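(* Let $p\colon\mathbb{R}^n\times\mathbb{R}^n\to\mathbb{R}$ be a (measurable) function, continuous in the second variable, such that $1<p^-\le p(x,y)\le p^+<\infty$ for all $x,y\in\mathbb{R}^n$ and some constants $p^-,p^+$. Let $a\colon\mathbb{R}^n\times\mathbb{R}^n\to\mathbb{R}$ be a (measurable) function, continuous in the second variable, such that $0<a_-\le a(x,y)\le a_+<\infty$ for all $x,y\in\mathbb{R}^n$ and some constants $a_-,a_+$. For $s\in(0,1)$ set $$\mathcal{J}_{s,p}(u)=\iint_{\mathbb{R}^n\times\mathbb{R}^n}a(x,y)\frac{|u(x)-u(y)|^{p(x,y)}}{|x-y|^{n+sp(x,y)}}\,dx\,dy.$$ Let $u\in W^{1,p^+}(\mathbb{R}^n)\cap W^{1,p^-}(\mathbb{R}^n)$. Then $$\lim_{s\uparrow1}(1-s)\,\mathcal{J}_{s,p}(u)=\int_{\mathbb{R}^n}H_0(x,|\nabla u(x)|)\,dx,$$ where $$H_0(x,t)=K_{n,p}(x)\,t^{p(x,x)},\qquad K_{n,p}(x)=\frac{a(x,x)}{p(x,x)}\int_{\mathbb{S}^{n-1}}|w_n|^{p(x,x)}\,dS_w.$$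
   Context: $n\ge1$ is an integer, $\mathbb{S}^{n-1}$ is the unit sphere of $\mathbb{R}^n$, $dS$ is its $(n-1)$-dimensional Hausdorff (surface) measure, and $w_n$ is the $n$-th coordinate of $w\in\mathbb{S}^{n-1}$. $W^{1,p}(\mathbb{R}^n)$ (for constant $p$) is the usual Sobolev space of real-valued functions. "Continuous in the second variable" means that $y\mapsto p(x,y)$ (respectively $y\mapsto a(x,y)$) is continuous for every $x\in\mathbb{R}^n$. *)

theory Defs
  imports "HOL-Analysis.Analysis"
begin

section \<open>Hausdorff measure\<close>

text \<open>
  Standard normalisation: a set of diameter \<open>r\<close> contributes the volume of a
  \<open>d\<close>-dimensional ball of diameter \<open>r\<close>, so that for \<open>d = 0\<close> one gets the counting
  measure. The empty set is treated separately because \<open>0 ^ 0 = 1\<close>; coverings by bounded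
  sets only, because \<open>diameter\<close> is unspecified on unbounded sets.
\<close>

definition hausdorff_weight :: "nat \<Rightarrow> 'a::metric_space set \<Rightarrow> ennreal" where
  "hausdorff_weight d U =
     (if U = {} then 0 else ennreal (unit_ball_vol (real d) * (diameter U / 2) ^ d))"

definition hausdorff_premeasure :: "nat \<Rightarrow> real \<Rightarrow> 'a::metric_space set \<Rightarrow> ennreal" where
  "hausdorff_premeasure d \<delta> A =
     (INF U \<in> {U :: nat \<Rightarrow> 'a set. A \<subseteq> (\<Union>i. U i) \<and> (\<forall>i. bounded (U i) \<and> diameter (U i) \<le> \<delta>)}.
        \<Sum>i. hausdorff_weight d (U i))"

definition hausdorff_outer :: "nat \<Rightarrow> 'a::metric_space set \<Rightarrow> ennreal" where
  "hausdorff_outer d A = (SUP \<delta> \<in> {0<..}. hausdorff_premeasure d \<delta> A)"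

definition hausdorff_measure :: "nat \<Rightarrow> 'a::metric_space measure" where
  "hausdorff_measure d = measure_of UNIV (sets borel) (hausdorff_outer d)"


section \<open>The Sobolev spaces $W^{1,q}(\mathbb{R}^n)$\<close>

definition partial_deriv :: "'n \<Rightarrow> (real ^ 'n::finite \<Rightarrow> real) \<Rightarrow> real ^ 'n \<Rightarrow> real" where
  "partial_deriv i \<phi> x = frechet_derivative \<phi> (at x) (axis i 1)"

primrec C_k :: "nat \<Rightarrow> (real ^ 'n::finite \<Rightarrow> real) \<Rightarrow> bool" where
  "C_k 0 \<phi> \<longleftrightarrow> continuous_on UNIV \<phi>"
| "C_k (Suc k) \<phi> \<longleftrightarrow> (\<forall>x. \<phi> differentiable (at x)) \<and> (\<forall>i. C_k k (partial_deriv i \<phi>))"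

definition test_function :: "(real ^ 'n::finite \<Rightarrow> real) \<Rightarrow> bool" where
  "test_function \<phi> \<longleftrightarrow> (\<forall>k. C_k k \<phi>) \<and> compact (closure {x. \<phi> x \<noteq> 0})"

definition locally_integrable ::
    "('a::euclidean_space \<Rightarrow> 'b::euclidean_space) \<Rightarrow> bool" where
  "locally_integrable f \<longleftrightarrow> (\<forall>K. compact K \<longrightarrow> set_integrable lebesgue K f)"

definition is_weak_gradient ::
    "(real ^ 'n::finite \<Rightarrow> real) \<Rightarrow> (real ^ 'n \<Rightarrow> real ^ 'n) \<Rightarrow> bool" where
  "is_weak_gradient u g \<longleftrightarrow> locally_integrable u \<and> locally_integrable g \<and>
     (\<forall>\<phi> i. test_function \<phi> \<longrightarrow>
        (LINT x|lebesgue. u x * partial_deriv i \<phi> x) = - (LINT x|lebesgue. g x $ i * \<phi> x))"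

text \<open>Some representative; weak gradients are unique up to a null set.\<close>

definition weak_gradient ::
    "(real ^ 'n::finite \<Rightarrow> real) \<Rightarrow> real ^ 'n \<Rightarrow> real ^ 'n" where
  "weak_gradient u = (SOME g. is_weak_gradient u g)"

definition Lebesgue_space ::
    "real \<Rightarrow> ('a::euclidean_space \<Rightarrow> 'b::euclidean_space) set" where
  "Lebesgue_space q =
     {f. f \<in> borel_measurable lebesgue \<and> integrable lebesgue (\<lambda>x. norm (f x) powr q)}"

definition Sobolev_space :: "real \<Rightarrow> (real ^ 'n::finite \<Rightarrow> real) set" where
  "Sobolev_space q =
     {u. u \<in> Lebesgue_space q \<and> (\<exists>g. is_weak_gradient u g \<and> g \<in> Lebesgue_space q)}"


section \<open>The energies\<close>

text \<open>
  The integrand is read as \<open>0\<close> on the null set \<open>x = y\<close>, by division by zero.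
\<close>

definition frac_energy ::
    "(real ^ 'n::finite \<Rightarrow> real ^ 'n \<Rightarrow> real) \<Rightarrow> (real ^ 'n \<Rightarrow> real ^ 'n \<Rightarrow> real) \<Rightarrow>
     real \<Rightarrow> (real ^ 'n \<Rightarrow> real) \<Rightarrow> ennreal" where
  "frac_energy a p s u =
     (\<integral>\<^sup>+ (x, y). ennreal (a x y * (\<bar>u x - u y\<bar> powr p x y
         / norm (x - y) powr (real CARD('n) + s * p x y))) \<partial>lebesgue)"

text \<open>
  The index type of \<open>real ^ 'n\<close> carries no order, so the coordinate playing the role of
  the last one is the parameter \<open>k\<close>.
\<close>

definition K_const ::
    "'n \<Rightarrow> (real ^ 'n::finite \<Rightarrow> real ^ 'n \<Rightarrow> real) \<Rightarrow> (real ^ 'n \<Rightarrow> real ^ 'n \<Rightarrow> real) \<Rightarrow>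
     real ^ 'n \<Rightarrow> real" where
  "K_const k a p x = a x x / p x x *
     (LINT w : sphere 0 1 | hausdorff_measure (CARD('n) - 1). \<bar>w $ k\<bar> powr p x x)"

definition H_0 ::
    "'n \<Rightarrow> (real ^ 'n::finite \<Rightarrow> real ^ 'n \<Rightarrow> real) \<Rightarrow> (real ^ 'n \<Rightarrow> real ^ 'n \<Rightarrow> real) \<Rightarrow>
     real ^ 'n \<Rightarrow> real \<Rightarrow> real" where
  "H_0 k a p x t = K_const k a p x * t powr p x x"

end

theory Submission
  imports Defs
begin

text \<open>
  Let \<open>n\<close> be the dimension, \<open>S\<close> the unit sphere and \<open>quot r w x = (u (x + r w) - u x) / r\<close> for
  \<open>r > 0\<close> and \<open>w \<in> S\<close>. Write \<open>y = x + r w\<close> in the energy (polar coordinates around \<open>x\<close>) and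
  substitute \<open>r = exp (- (\<tau> / (1 - s)))\<close>. The factor \<open>1 - s\<close> is exactly what the change from
  \<open>dr / r\<close> to \<open>d\<tau>\<close> consumes, and what remains is
  \<open>\<integral>\<^sub>S \<integral> \<integral> a x (x + r w) * \<bar>quot r w x\<bar> powr p x (x + r w) * exp (- (\<tau> * p x (x + r w))) dx d\<tau> dS\<close>
  with \<open>\<tau>\<close> ranging over the real line.
  The parameter \<open>s\<close> now occurs only through \<open>r\<close>, and as \<open>s\<close> increases to \<open>1\<close> we have \<open>r \<rightarrow> 0\<close>
  for \<open>\<tau> > 0\<close> and \<open>r \<rightarrow> \<infinity>\<close> for \<open>\<tau> < 0\<close>. So the limit can be taken inside the two outer integrals:

  For \<open>\<tau> > 0\<close> the difference quotients \<open>quot r w\<close> converge to the directional derivative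
  \<open>\<lambda>x. \<nabla>u x \<bullet> w\<close> in \<open>L\<^sup>q\<close> for both \<open>q = p_minus\<close> and \<open>q = p_plus\<close>, hence in the variable exponent modular,
  while \<open>p\<close> and \<open>a\<close> converge to their values on the diagonal by continuity in the second variable.
  For \<open>\<tau> < 0\<close> the quotient is \<open>1 / r\<close> times a difference of two translates of \<open>u\<close>, and the
  inner integral tends to \<open>0\<close>. In both cases it is, for \<open>s > 1 / 2\<close>, at most a constant times
  \<open>exp (- (p_minus * \<bar>\<tau>\<bar>)) + exp (- (p_plus * \<bar>\<tau>\<bar>))\<close>, so dominated convergence applies. In the
  limit, the integral of \<open>exp (- (\<tau> * p x x))\<close> over \<open>\<tau> > 0\<close> gives \<open>1 / p x x\<close>, and rotation
  invariance of the surface measure turns \<open>\<integral>\<bar>\<nabla>u x \<bullet> w\<bar> powr q\<close> into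
  \<open>norm (\<nabla>u x) powr q\<close> times the same integral of \<open>\<bar>w $ k\<bar> powr q\<close>. The lemmas that carry this
  argument are \<open>energy_polar\<close>, \<open>shifted_modular_quot_tendsto\<close>, \<open>shifted_modular_quot_envelope\<close> and
  \<open>limit_energy_integral\<close>.

  Two facts about the data have to be supplied. The first is the formula
  \<open>u (x + h) - u x = \<integral> \<nabla>u (x + t h) \<bullet> h dt\<close> over \<open>{0..1}\<close>, for every \<open>h\<close> and almost every \<open>x\<close>
  (\<open>weak_gradient_line\<close>). It holds because both sides have the same integral against every test
  function. With Jensen's inequality and the continuity of translations in \<open>L\<^sup>q\<close> it gives the
  bounds and the convergence of the difference quotients.

  The second concerns the surface measure. Polar coordinates hold almost by definition for the
  cone measure, which assigns to a set of directions \<open>n\<close> times the volume of the cone over it. The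
  constant in the limit is an integral with respect to the \<open>(n - 1)\<close>-dimensional Hausdorff
  measure, so the two measures must be shown to agree on the sphere, normalisation included
  (\<open>hausdorff_measure_sphere\<close>). That the cone measure is at most the Hausdorff measure is the
  isodiametric inequality, carried to small pieces of the sphere by central projection, which is
  almost isometric there. The converse is needed for the whole sphere only, where it follows from
  Vitali's covering lemma.
\<close>

section \<open>Hausdorff measure as a Borel measure\<close>

lemma hausdorff_premeasure_le:
  assumes "A \<subseteq> (\<Union>i. U i)" "\<And>i. bounded (U i)" "\<And>i. diameter (U i) \<le> \<delta>"
  shows "hausdorff_premeasure d \<delta> A \<le> (\<Sum>i. hausdorff_weight d (U i))"
  unfolding hausdorff_premeasure_def using assms by (intro INF_lower) auto

lemma hausdorff_premeasure_mono:
  "A \<subseteq> B \<Longrightarrow> hausdorff_premeasure d \<delta> A \<le> hausdorff_premeasure d \<delta> B"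
  unfolding hausdorff_premeasure_def by (intro INF_superset_mono) auto

lemma hausdorff_premeasure_antimono:
  "\<delta> \<le> \<delta>' \<Longrightarrow> hausdorff_premeasure d \<delta>' A \<le> hausdorff_premeasure d \<delta> A"
  unfolding hausdorff_premeasure_def by (intro INF_superset_mono) (auto intro: order_trans)

lemma hausdorff_outer_mono: "A \<subseteq> B \<Longrightarrow> hausdorff_outer d A \<le> hausdorff_outer d B"
  unfolding hausdorff_outer_def by (intro SUP_mono) (auto intro: hausdorff_premeasure_mono)

lemma hausdorff_premeasure_le_outer:
  "0 < \<delta> \<Longrightarrow> hausdorff_premeasure d \<delta> A \<le> hausdorff_outer d A"
  unfolding hausdorff_outer_def by (intro SUP_upper) auto

lemma hausdorff_outer_empty [simp]: "hausdorff_outer d {} = 0"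
proof -
  have "hausdorff_premeasure d \<delta> ({}::'a::metric_space set) = 0" if "\<delta> > 0" for \<delta>
    using hausdorff_premeasure_le[of "{}" "\<lambda>_. {} :: 'a set" \<delta> d] that
    by (simp add: hausdorff_weight_def)
  then show ?thesis unfolding hausdorff_outer_def by (auto intro!: SUP_eq_const simp: bot_ennreal)
qed

text \<open>
  Near-optimal coverings of the single sets, with errors \<open>e / 2, e / 4, \<dots>\<close>, are enumerated
  into one sequence.
\<close>

lemma hausdorff_premeasure_UN:
  fixes A :: "nat \<Rightarrow> 'a::metric_space set"
  shows "hausdorff_premeasure d \<delta> (\<Union>i. A i) \<le> (\<Sum>i. hausdorff_premeasure d \<delta> (A i))"
proof (rule ennreal_le_epsilon)
  let ?O = "hausdorff_premeasure d \<delta>"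
  let ?f = "hausdorff_weight d"
  fix e :: real assume "0 < e" "(\<Sum>n. ?O (A n)) < top"
  then have *: "?O (A n) < ?O (A n) + e * (1/2)^Suc n" for n
    by (auto simp add: less_top dest!: ennreal_suminf_lessD)
  have "\<exists>U. A n \<subseteq> (\<Union>i. U i) \<and> (\<forall>i. bounded (U i) \<and> diameter (U i) \<le> \<delta>) \<and>
      (\<Sum>i. ?f (U i)) < ?O (A n) + e * (1/2)^Suc n" for n
    using *[of n] by (subst (asm) hausdorff_premeasure_def) (auto simp: INF_less_iff)
  then obtain B where sbB: "\<And>n. A n \<subseteq> (\<Union>i. B n i)"
    and B: "\<And>n i. bounded (B n i) \<and> diameter (B n i) \<le> \<delta>"
    and Ble: "\<And>n. (\<Sum>i. ?f (B n i)) < ?O (A n) + e * (1/2)^(Suc n)"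
    by metis
  define C where "C = case_prod B o prod_decode"
  have A_C: "(\<Union>i. A i) \<subseteq> (\<Union>i. C i)"
    using sbB by (auto simp add: C_def subset_eq) (metis prod.case prod_encode_inverse)
  have "?O (\<Union>i. A i) \<le> (\<Sum>i. ?f (C i))"
    using B by (intro hausdorff_premeasure_le[OF A_C]) (auto simp: C_def split: prod.splits)
  also have "\<dots> = (\<Sum>i. (\<lambda>(m,n). ?f (B m n)) (prod_decode i))"
    by (simp add: C_def case_prod_beta)
  also have "\<dots> = (\<Sum>n. \<Sum>i. ?f (B n i))"
    by (intro suminf_ennreal_2dimen) auto
  also have "\<dots> \<le> (\<Sum>n. ?O (A n) + e * (1/2) ^ Suc n)"
    by (intro suminf_le suminf_nonneg allI less_imp_le[OF Ble]) auto
  also have "... = (\<Sum>n. ?O (A n)) + (\<Sum>n. ennreal e * ennreal ((1/2) ^ Suc n))"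
    using \<open>0 < e\<close> by (subst suminf_add[symmetric])
                     (auto simp del: ennreal_suminf_cmult simp add: ennreal_mult[symmetric])
  also have "\<dots> = (\<Sum>n. ?O (A n)) + e"
    unfolding ennreal_suminf_cmult
    by (subst suminf_ennreal_eq[OF zero_le_power power_half_series]) auto
  finally show "?O (\<Union>i. A i) \<le> (\<Sum>n. ?O (A n)) + e" .
qed

lemma hausdorff_outer_UN:
  fixes A :: "nat \<Rightarrow> 'a::metric_space set"
  shows "hausdorff_outer d (\<Union>i. A i) \<le> (\<Sum>i. hausdorff_outer d (A i))"
  unfolding hausdorff_outer_def[of d "\<Union>i. A i"]
proof (rule SUP_least)
  fix \<delta> :: real assume "\<delta> \<in> {0<..}"
  then show "hausdorff_premeasure d \<delta> (\<Union>i. A i) \<le> (\<Sum>i. hausdorff_outer d (A i))"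
    by (intro order_trans[OF hausdorff_premeasure_UN] suminf_le hausdorff_premeasure_le_outer) auto
qed

lemma hausdorff_outer_space: "outer_measure_space UNIV (hausdorff_outer d)"
  by (auto simp: outer_measure_space_def positive_def increasing_def countably_subadditive_def
      hausdorff_outer_mono hausdorff_outer_UN)

lemma hausdorff_outer_Un:
  "hausdorff_outer d (A \<union> B) \<le> hausdorff_outer d A + hausdorff_outer d B"
proof -
  let ?C = "\<lambda>i::nat. if i = 0 then A else if i = 1 then B else {}"
  have "A \<union> B = (\<Union>i. ?C i)" by (auto split: if_splits)
  then have "hausdorff_outer d (A \<union> B) \<le> (\<Sum>i. hausdorff_outer d (?C i))"
    using hausdorff_outer_UN[of d ?C] by simp
  also have "\<dots> = (\<Sum>i\<in>{0,1}. hausdorff_outer d (?C i))"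
    by (rule suminf_finite) auto
  finally show ?thesis by simp
qed

text \<open>
  A set of diameter less than \<open>\<eta>\<close> cannot meet both \<open>A\<close> and \<open>B\<close>. So a fine covering of the
  union splits into a covering of \<open>A\<close> and one of \<open>B\<close>.
\<close>

lemma hausdorff_outer_Un_separated:
  fixes A B :: "'a::metric_space set"
  assumes \<eta>: "0 < \<eta>" and sep: "\<And>x y. x \<in> A \<Longrightarrow> y \<in> B \<Longrightarrow> \<eta> \<le> dist x y"
  shows "hausdorff_outer d A + hausdorff_outer d B \<le> hausdorff_outer d (A \<union> B)"
proof -
  have fine: "hausdorff_premeasure d \<delta> A + hausdorff_premeasure d \<delta> B \<le> hausdorff_outer d (A \<union> B)"
    if \<delta>: "0 < \<delta>" "\<delta> < \<eta>" for \<delta>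
  proof -
    have "hausdorff_premeasure d \<delta> A + hausdorff_premeasure d \<delta> B \<le> (\<Sum>i. hausdorff_weight d (U i))"
      if U: "A \<union> B \<subseteq> (\<Union>i. U i)" "\<And>i. bounded (U i)" "\<And>i. diameter (U i) \<le> \<delta>" for U :: "nat \<Rightarrow> 'a set"
    proof -
      let ?UA = "\<lambda>i. if U i \<inter> A = {} then {} else U i"
      let ?UB = "\<lambda>i. if U i \<inter> A = {} then U i else {}"
      have no: "U i \<inter> A = {} \<or> U i \<inter> B = {}" for i
      proof (rule ccontr)
        assume "\<not> ?thesis"
        then obtain x y where xy: "x \<in> U i" "x \<in> A" "y \<in> U i" "y \<in> B" by auto
        then have "dist x y \<le> \<delta>" using diameter_bounded_bound[OF U(2) xy(1,3)] U(3)[of i] by simp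
        then show False using sep[OF xy(2,4)] \<delta> by simp
      qed
      have 1: "hausdorff_premeasure d \<delta> A \<le> (\<Sum>i. hausdorff_weight d (?UA i))"
      proof (rule hausdorff_premeasure_le)
        show "A \<subseteq> (\<Union>i. ?UA i)" using U(1) by fastforce
      qed (use U \<delta> in auto)
      have 2: "hausdorff_premeasure d \<delta> B \<le> (\<Sum>i. hausdorff_weight d (?UB i))"
      proof (rule hausdorff_premeasure_le)
        show "B \<subseteq> (\<Union>i. ?UB i)"
        proof
          fix x assume x: "x \<in> B"
          then obtain i where "x \<in> U i" using U(1) by auto
          then show "x \<in> (\<Union>i. ?UB i)" using no[of i] x by (intro UN_I[of i]) auto
        qed
      qed (use U \<delta> in auto)
      have 3: "(\<Sum>i. hausdorff_weight d (?UA i)) + (\<Sum>i. hausdorff_weight d (?UB i))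
          = (\<Sum>i. hausdorff_weight d (U i))"
        by (subst suminf_add) (auto intro!: suminf_cong simp: hausdorff_weight_def)
      show ?thesis using add_mono[OF 1 2] unfolding 3 .
    qed
    then have "hausdorff_premeasure d \<delta> A + hausdorff_premeasure d \<delta> B \<le> hausdorff_premeasure d \<delta> (A \<union> B)"
      unfolding hausdorff_premeasure_def[of d \<delta> "A \<union> B"] by (intro INF_greatest) auto
    also have "\<dots> \<le> hausdorff_outer d (A \<union> B)"
      using \<delta> by (rule_tac hausdorff_premeasure_le_outer)
    finally show ?thesis .
  qed
  have "hausdorff_premeasure d \<delta>1 A + hausdorff_premeasure d \<delta>2 B \<le> hausdorff_outer d (A \<union> B)"
    if "0 < \<delta>1" "0 < \<delta>2" for \<delta>1 \<delta>2
  proof -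
    let ?\<delta> = "min (min \<delta>1 \<delta>2) (\<eta>/2)"
    have "hausdorff_premeasure d \<delta>1 A + hausdorff_premeasure d \<delta>2 B
        \<le> hausdorff_premeasure d ?\<delta> A + hausdorff_premeasure d ?\<delta> B"
      by (intro add_mono hausdorff_premeasure_antimono) auto
    also have "\<dots> \<le> hausdorff_outer d (A \<union> B)" using that \<eta> by (intro fine) auto
    finally show ?thesis .
  qed
  then have "(SUP \<delta>\<in>{0<..}. SUP \<delta>'\<in>{0<..}. hausdorff_premeasure d \<delta> A + hausdorff_premeasure d \<delta>' B)
      \<le> hausdorff_outer d (A \<union> B)"
    by (intro SUP_least) simp
  then show ?thesis
    unfolding hausdorff_outer_def[of d A] hausdorff_outer_def[of d B]
    by (simp add: ennreal_SUP_add_left ennreal_SUP_add_right[symmetric])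
qed

text \<open>
  The part of \<open>T\<close> at distance at least \<open>1 / (k + 1)\<close>
  from \<open>F\<close> is separated from \<open>F\<close>, so only the shells \<open>B j\<close> with \<open>j \<ge> k\<close> are left to control.
  Shells whose indices differ by two are separated from each other, which bounds the sum over the
  even and over the odd shells by the measure of \<open>T\<close>. The sum over all shells therefore converges,
  and it can be cancelled after letting \<open>k\<close> tend to infinity.
\<close>

lemma hausdorff_outer_closed_split:
  fixes F T :: "'a::metric_space set"
  assumes F: "closed F"
  shows "hausdorff_outer d (F \<inter> T) + hausdorff_outer d (T - F) \<le> hausdorff_outer d T"
proof (cases "F = {} \<or> hausdorff_outer d T = \<infinity>")
  case True
  then show ?thesis by auto
next
  case False
  then have ne: "F \<noteq> {}" and fin: "hausdorff_outer d T < \<infinity>" by (auto simp: less_top)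
  let ?O = "hausdorff_outer d"
  define D where "D x = infdist x F" for x
  have D_lip: "D x \<le> D y + dist x y" for x y unfolding D_def by (rule infdist_triangle)
  have D_sep: "s - t \<le> dist x y" if "D x \<ge> s" "D y \<le> t" for s t x y
    using D_lip[of x y] that by linarith
  have D0: "D x = 0" if "x \<in> F" for x unfolding D_def using that by simp
  have Dpos: "D x > 0" if "x \<notin> F" for x
    unfolding D_def using that F ne by (metis infdist_nonneg in_closed_iff_infdist_zero less_le)
  define A where "A k = {x \<in> T. 1 / real (k+1) \<le> D x}" for k
  define B where "B k = {x \<in> T. 1 / real (k+2) \<le> D x \<and> D x < 1 / real (k+1)}" for k
  have i: "?O (F \<inter> T) + ?O (A k) \<le> ?O T" for k
  proof -
    have "?O (F \<inter> T) + ?O (A k) \<le> ?O ((F \<inter> T) \<union> A k)"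
    proof (rule hausdorff_outer_Un_separated[where \<eta> = "1 / real (k+1)"])
      fix x y assume "x \<in> F \<inter> T" "y \<in> A k"
      then show "1 / real (k+1) \<le> dist x y"
        using D_sep[of "1 / real (k+1)" y x 0] D0 by (auto simp: A_def dist_commute)
    qed simp
    also have "\<dots> \<le> ?O T" by (rule hausdorff_outer_mono) (auto simp: A_def)
    finally show ?thesis .
  qed
  have ii: "(\<Sum>k<m. ?O (B (2*k+j))) \<le> ?O (\<Union>k<m. B (2*k+j))" for m j
  proof (induction m)
    case (Suc m)
    have "(\<Sum>k<Suc m. ?O (B (2*k+j))) \<le> ?O (\<Union>k<m. B (2*k+j)) + ?O (B (2*m+j))"
      using Suc by (simp add: add_mono)
    also have "\<dots> \<le> ?O ((\<Union>k<m. B (2*k+j)) \<union> B (2*m+j))"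
    proof (cases "m = 0")
      case False
      show ?thesis
      proof (rule hausdorff_outer_Un_separated[where \<eta> = "1 / real (2*m+j) - 1 / real (2*m+j+1)"])
        show "0 < 1 / real (2*m+j) - 1 / real (2*m+j+1)"
          using False by (auto intro!: divide_strict_left_mono)
        fix x y assume "x \<in> (\<Union>k<m. B (2*k+j))" and y: "y \<in> B (2*m+j)"
        then obtain k where k: "k < m" "x \<in> B (2*k+j)" by auto
        have "1 / real (2*m+j) \<le> 1 / real (2*k+j+2)" using k by (intro divide_left_mono) auto
        also have "\<dots> \<le> D x" using k by (auto simp: B_def)
        finally show "1 / real (2*m+j) - 1 / real (2*m+j+1) \<le> dist x y"
          using y by (intro D_sep) (auto simp: B_def)
      qed
    qed simp
    also have "\<dots> = ?O (\<Union>k<Suc m. B (2*k+j))"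
      by (simp add: lessThan_Suc Un_commute)
    finally show ?case .
  qed simp
  have ii': "(\<Sum>k<m. ?O (B (2*k+j))) \<le> ?O T" for m j
    by (rule order_trans[OF ii hausdorff_outer_mono]) (auto simp: B_def)
  have split: "(\<Sum>k<2*m. f k) = (\<Sum>k<m. f (2*k)) + (\<Sum>k<m. f (2*k+1))" for f :: "nat \<Rightarrow> ennreal" and m
    by (induction m) (auto simp: algebra_simps)
  have iii: "(\<Sum>k. ?O (B k)) \<le> ?O T + ?O T"
  proof (rule suminf_le_const)
    fix n
    have "(\<Sum>k<n. ?O (B k)) \<le> (\<Sum>k<2*n. ?O (B k))" by (intro sum_mono2) auto
    also have "\<dots> \<le> ?O T + ?O T"
      unfolding split using ii'[of 0 n] ii'[of 1 n] by (intro add_mono) auto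
    finally show "(\<Sum>k<n. ?O (B k)) \<le> ?O T + ?O T" .
  qed simp
  have iv: "T - F \<subseteq> A k \<union> (\<Union>j. B (j+k))" for k
  proof
    fix x assume x: "x \<in> T - F"
    then have Dx: "D x > 0" using Dpos by auto
    define N where "N = (LEAST N. 1 / real (N+1) \<le> D x)"
    obtain N0 where "1 / real (Suc N0) < D x" using nat_approx_posE[OF Dx] by blast
    then have ex: "1 / real (N0+1) \<le> D x" by simp
    have N: "1 / real (N+1) \<le> D x" unfolding N_def by (rule LeastI[of _ N0]) (use ex in simp)
    show "x \<in> A k \<union> (\<Union>j. B (j+k))"
    proof (cases "N \<le> k")
      case True
      then have "1 / real (k+1) \<le> 1 / real (N+1)" by (intro divide_left_mono) auto
      then show ?thesis using N x by (auto simp: A_def)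
    next
      case False
      then obtain M where M: "N = Suc M" by (cases N) auto
      have "\<not> 1 / real (M+1) \<le> D x"
        using not_less_Least[of M "\<lambda>N. 1 / real (N+1) \<le> D x"] M unfolding N_def by simp
      then have "x \<in> B M" using N M x by (auto simp: B_def)
      moreover have "M = (M - k) + k" using False M by simp
      ultimately show ?thesis by (metis UN_I UnI2 UNIV_I)
    qed
  qed
  have v: "?O (F \<inter> T) + ?O (T - F) + (\<Sum>j<k. ?O (B j)) \<le> ?O T + (\<Sum>j. ?O (B j))" for k
  proof -
    have "?O (T - F) \<le> ?O (A k) + ?O (\<Union>j. B (j+k))"
      by (rule order_trans[OF hausdorff_outer_mono[OF iv] hausdorff_outer_Un])
    also have "\<dots> \<le> ?O (A k) + (\<Sum>j. ?O (B (j+k)))"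
      by (intro add_left_mono hausdorff_outer_UN)
    finally have "?O (F \<inter> T) + ?O (T - F) + (\<Sum>j<k. ?O (B j)) \<le>
        ?O (F \<inter> T) + (?O (A k) + (\<Sum>j. ?O (B (j+k)))) + (\<Sum>j<k. ?O (B j))"
      by (intro add_left_mono add_right_mono)
    also have "\<dots> = (?O (F \<inter> T) + ?O (A k)) + ((\<Sum>j. ?O (B (j+k))) + (\<Sum>j<k. ?O (B j)))"
      by (simp add: ac_simps)
    also have "(\<Sum>j. ?O (B (j+k))) + (\<Sum>j<k. ?O (B j)) = (\<Sum>j. ?O (B j))"
      using suminf_offset[of "\<lambda>j. ?O (B j)" k] by (simp add: add.commute)
    finally show ?thesis by (rule order_trans[OF _ add_right_mono[OF i[of k]]])
  qed
  have S: "(\<Sum>j. ?O (B j)) < \<infinity>" using fin by (intro le_less_trans[OF iii]) (auto simp: less_top)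
  have "(SUP k. ?O (F \<inter> T) + ?O (T - F) + (\<Sum>j<k. ?O (B j))) \<le> ?O T + (\<Sum>j. ?O (B j))"
    by (intro SUP_least v)
  then have "?O (F \<inter> T) + ?O (T - F) + (\<Sum>j. ?O (B j)) \<le> ?O T + (\<Sum>j. ?O (B j))"
    by (simp add: ennreal_SUP_add_right[symmetric] suminf_eq_SUP)
  then show ?thesis using S by (simp add: add.commute[of _ "\<Sum>j. ?O (B j)"] ennreal_add_left_cancel_le) auto
qed

text \<open>
  The sets that satisfy the Caratheodory condition form a sigma algebra, and the Borel sets are
  the smallest sigma algebra that contains the closed sets.
\<close>

lemma borel_subset_hausdorff_lambda_system:
  "sets borel \<subseteq> lambda_system UNIV UNIV (hausdorff_outer d :: 'a::metric_space set \<Rightarrow> _)"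
proof -
  interpret sigma_algebra "UNIV :: 'a set" UNIV using sigma_algebra_Pow[of "UNIV :: 'a set"] by simp
  let ?L = "lambda_system UNIV UNIV (hausdorff_outer d :: 'a set \<Rightarrow> _)"
  have ms: "measure_space UNIV ?L (hausdorff_outer d)"
    by (rule caratheodory_lemma[OF hausdorff_outer_space])
  then interpret L: sigma_algebra UNIV ?L by (simp add: measure_space_def)
  have "{S :: 'a set. closed S} \<subseteq> ?L"
  proof
    fix F :: "'a set" assume "F \<in> {S. closed S}"
    then have F: "closed F" by simp
    have "hausdorff_outer d (F \<inter> x) + hausdorff_outer d ((UNIV - F) \<inter> x) = hausdorff_outer d x" for x
    proof (rule antisym)
      have e: "(UNIV - F) \<inter> x = x - F" by auto
      show "hausdorff_outer d (F \<inter> x) + hausdorff_outer d ((UNIV - F) \<inter> x) \<le> hausdorff_outer d x"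
        unfolding e by (rule hausdorff_outer_closed_split[OF F])
      have "x = (F \<inter> x) \<union> ((UNIV - F) \<inter> x)" by auto
      then show "hausdorff_outer d x \<le> hausdorff_outer d (F \<inter> x) + hausdorff_outer d ((UNIV - F) \<inter> x)"
        using hausdorff_outer_Un by metis
    qed
    then show "F \<in> ?L" by (simp add: lambda_system_def)
  qed
  then have "sigma_sets UNIV {S :: 'a set. closed S} \<subseteq> ?L" by (rule L.sigma_sets_subset)
  then show ?thesis unfolding borel_eq_closed by simp
qed

lemma sets_hausdorff_measure [simp, measurable_cong]: "sets (hausdorff_measure d) = sets borel"
  unfolding hausdorff_measure_def
  by (metis sets.sigma_sets_eq sets_measure_of space_borel top_greatest Pow_UNIV)

lemma space_hausdorff_measure [simp]: "space (hausdorff_measure d) = UNIV"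
  using sets_eq_imp_space_eq[OF sets_hausdorff_measure] by simp

lemma emeasure_hausdorff_measure:
  assumes A: "A \<in> sets borel"
  shows "emeasure (hausdorff_measure d) A = hausdorff_outer d A"
proof -
  interpret sigma_algebra "UNIV :: 'a set" UNIV using sigma_algebra_Pow[of "UNIV :: 'a set"] by simp
  have "measure_space UNIV (sets borel) (hausdorff_outer d :: 'a set \<Rightarrow> _)"
    by (rule measure_down[OF caratheodory_lemma[OF hausdorff_outer_space, of d] _
          borel_subset_hausdorff_lambda_system]) (metis sets.sigma_algebra_axioms space_borel)
  then have "positive (sets (hausdorff_measure d)) (hausdorff_outer d :: 'a set \<Rightarrow> _)"
    "countably_additive (sets (hausdorff_measure d)) (hausdorff_outer d :: 'a set \<Rightarrow> _)"
    by (auto simp: measure_space_def)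
  then show ?thesis
    using A by (subst emeasure_measure_of[OF hausdorff_measure_def]) auto
qed


section \<open>The isodiametric inequality\<close>

abbreviation lborel_PiM :: "'i set \<Rightarrow> ('i \<Rightarrow> real) measure" where
  "lborel_PiM I \<equiv> Pi\<^sub>M I (\<lambda>_. lborel)"

text \<open>
  The convex hulls of \<open>X\<close> and \<open>Y\<close> are intervals, and the sum of their lengths is
  \<open>(Sup X - Inf Y) + (Sup Y - Inf X)\<close>. Each of these two differences is a limit of differences
  of points of \<open>X\<close> and \<open>Y\<close>.
\<close>

lemma emeasure_lborel_pair_diameter:
  fixes X Y :: "real set"
  assumes "X \<noteq> {}" "Y \<noteq> {}" and dist: "\<And>a b. a \<in> X \<Longrightarrow> b \<in> Y \<Longrightarrow> \<bar>a - b\<bar> \<le> c"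
  shows "emeasure lborel X + emeasure lborel Y \<le> ennreal (2 * c)"
proof -
  obtain a0 b0 where ab: "a0 \<in> X" "b0 \<in> Y" using assms by auto
  have c: "c \<ge> 0" using dist[OF ab] by linarith
  have bX: "bdd_above X" "bdd_below X"
    using dist[OF _ ab(2)] by (auto intro!: bdd_aboveI[of _ "b0 + c"] bdd_belowI[of _ "b0 - c"]) (smt (verit))+
  have bY: "bdd_above Y" "bdd_below Y"
    using dist[OF ab(1)] by (auto intro!: bdd_aboveI[of _ "a0 + c"] bdd_belowI[of _ "a0 - c"]) (smt (verit))+
  have XY: "Sup X \<le> Inf Y + c"
  proof (rule cSup_least[OF assms(1)])
    fix a assume a: "a \<in> X"
    have "a - c \<le> Inf Y" by (rule cInf_greatest[OF assms(2)]) (use dist[OF a] in \<open>smt (verit)\<close>)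
    then show "a \<le> Inf Y + c" by simp
  qed
  have YX: "Sup Y \<le> Inf X + c"
  proof (rule cSup_least[OF assms(2)])
    fix b assume b: "b \<in> Y"
    have "b - c \<le> Inf X" by (rule cInf_greatest[OF assms(1)]) (use dist[OF _ b] in \<open>smt (verit)\<close>)
    then show "b \<le> Inf X + c" by simp
  qed
  have iX: "Inf X \<le> Sup X" and iY: "Inf Y \<le> Sup Y"
    using assms bX bY by (auto intro: cInf_le_cSup)
  have "emeasure lborel X \<le> emeasure lborel {Inf X .. Sup X}"
    by (rule emeasure_mono) (use bX in \<open>auto intro: cInf_lower cSup_upper\<close>)
  moreover have "emeasure lborel Y \<le> emeasure lborel {Inf Y .. Sup Y}"
    by (rule emeasure_mono) (use bY in \<open>auto intro: cInf_lower cSup_upper\<close>)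
  ultimately have "emeasure lborel X + emeasure lborel Y
      \<le> ennreal (Sup X - Inf X) + ennreal (Sup Y - Inf Y)"
    using iX iY by (intro add_mono) auto
  also have "\<dots> = ennreal ((Sup X - Inf X) + (Sup Y - Inf Y))"
    using iX iY by (simp add: ennreal_plus[symmetric] del: ennreal_plus)
  also have "\<dots> \<le> ennreal (2 * c)" using XY YX by (intro ennreal_leI) linarith
  finally show ?thesis .
qed

text \<open>
  Steiner symmetrisation in the direction \<open>i\<close>: every slice of \<open>A\<close> parallel to the axis \<open>i\<close> is
  replaced by the open interval centred at \<open>0\<close> of the same length \<open>m x\<close>. The measure is kept by
  Fubini, and the bound on the diameter by the comparison of two slices above. As the length of a
  slice inherits the reflection symmetries of \<open>A\<close> in the other coordinates, the symmetries can be
  accumulated one coordinate at a time. Working with products over a finite index set, and not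
  with a Euclidean type, makes the dimension a variable: it will be one less than that of the
  ambient space.
\<close>

lemma steiner_symmetrisation:
  fixes A :: "('i \<Rightarrow> real) set"
  assumes fin: "finite I" and i: "i \<in> I" and A: "A \<in> sets (lborel_PiM I)"
    and diam: "\<And>x y. x \<in> A \<Longrightarrow> y \<in> A \<Longrightarrow> (\<Sum>j\<in>I. (x j - y j)\<^sup>2) \<le> c"
  shows "\<exists>B\<in>sets (lborel_PiM I). emeasure (lborel_PiM I) B = emeasure (lborel_PiM I) A \<and>
    (\<forall>x\<in>B. \<forall>y\<in>B. (\<Sum>j\<in>I. (x j - y j)\<^sup>2) \<le> c) \<and>
    (\<forall>x\<in>B. x(i := - x i) \<in> B) \<and>
    (\<forall>j\<in>I. (\<forall>x\<in>A. x(j := - x j) \<in> A) \<longrightarrow> (\<forall>x\<in>B. x(j := - x j) \<in> B))"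
proof -
  interpret product_sigma_finite "\<lambda>_::'i. lborel :: real measure" by standard
  let ?P = "lborel_PiM I"
  define m where "m x = emeasure lborel {t. x(i := t) \<in> A}" for x :: "'i \<Rightarrow> real"
  define B where "B = {x \<in> space ?P. ennreal (2 * \<bar>x i\<bar>) < m x}"
  have sp: "x \<in> space ?P \<longleftrightarrow> x \<in> extensional I" for x by (auto simp: space_PiM PiE_def)
  have upd_meas: "(\<lambda>w. (fst w)(i := snd w)) \<in> ?P \<Otimes>\<^sub>M lborel \<rightarrow>\<^sub>M ?P"
  proof (rule measurable_PiM_single')
    fix j assume j: "j \<in> I"
    show "(\<lambda>w. ((fst w)(i := snd w)) j) \<in> ?P \<Otimes>\<^sub>M lborel \<rightarrow>\<^sub>M lborel"
      using j by (cases "j = i") (auto simp: case_prod_beta)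
  qed (use i in \<open>auto simp: space_pair_measure space_PiM PiE_def extensional_def\<close>)
  have Q: "(\<lambda>w. (fst w)(i := snd w)) -` A \<inter> space (?P \<Otimes>\<^sub>M lborel) \<in> sets (?P \<Otimes>\<^sub>M lborel)"
    by (rule measurable_sets[OF upd_meas A])
  have m_eq: "m x = emeasure lborel (Pair x -` ((\<lambda>w. (fst w)(i := snd w)) -` A \<inter> space (?P \<Otimes>\<^sub>M lborel)))"
    if "x \<in> space ?P" for x
    unfolding m_def by (rule arg_cong[where f="emeasure lborel"]) (use that in \<open>auto simp: space_pair_measure\<close>)
  have m_meas[measurable]: "m \<in> borel_measurable ?P"
    using lborel.measurable_emeasure_Pair[OF Q] by (subst measurable_cong[OF m_eq])
  have B_meas: "B \<in> sets ?P"
    unfolding B_def using i by measurable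
  have m_upd: "m (x(i := t)) = m x" for x t by (simp add: m_def)
  have slice: "emeasure lborel {t. ennreal (2 * \<bar>t\<bar>) < c} = c" for c :: ennreal
  proof (cases c)
    case (real r)
    have "{t. ennreal (2 * \<bar>t\<bar>) < c} = {- (r/2) <..< r/2}"
      using real by (auto simp: ennreal_less_iff)
    then show ?thesis using real by simp
  next
    case top
    then show ?thesis by simp
  qed
  obtain J where J: "I = insert i J" "i \<notin> J" using i by (meson mk_disjoint_insert)
  then have finJ: "finite J" using fin by simp
  have em: "emeasure ?P C = (\<integral>\<^sup>+ x. emeasure lborel {t. x(i := t) \<in> C} \<partial>lborel_PiM J)"
    if C: "C \<in> sets ?P" for C
  proof -
    have "emeasure ?P C = (\<integral>\<^sup>+ x. indicator C x \<partial>?P)" using C by simp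
    also have "\<dots> = (\<integral>\<^sup>+ x. (\<integral>\<^sup>+ t. indicator C (x(i := t)) \<partial>lborel) \<partial>lborel_PiM J)"
      using C unfolding J(1) by (subst product_nn_integral_insert[OF finJ J(2)]) auto
    also have "\<dots> = (\<integral>\<^sup>+ x. emeasure lborel {t. x(i := t) \<in> C} \<partial>lborel_PiM J)"
    proof (rule nn_integral_cong)
      fix x assume x: "x \<in> space (lborel_PiM J)"
      have "(\<lambda>t. x(i := t)) \<in> lborel \<rightarrow>\<^sub>M ?P"
        unfolding J(1)
      proof (rule measurable_PiM_single')
        fix j show "(\<lambda>t. (x(i := t)) j) \<in> lborel \<rightarrow>\<^sub>M lborel" by (cases "j = i") auto
      qed (use x in \<open>auto simp: space_PiM PiE_def extensional_def\<close>)
      then have "(\<lambda>t. x(i := t)) -` C \<inter> space lborel \<in> sets lborel" using C by (rule measurable_sets)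
      then have "{t. x(i := t) \<in> C} \<in> sets lborel" by (simp add: vimage_def)
      then have "emeasure lborel {t. x(i := t) \<in> C} = (\<integral>\<^sup>+ t. indicator {t. x(i := t) \<in> C} t \<partial>lborel)"
        by (subst nn_integral_indicator) auto
      also have "\<dots> = (\<integral>\<^sup>+ t. indicator C (x(i := t)) \<partial>lborel)"
        by (intro nn_integral_cong) (auto simp: indicator_def)
      finally show "(\<integral>\<^sup>+ t. indicator C (x(i := t)) \<partial>lborel) = emeasure lborel {t. x(i := t) \<in> C}" by simp
    qed
    finally show ?thesis .
  qed
  have B_em: "emeasure ?P B = emeasure ?P A"
    unfolding em[OF B_meas] em[OF A]
  proof (rule nn_integral_cong)
    fix x assume "x \<in> space (lborel_PiM J)"
    then have "x(i := t) \<in> space ?P" for t unfolding sp by (auto simp: J(1) space_PiM PiE_def extensional_def)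
    then have "{t. x(i := t) \<in> B} = {t. ennreal (2 * \<bar>t\<bar>) < m x}" by (auto simp: B_def m_upd)
    then show "emeasure lborel {t. x(i := t) \<in> B} = emeasure lborel {t. x(i := t) \<in> A}"
      by (simp only: slice) (simp add: m_def)
  qed
  have split: "(\<Sum>j\<in>I. (x j - y j)\<^sup>2) = (x i - y i)\<^sup>2 + (\<Sum>j\<in>J. (x j - y j)\<^sup>2)" for x y :: "'i \<Rightarrow> real"
    using J finJ by simp
  have B_diam: "(\<Sum>j\<in>I. (x j - y j)\<^sup>2) \<le> c" if x: "x \<in> B" and y: "y \<in> B" for x y
  proof -
    let ?X = "{t. x(i := t) \<in> A}" and ?Y = "{t. y(i := t) \<in> A}"
    have mx: "ennreal (2 * \<bar>x i\<bar>) < emeasure lborel ?X" and my: "ennreal (2 * \<bar>y i\<bar>) < emeasure lborel ?Y"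
      using x y by (auto simp: B_def m_def)
    have ne: "?X \<noteq> {}" "?Y \<noteq> {}" using mx my by force+
    have "\<exists>a\<in>?X. \<exists>b\<in>?Y. \<bar>x i - y i\<bar> \<le> \<bar>a - b\<bar>"
    proof (rule ccontr)
      assume "\<not> ?thesis"
      then have "\<bar>a - b\<bar> \<le> \<bar>x i - y i\<bar>" if "a \<in> ?X" "b \<in> ?Y" for a b
        using that by (meson linear order_trans)
      then have "emeasure lborel ?X + emeasure lborel ?Y \<le> ennreal (2 * \<bar>x i - y i\<bar>)"
        by (intro emeasure_lborel_pair_diameter ne)
      also have "\<dots> \<le> ennreal (2 * \<bar>x i\<bar> + 2 * \<bar>y i\<bar>)" using abs_triangle_ineq4[of "x i" "y i"] by (intro ennreal_leI) simp
      also have "\<dots> = ennreal (2 * \<bar>x i\<bar>) + ennreal (2 * \<bar>y i\<bar>)" by (rule ennreal_plus) auto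
      also have "\<dots> < emeasure lborel ?X + emeasure lborel ?Y" using mx my by (rule add_strict_mono)
      finally show False by simp
    qed
    then obtain a b where ab: "x(i := a) \<in> A" "y(i := b) \<in> A" "\<bar>x i - y i\<bar> \<le> \<bar>a - b\<bar>" by auto
    have "(\<Sum>j\<in>I. (x j - y j)\<^sup>2) \<le> (a - b)\<^sup>2 + (\<Sum>j\<in>J. (x j - y j)\<^sup>2)"
      unfolding split using ab(3) by (simp add: abs_le_square_iff)
    also have "(\<Sum>j\<in>J. (x j - y j)\<^sup>2) = (\<Sum>j\<in>J. ((x(i := a)) j - (y(i := b)) j)\<^sup>2)"
      using J by (intro sum.cong) auto
    also have "(a - b)\<^sup>2 + \<dots> = (\<Sum>j\<in>I. ((x(i := a)) j - (y(i := b)) j)\<^sup>2)"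
      unfolding split by simp
    also have "\<dots> \<le> c" by (rule diam[OF ab(1,2)])
    finally show ?thesis .
  qed
  have ext: "x(j := t) \<in> space ?P" if "x \<in> space ?P" "j \<in> I" for x :: "'i \<Rightarrow> real" and j t
    using that unfolding sp by (auto simp: extensional_def)
  have B_refl: "x(i := - x i) \<in> B" if "x \<in> B" for x
    using that i by (auto simp: B_def m_upd intro: ext)
  have B_keep: "x(j := - x j) \<in> B"
    if j: "j \<in> I" and sym: "\<forall>x\<in>A. x(j := - x j) \<in> A" and x: "x \<in> B" for j x
  proof (cases "j = i")
    case True
    then show ?thesis using B_refl x by simp
  next
    case False
    have iff: "(x(j := - x j))(i := t) \<in> A \<longleftrightarrow> x(i := t) \<in> A" for t
    proof
      assume "x(i := t) \<in> A"
      from sym[rule_format, OF this] show "(x(j := - x j))(i := t) \<in> A" using False by (simp add: fun_upd_twist)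
    next
      assume "(x(j := - x j))(i := t) \<in> A"
      from sym[rule_format, OF this]
      have "(x(j := - x j))(i := t, j := - ((x(j := - x j))(i := t)) j) \<in> A" .
      also have "(x(j := - x j))(i := t, j := - ((x(j := - x j))(i := t)) j) = x(i := t)"
        using False by (auto simp: fun_eq_iff)
      finally show "x(i := t) \<in> A" .
    qed
    have "m (x(j := - x j)) = m x" unfolding m_def iff ..
    then show ?thesis using x j False by (auto simp: B_def intro: ext)
  qed
  show ?thesis
    using B_meas B_em B_diam B_refl B_keep by blast
qed

text \<open>
  After symmetrising in all coordinates the set is symmetric about the origin. Each point \<open>x\<close>
  then has distance \<open>2 \<bar>x\<bar>\<close> from the point \<open>- x\<close> of the set, so the set lies in the ball of
  radius \<open>D / 2\<close>.
\<close>

theorem isodiametric_inequality_PiM: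
  fixes A :: "('i \<Rightarrow> real) set"
  assumes fin: "finite I" and A: "A \<in> sets (lborel_PiM I)" and D: "0 \<le> D"
    and diam: "\<And>x y. x \<in> A \<Longrightarrow> y \<in> A \<Longrightarrow> (\<Sum>j\<in>I. (x j - y j)\<^sup>2) \<le> D\<^sup>2"
  shows "emeasure (lborel_PiM I) A \<le> ennreal (unit_ball_vol (real (card I)) * (D / 2) ^ card I)"
proof -
  let ?P = "lborel_PiM I"
  have "\<exists>B\<in>sets ?P. emeasure ?P B = emeasure ?P A \<and>
      (\<forall>x\<in>B. \<forall>y\<in>B. (\<Sum>j\<in>I. (x j - y j)\<^sup>2) \<le> D\<^sup>2) \<and> (\<forall>j\<in>J. \<forall>x\<in>B. x(j := - x j) \<in> B)"
    if "J \<subseteq> I" for J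
    using finite_subset[OF that fin] that
  proof (induction J)
    case empty
    then show ?case using A diam by (intro bexI[of _ A]) auto
  next
    case (insert i J)
    then obtain B where B: "B \<in> sets ?P" "emeasure ?P B = emeasure ?P A"
      "\<And>x y. x \<in> B \<Longrightarrow> y \<in> B \<Longrightarrow> (\<Sum>j\<in>I. (x j - y j)\<^sup>2) \<le> D\<^sup>2"
      "\<And>j x. j \<in> J \<Longrightarrow> x \<in> B \<Longrightarrow> x(j := - x j) \<in> B" by blast
    have i: "i \<in> I" and J: "J \<subseteq> I" using insert by auto
    obtain C where C: "C \<in> sets ?P" "emeasure ?P C = emeasure ?P B"
      "\<And>x y. x \<in> C \<Longrightarrow> y \<in> C \<Longrightarrow> (\<Sum>j\<in>I. (x j - y j)\<^sup>2) \<le> D\<^sup>2"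
      "\<And>x. x \<in> C \<Longrightarrow> x(i := - x i) \<in> C"
      "\<And>j x. j \<in> I \<Longrightarrow> \<forall>x\<in>B. x(j := - x j) \<in> B \<Longrightarrow> x \<in> C \<Longrightarrow> x(j := - x j) \<in> C"
      using steiner_symmetrisation[OF fin i B(1,3)] by blast
    show ?case
    proof (intro bexI[of _ C] conjI ballI)
      fix j x assume j: "j \<in> insert i J" and x: "x \<in> C"
      show "x(j := - x j) \<in> C"
      proof (cases "j = i")
        case False
        then show ?thesis using C(5)[of j x] B(4) j J x by auto
      qed (use C(4) x in simp)
    qed (use C B in auto)
  qed
  from this[of I] obtain B where B: "B \<in> sets ?P" "emeasure ?P B = emeasure ?P A"
      "\<And>x y. x \<in> B \<Longrightarrow> y \<in> B \<Longrightarrow> (\<Sum>j\<in>I. (x j - y j)\<^sup>2) \<le> D\<^sup>2"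
      "\<And>j x. j \<in> I \<Longrightarrow> x \<in> B \<Longrightarrow> x(j := - x j) \<in> B" by blast
  have flip: "(\<lambda>j. if j \<in> J then - x j else x j) \<in> B" if x: "x \<in> B" and "J \<subseteq> I" for x J
    using finite_subset[OF that(2) fin] that(2)
  proof (induction J)
    case empty
    then show ?case using x by simp
  next
    case (insert i J)
    have "(\<lambda>j. if j \<in> insert i J then - x j else x j)
        = (\<lambda>j. if j \<in> J then - x j else x j)(i := - (\<lambda>j. if j \<in> J then - x j else x j) i)"
      using insert by auto
    also have "\<dots> \<in> B" using insert by (intro B(4)) auto
    finally show ?case .
  qed
  have small: "sqrt (\<Sum>j\<in>I. (x j)\<^sup>2) \<le> D / 2" if x: "x \<in> B" for x
  proof -
    have "(\<Sum>j\<in>I. (x j - (if j \<in> I then - x j else x j))\<^sup>2) \<le> D\<^sup>2"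
      by (rule B(3)[OF x flip[OF x order_refl]])
    also have "(\<Sum>j\<in>I. (x j - (if j \<in> I then - x j else x j))\<^sup>2) = 4 * (\<Sum>j\<in>I. (x j)\<^sup>2)"
      unfolding sum_distrib_left by (intro sum.cong) (auto simp: power2_eq_square)
    finally have "(\<Sum>j\<in>I. (x j)\<^sup>2) \<le> (D / 2)\<^sup>2" by (simp add: power2_eq_square)
    then show ?thesis using D by (intro real_le_lsqrt) (auto intro: sum_nonneg)
  qed
  have ball: "emeasure ?P A \<le> ennreal (unit_ball_vol (real (card I)) * r ^ card I)"
    if r: "r > 0" "D / 2 \<le> r" for r
  proof -
    have "emeasure ?P B \<le> emeasure ?P ({f. sqrt (\<Sum>i\<in>I. (f i)\<^sup>2) \<le> r} \<inter> space ?P)"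
    proof (rule emeasure_mono)
      show "B \<subseteq> {f. sqrt (\<Sum>i\<in>I. (f i)\<^sup>2) \<le> r} \<inter> space ?P"
        using small r sets.sets_into_space[OF B(1)] by force
    qed measurable
    then show ?thesis using emeasure_cball_aux[OF fin r(1)] B(2) by simp
  qed
  have "((\<lambda>r. ennreal (unit_ball_vol (real (card I)) * r ^ card I)) \<longlongrightarrow>
      ennreal (unit_ball_vol (real (card I)) * (D / 2) ^ card I)) (at_right (D / 2))"
    by (intro tendsto_intros)
  then show ?thesis
  proof (rule tendsto_lowerbound)
    show "\<forall>\<^sub>F r in at_right (D / 2). emeasure ?P A \<le> ennreal (unit_ball_vol (real (card I)) * r ^ card I)"
      using D by (intro eventually_at_rightI[of "D/2" "D/2 + 1"] ball) auto
  qed simp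
qed


section \<open>Gnomonic coordinates and orthogonal invariance\<close>

text \<open>
  The integral over the hyperplane orthogonal to \<open>b\<close> is written as an integral over the
  coordinates different from \<open>b\<close>, because there is no Euclidean type of dimension
  \<open>DIM('a) - 1\<close>.
\<close>

lemma nn_integral_lborel_hyperplane:
  fixes F :: "'a::euclidean_space \<Rightarrow> ennreal"
  assumes b: "b \<in> Basis" and F[measurable]: "F \<in> borel_measurable borel"
  shows "(\<integral>\<^sup>+z. F z \<partial>lborel) =
    (\<integral>\<^sup>+t. (\<integral>\<^sup>+v. F (t *\<^sub>R b + (\<Sum>i\<in>Basis - {b}. v i *\<^sub>R i)) \<partial>lborel_PiM (Basis - {b})) \<partial>lborel)"
proof -
  interpret product_sigma_finite "\<lambda>_::'a. lborel :: real measure" by standard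
  let ?I = "Basis - {b}"
  have B: "insert b ?I = Basis" using b by auto
  have coords: "(\<Sum>i\<in>Basis. (v(b := t)) i *\<^sub>R i) = t *\<^sub>R b + (\<Sum>i\<in>?I. v i *\<^sub>R i)" for t v
    using b by (subst sum.remove[of _ b]) auto
  have "(\<integral>\<^sup>+z. F z \<partial>lborel) = (\<integral>\<^sup>+f. F (\<Sum>b\<in>Basis. f b *\<^sub>R b) \<partial>lborel_PiM (insert b ?I))"
    unfolding B by (subst lborel_eq, subst nn_integral_distr) auto
  also have "\<dots> = (\<integral>\<^sup>+t. (\<integral>\<^sup>+v. F (\<Sum>i\<in>Basis. (v(b := t)) i *\<^sub>R i) \<partial>lborel_PiM ?I) \<partial>lborel)"
    by (subst product_nn_integral_insert_rev) (auto simp del: fun_upd_apply simp: B)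
  finally show ?thesis by (simp only: coords)
qed

lemma nn_integral_lborel_PiM_scale:
  fixes t :: real
  assumes "finite I" and t: "0 < t" and "F \<in> borel_measurable (lborel_PiM I)"
  shows "(\<integral>\<^sup>+v. F v \<partial>lborel_PiM I) = ennreal (t ^ card I) * (\<integral>\<^sup>+v. F (\<lambda>i\<in>I. t * v i) \<partial>lborel_PiM I)"
  using assms(1,3)
proof (induction I arbitrary: F)
  case empty
  then show ?case by (simp add: PiM_empty nn_integral_count_space_finite)
next
  case (insert i I)
  interpret product_sigma_finite "\<lambda>_. lborel :: real measure" by standard
  note F[measurable] = insert.prems
  have upd[measurable]: "(\<lambda>w. (fst w)(i := snd w)) \<in> lborel_PiM I \<Otimes>\<^sub>M lborel \<rightarrow>\<^sub>M lborel_PiM (insert i I)"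
  proof (rule measurable_PiM_single')
    fix j assume "j \<in> insert i I"
    then show "(\<lambda>w. ((fst w)(i := snd w)) j) \<in> lborel_PiM I \<Otimes>\<^sub>M lborel \<rightarrow>\<^sub>M lborel"
      by (cases "j = i") (auto simp: case_prod_beta)
  qed (auto simp: space_pair_measure space_PiM PiE_def extensional_def)
  have F2: "(\<lambda>(x, y). F (x(i := y))) \<in> borel_measurable (lborel_PiM I \<Otimes>\<^sub>M lborel)"
    using measurable_compose[OF upd F] by (simp add: case_prod_beta)
  have sc[measurable]: "(\<lambda>v. \<lambda>i\<in>J. t * v i) \<in> lborel_PiM J \<rightarrow>\<^sub>M lborel_PiM J" for J
    by (rule measurable_restrict) auto
  have Fx[measurable]: "(\<lambda>y. F (x(i := y))) \<in> borel_measurable borel" if "x \<in> space (lborel_PiM I)" for x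
    using measurable_Pair2[OF F2 that] by simp
  have F3: "(\<lambda>(x, y). F (x(i := t * y))) \<in> borel_measurable (lborel_PiM I \<Otimes>\<^sub>M lborel)"
  proof -
    have "(\<lambda>w. (fst w, t * snd w)) \<in> lborel_PiM I \<Otimes>\<^sub>M lborel \<rightarrow>\<^sub>M lborel_PiM I \<Otimes>\<^sub>M lborel" by simp
    from measurable_compose[OF this F2] show ?thesis by (simp add: case_prod_beta)
  qed
  have "(\<integral>\<^sup>+v. F v \<partial>lborel_PiM (insert i I)) = (\<integral>\<^sup>+x. \<integral>\<^sup>+y. F (x(i := y)) \<partial>lborel \<partial>lborel_PiM I)"
    using insert by (intro product_nn_integral_insert) auto
  also have "\<dots> = (\<integral>\<^sup>+x. ennreal t * (\<integral>\<^sup>+y. F (x(i := t * y)) \<partial>lborel) \<partial>lborel_PiM I)"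
  proof (rule nn_integral_cong)
    fix x assume "x \<in> space (lborel_PiM I)"
    then show "(\<integral>\<^sup>+y. F (x(i := y)) \<partial>lborel) = ennreal t * (\<integral>\<^sup>+y. F (x(i := t * y)) \<partial>lborel)"
      using nn_integral_real_affine[OF Fx, of x t 0] t by simp
  qed
  also have "\<dots> = ennreal t * (\<integral>\<^sup>+x. (\<integral>\<^sup>+y. F (x(i := t * y)) \<partial>lborel) \<partial>lborel_PiM I)"
    using lborel.borel_measurable_nn_integral[OF F3] by (subst nn_integral_cmult) auto
  also have "(\<integral>\<^sup>+x. (\<integral>\<^sup>+y. F (x(i := t * y)) \<partial>lborel) \<partial>lborel_PiM I) = ennreal (t ^ card I) *
      (\<integral>\<^sup>+x. (\<integral>\<^sup>+y. F ((\<lambda>i\<in>I. t * x i)(i := t * y)) \<partial>lborel) \<partial>lborel_PiM I)"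
    using lborel.borel_measurable_nn_integral[OF F3] by (subst insert.IH) auto
  also have "(\<integral>\<^sup>+x. (\<integral>\<^sup>+y. F ((\<lambda>i\<in>I. t * x i)(i := t * y)) \<partial>lborel) \<partial>lborel_PiM I)
      = (\<integral>\<^sup>+x. (\<integral>\<^sup>+y. F (\<lambda>j\<in>insert i I. t * (x(i := y)) j) \<partial>lborel) \<partial>lborel_PiM I)"
    using insert.hyps by (intro nn_integral_cong arg_cong[where f=F]) (auto simp: fun_eq_iff)
  also have "\<dots> = (\<integral>\<^sup>+v. F (\<lambda>j\<in>insert i I. t * v j) \<partial>lborel_PiM (insert i I))"
    using insert.hyps by (intro product_nn_integral_insert[symmetric] measurable_compose[OF sc F]) auto
  finally show ?case
    using insert.hyps t by (simp add: mult.assoc[symmetric] ennreal_mult[symmetric] restrict_def)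
qed

lemma inner_hyperplane_coords:
  assumes b: "b \<in> Basis"
  shows "(t *\<^sub>R b + (\<Sum>i\<in>Basis - {b}. v i *\<^sub>R i)) \<bullet> b = t"
    and "j \<in> Basis - {b} \<Longrightarrow> (t *\<^sub>R b + (\<Sum>i\<in>Basis - {b}. v i *\<^sub>R i)) \<bullet> j = v j"
proof -
  show "(t *\<^sub>R b + (\<Sum>i\<in>Basis - {b}. v i *\<^sub>R i)) \<bullet> b = t"
    using b by (auto simp: inner_add_left inner_sum_left inner_Basis intro!: sum.neutral)
  assume j: "j \<in> Basis - {b}"
  have "(\<Sum>i\<in>Basis - {b}. v i * (i \<bullet> j)) = (\<Sum>i\<in>Basis - {b}. if i = j then v j else 0)"
    using j by (intro sum.cong) (auto simp: inner_Basis)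
  then show "(t *\<^sub>R b + (\<Sum>i\<in>Basis - {b}. v i *\<^sub>R i)) \<bullet> j = v j"
    using b j by (auto simp: inner_add_left inner_sum_left inner_Basis)
qed

text \<open>
  The slice of the cone at height \<open>t\<close> is \<open>t\<close> times its base \<open>V\<close>. Hence the volume up to the
  height \<open>c\<close> is the integral of \<open>t ^ (DIM('a) - 1)\<close> over \<open>{0..c}\<close>, times the measure of \<open>V\<close>.
\<close>

lemma emeasure_gnomonic_cone:
  fixes b :: "'a::euclidean_space"
  assumes b: "b \<in> Basis" and V[measurable]: "V \<in> sets (lborel_PiM (Basis - {b}))" and c: "0 \<le> c"
  shows "{z. 0 < z \<bullet> b \<and> z \<bullet> b \<le> c \<and> (\<lambda>i\<in>Basis - {b}. (z \<bullet> i) / (z \<bullet> b)) \<in> V} \<in> sets borel" (is "?C \<in> _")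
    and "ennreal DIM('a) * emeasure lborel {z. 0 < z \<bullet> b \<and> z \<bullet> b \<le> c \<and> (\<lambda>i\<in>Basis - {b}. (z \<bullet> i) / (z \<bullet> b)) \<in> V}
      = ennreal (c ^ DIM('a)) * emeasure (lborel_PiM (Basis - {b})) V"
proof -
  let ?I = "Basis - {b}"
  define d where "d = card ?I"
  have dim: "DIM('a) = Suc d" using card_Suc_Diff1[OF finite_Basis b] by (simp add: d_def)
  have g[measurable]: "(\<lambda>z::'a. \<lambda>i\<in>?I. (z \<bullet> i) / (z \<bullet> b)) \<in> borel \<rightarrow>\<^sub>M lborel_PiM ?I"
    by (rule measurable_restrict) auto
  show C[measurable]: "?C \<in> sets borel" by measurable
  have inner: "(\<integral>\<^sup>+v. indicator ?C (t *\<^sub>R b + (\<Sum>i\<in>?I. v i *\<^sub>R i)) \<partial>lborel_PiM ?I)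
      = ennreal (t ^ d) * indicator {0..c} t * emeasure (lborel_PiM ?I) V" if t0: "t \<noteq> 0" for t :: real
  proof (cases "0 < t \<and> t \<le> c")
    case True
    then have t: "0 < t" "t \<le> c" by auto
    have sc: "(\<lambda>v. \<lambda>i\<in>?I. v i / t) \<in> lborel_PiM ?I \<rightarrow>\<^sub>M lborel_PiM ?I"
      by (rule measurable_restrict) auto
    have m: "(\<lambda>v. indicator V (\<lambda>i\<in>?I. v i / t) :: ennreal) \<in> borel_measurable (lborel_PiM ?I)"
      by (rule measurable_compose[OF sc]) auto
    have "(\<integral>\<^sup>+v. indicator ?C (t *\<^sub>R b + (\<Sum>i\<in>?I. v i *\<^sub>R i)) \<partial>lborel_PiM ?I)
        = (\<integral>\<^sup>+v. indicator V (\<lambda>i\<in>?I. v i / t) \<partial>lborel_PiM ?I)"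
    proof (rule nn_integral_cong)
      fix v :: "'a \<Rightarrow> real"
      have "(\<lambda>i\<in>?I. ((t *\<^sub>R b + (\<Sum>i\<in>?I. v i *\<^sub>R i)) \<bullet> i) / ((t *\<^sub>R b + (\<Sum>i\<in>?I. v i *\<^sub>R i)) \<bullet> b)) = (\<lambda>i\<in>?I. v i / t)"
        by (rule restrict_ext) (simp only: inner_hyperplane_coords[OF b])
      then show "indicator ?C (t *\<^sub>R b + (\<Sum>i\<in>?I. v i *\<^sub>R i)) = (indicator V (\<lambda>i\<in>?I. v i / t) :: ennreal)"
        using t by (simp add: indicator_def inner_hyperplane_coords(1)[OF b])
    qed
    also have "\<dots> = ennreal (t ^ d) * (\<integral>\<^sup>+v. indicator V (\<lambda>i\<in>?I. (\<lambda>i\<in>?I. t * v i) i / t) \<partial>lborel_PiM ?I)"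
      unfolding d_def by (subst nn_integral_lborel_PiM_scale[OF _ t(1) m]) auto
    also have "(\<integral>\<^sup>+v. indicator V (\<lambda>i\<in>?I. (\<lambda>i\<in>?I. t * v i) i / t) \<partial>lborel_PiM ?I)
        = (\<integral>\<^sup>+v. indicator V v \<partial>lborel_PiM ?I)"
    proof (rule nn_integral_cong)
      fix v :: "'a \<Rightarrow> real" assume "v \<in> space (lborel_PiM ?I)"
      then have "(\<lambda>i\<in>?I. (\<lambda>i\<in>?I. t * v i) i / t) = v"
        using t by (auto simp: space_PiM PiE_def extensional_def fun_eq_iff)
      then show "indicator V (\<lambda>i\<in>?I. (\<lambda>i\<in>?I. t * v i) i / t) = (indicator V v :: ennreal)" by simp
    qed
    finally have *: "(\<integral>\<^sup>+v. indicator ?C (t *\<^sub>R b + (\<Sum>i\<in>?I. v i *\<^sub>R i)) \<partial>lborel_PiM ?I)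
        = ennreal (t ^ d) * (\<integral>\<^sup>+v. indicator V v \<partial>lborel_PiM ?I)" .
    show ?thesis unfolding * using t by simp
  next
    case False
    then have "t \<notin> {0..c}" using t0 by auto
    moreover have "indicator ?C (t *\<^sub>R b + (\<Sum>i\<in>?I. v i *\<^sub>R i)) = (0 :: ennreal)" for v :: "'a \<Rightarrow> real"
      using False by (auto simp: indicator_def inner_hyperplane_coords(1)[OF b])
    ultimately show ?thesis by simp
  qed
  have "emeasure lborel ?C = (\<integral>\<^sup>+z. indicator ?C z \<partial>lborel)" by simp
  also have "\<dots> = (\<integral>\<^sup>+t. (\<integral>\<^sup>+v. indicator ?C (t *\<^sub>R b + (\<Sum>i\<in>?I. v i *\<^sub>R i)) \<partial>lborel_PiM ?I) \<partial>lborel)"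
    by (rule nn_integral_lborel_hyperplane[OF b]) auto
  also have "\<dots> = (\<integral>\<^sup>+t. ennreal (t ^ d) * indicator {0..c} t * emeasure (lborel_PiM ?I) V \<partial>lborel)"
    using AE_lborel_singleton[of "0::real"] by (intro nn_integral_cong_AE) (auto simp: inner)
  also have "\<dots> = (\<integral>\<^sup>+t. ennreal (t ^ d) * indicator {0..c} t \<partial>lborel) * emeasure (lborel_PiM ?I) V"
    by (rule nn_integral_multc) auto
  also have "(\<integral>\<^sup>+t. ennreal (t ^ d) * indicator {0..c} t \<partial>lborel) = ennreal (c ^ Suc d / Suc d - 0 ^ Suc d / Suc d)"
    by (rule nn_integral_FTC_Icc) (auto intro!: derivative_eq_intros simp: c simp del: power_Suc of_nat_Suc)
  finally have *: "emeasure lborel ?C = ennreal (c ^ Suc d / Suc d - 0 ^ Suc d / Suc d) * emeasure (lborel_PiM ?I) V" .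
  show "ennreal DIM('a) * emeasure lborel ?C = ennreal (c ^ DIM('a)) * emeasure (lborel_PiM ?I) V"
    unfolding * using c by (simp add: dim mult.assoc[symmetric] ennreal_mult[symmetric] del: of_nat_Suc)
qed

text \<open>
  The image \<open>\<nu>\<close> of the Lebesgue measure \<open>\<lambda>\<close> is invariant under translations and under
  \<open>x \<mapsto> - x\<close>. For a Borel set \<open>A\<close> and the unit ball \<open>B\<close>, computing the double integral of
  \<open>indicator A x * indicator B (y - x)\<close> with respect to \<open>\<nu>\<close> in \<open>x\<close> and \<open>\<lambda>\<close> in \<open>y\<close> in the two
  possible orders gives \<open>\<nu> A * \<lambda> B = \<lambda> A * \<nu> B\<close>. Since \<open>f\<close> preserves \<open>B\<close>, the factors \<open>\<lambda> B\<close>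
  and \<open>\<nu> B\<close> cancel.
\<close>

lemma distr_lborel_orthogonal:
  fixes f :: "'a::euclidean_space \<Rightarrow> 'a"
  assumes f: "orthogonal_transformation f"
  shows "distr lborel borel f = lborel"
proof -
  have lin: "linear f" and nrm: "norm (f x) = norm x" for x
    using f by (auto simp: orthogonal_transformation)
  have surj: "surj f" using f by (rule orthogonal_transformation_surj)
  have fm[measurable]: "f \<in> borel_measurable borel"
    using lin by (intro borel_measurable_continuous_onI linear_continuous_on) (simp add: linear_conv_bounded_linear)
  let ?\<nu> = "distr lborel borel f"
  have inv: "(\<integral>\<^sup>+x. F (y - x) \<partial>?\<nu>) = (\<integral>\<^sup>+x. F x \<partial>?\<nu>)"
    if [measurable]: "F \<in> borel_measurable borel" for F :: "'a \<Rightarrow> ennreal" and y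
  proof -
    obtain y' where y': "y = f y'" using surj by (metis surjD)
    have "(\<integral>\<^sup>+x. F (y - x) \<partial>?\<nu>) = (\<integral>\<^sup>+x. F (f (y' - x)) \<partial>lborel)"
      using lin by (subst nn_integral_distr) (auto simp: y' linear_diff)
    also have "\<dots> = (\<integral>\<^sup>+x. F (f x) \<partial>distr lborel borel (\<lambda>x. y' + (-1) *\<^sub>R x))"
      by (subst nn_integral_distr) auto
    also have "\<dots> = (\<integral>\<^sup>+x. F (f x) \<partial>lborel)"
      using lborel_affine[of "-1::real" y'] by (simp add: density_1)
    finally show ?thesis by (subst nn_integral_distr) auto
  qed
  have trans: "(\<integral>\<^sup>+x. F (x - y) \<partial>lborel) = (\<integral>\<^sup>+x. F x \<partial>lborel)"
    if [measurable]: "F \<in> borel_measurable borel" for F :: "'a \<Rightarrow> ennreal" and y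
  proof -
    have "(\<integral>\<^sup>+x. F (x - y) \<partial>lborel) = (\<integral>\<^sup>+x. F x \<partial>distr lborel borel (\<lambda>x. (- y) + 1 *\<^sub>R x))"
      by (subst nn_integral_distr) auto
    then show ?thesis using lborel_affine[of "1::real" "- y"] by (simp add: density_1)
  qed
  have fB: "f -` cball 0 r = cball 0 r" for r by (auto simp: nrm)
  have B: "emeasure ?\<nu> (cball 0 r) = emeasure lborel (cball (0::'a) r)" for r
    by (subst emeasure_distr) (auto simp: fB)
  have sf: "sigma_finite_measure ?\<nu>"
  proof
    show "\<exists>A. countable A \<and> A \<subseteq> sets ?\<nu> \<and> \<Union>A = space ?\<nu> \<and> (\<forall>a\<in>A. emeasure ?\<nu> a \<noteq> \<infinity>)"
    proof (intro exI conjI ballI)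
      show "countable (range (\<lambda>n. cball (0::'a) (real n)))" by simp
      show "\<Union>(range (\<lambda>n. cball (0::'a) (real n))) = space ?\<nu>" using real_arch_simple by auto
      show "emeasure ?\<nu> a \<noteq> \<infinity>" if "a \<in> range (\<lambda>n. cball (0::'a) (real n))" for a
        using that by (auto simp: B emeasure_cball)
    qed auto
  qed
  interpret \<nu>: sigma_finite_measure ?\<nu> by (rule sf)
  interpret P: pair_sigma_finite ?\<nu> lborel ..
  show ?thesis
  proof (rule measure_eqI)
    fix A assume "A \<in> sets ?\<nu>"
    then have A[measurable]: "A \<in> sets borel" by simp
    let ?B = "cball (0::'a) 1"
    have Bm[measurable]: "?B \<in> sets borel" by auto
    have "emeasure ?\<nu> A * emeasure lborel ?B = (\<integral>\<^sup>+x. indicator A x * (\<integral>\<^sup>+y. indicator ?B y \<partial>lborel) \<partial>?\<nu>)"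
      by (subst nn_integral_multc) auto
    also have "\<dots> = (\<integral>\<^sup>+x. indicator A x * (\<integral>\<^sup>+y. indicator ?B (y - x) \<partial>lborel) \<partial>?\<nu>)"
      by (subst trans) auto
    also have "\<dots> = (\<integral>\<^sup>+x. (\<integral>\<^sup>+y. indicator A x * indicator ?B (y - x) \<partial>lborel) \<partial>?\<nu>)"
      by (subst nn_integral_cmult) auto
    also have "\<dots> = (\<integral>\<^sup>+y. (\<integral>\<^sup>+x. indicator A x * indicator ?B (y - x) \<partial>?\<nu>) \<partial>lborel)"
      by (rule P.Fubini'[symmetric]) measurable
    also have "\<dots> = (\<integral>\<^sup>+y. (\<integral>\<^sup>+x. indicator A (y - x) * indicator ?B x \<partial>?\<nu>) \<partial>lborel)"
      using inv[of "\<lambda>x. indicator A (y - x) * indicator ?B x" y for y] by simp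
    also have "\<dots> = (\<integral>\<^sup>+x. (\<integral>\<^sup>+y. indicator A (y - x) * indicator ?B x \<partial>lborel) \<partial>?\<nu>)"
      by (rule P.Fubini') measurable
    also have "\<dots> = (\<integral>\<^sup>+x. (\<integral>\<^sup>+y. indicator A (y - x) \<partial>lborel) * indicator ?B x \<partial>?\<nu>)"
      by (subst nn_integral_multc) auto
    also have "\<dots> = (\<integral>\<^sup>+x. (\<integral>\<^sup>+y. indicator A y \<partial>lborel) * indicator ?B x \<partial>?\<nu>)"
      by (subst trans) auto
    also have "\<dots> = emeasure lborel A * emeasure lborel ?B"
      by (subst nn_integral_cmult) (auto simp: B)
    finally have eq: "emeasure lborel ?B * emeasure ?\<nu> A = emeasure lborel ?B * emeasure lborel A"
      by (simp add: mult.commute)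
    have "unit_ball_vol (real DIM('a)) \<noteq> 0"
      by (rule less_imp_neq[symmetric, OF unit_ball_vol_pos]) simp
    then have "emeasure lborel ?B \<noteq> 0" "emeasure lborel ?B \<noteq> top"
      by (auto simp: emeasure_cball)
    then show "emeasure ?\<nu> A = emeasure lborel A" using eq
      by (simp add: ennreal_mult_cancel_left)
  qed simp
qed


section \<open>The cone measure on the sphere\<close>

text \<open>
  The surface measure of the unit sphere in the form in which polar coordinates are immediate:
  the measure of \<open>A\<close> is the volume of the cone over \<open>A\<close>, times the dimension.
\<close>

definition cone_measure :: "'a::euclidean_space measure" where
  "cone_measure = distr (density lborel (\<lambda>z. ennreal DIM('a) * indicator (cball 0 1) z)) borel sgn"

lemma borel_measurable_sgn_euclidean [measurable]: "(sgn :: 'a::euclidean_space \<Rightarrow> 'a) \<in> borel_measurable borel"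
  unfolding sgn_div_norm by measurable

lemma sets_cone_measure [simp, measurable_cong]: "sets cone_measure = sets borel"
  by (simp add: cone_measure_def)

lemma space_cone_measure [simp]: "space cone_measure = UNIV"
  by (simp add: cone_measure_def)

lemma emeasure_cone_measure:
  fixes A :: "'a::euclidean_space set"
  assumes A[measurable]: "A \<in> sets borel"
  shows "emeasure cone_measure A = ennreal DIM('a) * emeasure lborel {z \<in> cball 0 1. sgn z \<in> A}"
proof -
  have c[measurable]: "cball (0::'a) 1 \<in> sets borel" by auto
  have [measurable]: "{z \<in> cball 0 1. sgn z \<in> A} \<in> sets borel" by measurable
  have "emeasure cone_measure A = emeasure (density lborel (\<lambda>z. ennreal DIM('a) * indicator (cball 0 1) z)) (sgn -` A)"
    unfolding cone_measure_def by (subst emeasure_distr) auto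
  also have "\<dots> = (\<integral>\<^sup>+z. ennreal DIM('a) * indicator (cball 0 1) z * indicator (sgn -` A) z \<partial>lborel)"
    using measurable_sets[OF borel_measurable_sgn_euclidean A] by (subst emeasure_density) auto
  also have "\<dots> = (\<integral>\<^sup>+z. ennreal DIM('a) * indicator {z \<in> cball 0 1. sgn z \<in> A} z \<partial>lborel)"
    by (intro nn_integral_cong) (auto simp: indicator_def)
  also have "\<dots> = ennreal DIM('a) * emeasure lborel {z \<in> cball 0 1. sgn z \<in> A}"
    by (subst nn_integral_cmult) auto
  finally show ?thesis .
qed

lemma finite_measure_cone_measure: "finite_measure (cone_measure :: 'a::euclidean_space measure)"
proof
  have "{z::'a. z \<in> cball 0 1 \<and> sgn z \<in> UNIV} = cball 0 1" by auto
  then show "emeasure (cone_measure :: 'a measure) (space cone_measure) \<noteq> \<infinity>"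
    by (simp del: mem_cball add: emeasure_cone_measure emeasure_cball ennreal_mult_eq_top_iff)
qed

lemma AE_cone_measure_norm: "AE w in (cone_measure :: 'a::euclidean_space measure). norm w = 1"
proof -
  have [measurable]: "{w::'a. norm w = 1} \<in> sets borel" "cball (0::'a) 1 \<in> sets borel"
    using borel_closed[OF closed_sphere[of "0::'a" 1]] by (auto simp: sphere_def)
  have "AE z in density lborel (\<lambda>z::'a. ennreal DIM('a) * indicator (cball 0 1) z). norm (sgn z) = 1"
    using AE_lborel_singleton[of "0::'a"] by (subst AE_density) (auto simp: norm_sgn)
  then show ?thesis unfolding cone_measure_def by (subst AE_distr_iff) auto
qed

lemma norm_hyperplane_diff:
  assumes b: "b \<in> (Basis :: 'a::euclidean_space set)"
  shows "norm ((t *\<^sub>R b + (\<Sum>i\<in>Basis - {b}. v i *\<^sub>R i)) - (t *\<^sub>R b + (\<Sum>i\<in>Basis - {b}. v' i *\<^sub>R i))) ^ 2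
    = (\<Sum>i\<in>Basis - {b}. (v i - v' i)\<^sup>2)"
proof -
  let ?y = "t *\<^sub>R b + (\<Sum>i\<in>Basis - {b}. v i *\<^sub>R i)" and ?y' = "t *\<^sub>R b + (\<Sum>i\<in>Basis - {b}. v' i *\<^sub>R i)"
  have "norm (?y - ?y') ^ 2 = (\<Sum>i\<in>Basis. ((?y - ?y') \<bullet> i)\<^sup>2)"
    unfolding power2_norm_eq_inner by (subst euclidean_inner) (simp add: power2_eq_square)
  also have "\<dots> = ((?y - ?y') \<bullet> b)\<^sup>2 + (\<Sum>i\<in>Basis - {b}. ((?y - ?y') \<bullet> i)\<^sup>2)"
    using b by (subst sum.remove[of _ b]) auto
  also have "((?y - ?y') \<bullet> b)\<^sup>2 = 0"
    by (simp only: inner_diff_left inner_hyperplane_coords[OF b]) simp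
  also have "(\<Sum>i\<in>Basis - {b}. ((?y - ?y') \<bullet> i)\<^sup>2) = (\<Sum>i\<in>Basis - {b}. (v i - v' i)\<^sup>2)"
    by (intro sum.cong refl) (simp only: inner_diff_left inner_hyperplane_coords[OF b])
  finally show ?thesis by simp
qed

text \<open>
  Central projection of the sphere onto the tangent plane at \<open>b\<close> distorts distances near \<open>b\<close> by
  a factor close to \<open>1\<close>. Put \<open>w = sgn y\<close> and \<open>w' = sgn y'\<close>. The difference of their \<open>b\<close>-components
  is of smaller order than \<open>norm (w - w')\<close>, because \<open>w - w'\<close> is orthogonal to \<open>w + w'\<close> and
  \<open>(w + w') / 2\<close> is \<open>\<delta>\<close>-close to \<open>b\<close>.
\<close>

lemma gnomonic_lipschitz:
  fixes y y' b :: "'a::euclidean_space"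
  assumes nb: "norm b = 1" and y: "y \<bullet> b = 1" "y' \<bullet> b = 1"
    and close: "norm (sgn y - b) \<le> \<delta>" "norm (sgn y' - b) \<le> \<delta>" and \<delta>: "0 \<le> \<delta>" "\<delta> < 1"
  shows "norm (y - y') \<le> norm (sgn y - sgn y') / (1 - \<delta>)\<^sup>2"
proof -
  define w w' where "w = sgn y" and "w' = sgn y'"
  have y0: "y \<noteq> 0" "y' \<noteq> 0" using y by auto
  have nw: "norm w = 1" "norm w' = 1" unfolding w_def w'_def using y0 by (auto simp: norm_sgn)
  have cb: "1 - \<delta> \<le> v \<bullet> b" if "norm (v - b) \<le> \<delta>" for v
  proof -
    have "\<bar>(v - b) \<bullet> b\<bar> \<le> norm (v - b) * norm b" by (rule Cauchy_Schwarz_ineq2)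
    then show ?thesis using that nb by (simp add: inner_diff_left power2_norm_eq_inner[symmetric])
  qed
  have wb: "1 - \<delta> \<le> w \<bullet> b" "1 - \<delta> \<le> w' \<bullet> b" using cb close by (auto simp: w_def w'_def)
  have wpos: "0 < w \<bullet> b" "0 < w' \<bullet> b" using wb \<delta> by linarith+
  have yw: "y = (1 / (w \<bullet> b)) *\<^sub>R w" "y' = (1 / (w' \<bullet> b)) *\<^sub>R w'"
    unfolding w_def w'_def sgn_div_norm using y y0 by simp_all
  have "2 * ((w - w') \<bullet> b) = (w - w') \<bullet> ((b - w) + (b - w'))"
  proof -
    have "(w - w') \<bullet> (w + w') = 0"
      using nw by (simp add: inner_diff_left inner_diff_right inner_add_left inner_add_right inner_commute norm_eq_1)
    then show ?thesis by (simp add: inner_diff_right inner_add_right)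
  qed
  then have "2 * \<bar>(w - w') \<bullet> b\<bar> \<le> norm (w - w') * norm ((b - w) + (b - w'))"
    using Cauchy_Schwarz_ineq2[of "w - w'" "(b - w) + (b - w')"] by linarith
  also have "\<dots> \<le> norm (w - w') * (2 * \<delta>)"
    using close norm_triangle_ineq[of "b - w" "b - w'"]
    by (intro mult_left_mono) (auto simp: w_def w'_def norm_minus_commute)
  finally have d: "\<bar>(w - w') \<bullet> b\<bar> \<le> \<delta> * norm (w - w')" by (simp add: mult.commute)
  have "y - y' = (1 / (w \<bullet> b)) *\<^sub>R (w - w') + (1 / (w \<bullet> b) - 1 / (w' \<bullet> b)) *\<^sub>R w'"
    by (simp add: yw scaleR_diff_left scaleR_diff_right)
  then have "norm (y - y') \<le> norm (w - w') / (w \<bullet> b) + \<bar>1 / (w \<bullet> b) - 1 / (w' \<bullet> b)\<bar>"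
    using norm_triangle_ineq[of "(1 / (w \<bullet> b)) *\<^sub>R (w - w')" "(1 / (w \<bullet> b) - 1 / (w' \<bullet> b)) *\<^sub>R w'"] wpos nw by simp
  also have "\<bar>1 / (w \<bullet> b) - 1 / (w' \<bullet> b)\<bar> = \<bar>(w - w') \<bullet> b\<bar> / ((w \<bullet> b) * (w' \<bullet> b))"
    using wpos by (simp add: field_simps inner_diff_left abs_mult)
  also have "norm (w - w') / (w \<bullet> b) + \<bar>(w - w') \<bullet> b\<bar> / ((w \<bullet> b) * (w' \<bullet> b))
      \<le> norm (w - w') / (1 - \<delta>) + (\<delta> * norm (w - w')) / ((1 - \<delta>) * (1 - \<delta>))"
    using wb \<delta> d by (intro add_mono frac_le mult_mono mult_nonneg_nonneg) auto
  also have "\<dots> = norm (w - w') / (1 - \<delta>)\<^sup>2"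
  proof -
    obtain e where e: "\<delta> = 1 - e" "0 < e" using \<delta> by (metis diff_diff_eq2 diff_gt_0_iff_gt add_diff_cancel_left')
    show ?thesis unfolding e(1) using e(2) by (simp add: field_simps power2_eq_square)
  qed
  finally show ?thesis by (simp add: w_def w'_def)
qed

text \<open>
  The cone over \<open>U\<close> up to radius \<open>1\<close> is contained in the cone up to height \<open>1\<close> over the central
  projection of \<open>U\<close> to the tangent plane. The isodiametric inequality bounds the base of the
  latter.
\<close>

lemma cone_measure_le_near_pole:
  fixes b :: "'a::euclidean_space"
  assumes b: "b \<in> Basis" and U[measurable]: "U \<in> sets borel" and sph: "U \<subseteq> sphere 0 1"
    and cl: "U \<subseteq> cball b \<delta>" and \<delta>: "0 \<le> \<delta>" "\<delta> < 1"
  shows "emeasure cone_measure U \<le>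
    ennreal (unit_ball_vol (real (DIM('a) - 1)) * (diameter U / (1 - \<delta>)\<^sup>2 / 2) ^ (DIM('a) - 1))"
proof -
  let ?I = "Basis - {b}"
  let ?y = "\<lambda>v. 1 *\<^sub>R b + (\<Sum>i\<in>?I. v i *\<^sub>R i)"
  have nb: "norm b = 1" using b by simp
  have card: "card ?I = DIM('a) - 1" using b by simp
  have bU: "bounded U" using cl bounded_subset bounded_cball by blast
  have ym[measurable]: "?y \<in> lborel_PiM ?I \<rightarrow>\<^sub>M borel" by measurable
  define V where "V = {v \<in> space (lborel_PiM ?I). sgn (?y v) \<in> U}"
  have V[measurable]: "V \<in> sets (lborel_PiM ?I)" unfolding V_def by measurable
  have Ub: "0 < w \<bullet> b" if "w \<in> U" for w
  proof -
    have "\<bar>(w - b) \<bullet> b\<bar> \<le> norm (w - b) * norm b" by (rule Cauchy_Schwarz_ineq2)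
    moreover have "norm (w - b) \<le> \<delta>" using cl that by (auto simp: dist_norm norm_minus_commute)
    ultimately show ?thesis using nb \<delta> by (simp add: inner_diff_left power2_norm_eq_inner[symmetric])
  qed
  have sub: "{z \<in> cball 0 1. sgn z \<in> U} \<subseteq> {z. 0 < z \<bullet> b \<and> z \<bullet> b \<le> 1 \<and> (\<lambda>i\<in>?I. (z \<bullet> i) / (z \<bullet> b)) \<in> V}"
  proof safe
    fix z :: 'a assume z: "z \<in> cball 0 1" "sgn z \<in> U"
    from Ub[OF z(2)] show pos: "0 < z \<bullet> b"
      by (simp add: sgn_div_norm zero_less_mult_iff)
    have "z \<bullet> b \<le> norm z * norm b" by (rule norm_cauchy_schwarz)
    then show "z \<bullet> b \<le> 1" using z nb by simp
    have "?y (\<lambda>i\<in>?I. (z \<bullet> i) / (z \<bullet> b)) = (1 / (z \<bullet> b)) *\<^sub>R z"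
    proof (rule euclidean_eqI)
      fix j :: 'a assume j: "j \<in> Basis"
      show "?y (\<lambda>i\<in>?I. (z \<bullet> i) / (z \<bullet> b)) \<bullet> j = ((1 / (z \<bullet> b)) *\<^sub>R z) \<bullet> j"
      proof (cases "j = b")
        case True
        then show ?thesis using pos by (simp only: inner_hyperplane_coords[OF b]) simp
      next
        case False
        then have j': "j \<in> ?I" using j by auto
        show ?thesis using j' by (subst inner_hyperplane_coords(2)[OF b j']) simp
      qed
    qed
    then have "sgn (?y (\<lambda>i\<in>?I. (z \<bullet> i) / (z \<bullet> b))) = sgn z"
      using pos by (simp only: sgn_scaleR) simp
    then show "(\<lambda>i\<in>?I. (z \<bullet> i) / (z \<bullet> b)) \<in> V"
      using z(2) by (auto simp: V_def space_PiM)
  qed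
  have diam: "(\<Sum>i\<in>?I. (v i - v' i)\<^sup>2) \<le> (diameter U / (1 - \<delta>)\<^sup>2)\<^sup>2" if "v \<in> V" "v' \<in> V" for v v'
  proof -
    have w: "sgn (?y v) \<in> U" "sgn (?y v') \<in> U" using that by (auto simp: V_def)
    have "norm (?y v - ?y v') \<le> norm (sgn (?y v) - sgn (?y v')) / (1 - \<delta>)\<^sup>2"
      using w cl by (intro gnomonic_lipschitz[OF nb] \<delta> inner_hyperplane_coords[OF b])
        (auto simp: dist_norm norm_minus_commute)
    also have "\<dots> \<le> diameter U / (1 - \<delta>)\<^sup>2"
      using diameter_bounded_bound[OF bU w] by (intro divide_right_mono) (auto simp: dist_norm)
    finally have "norm (?y v - ?y v') ^ 2 \<le> (diameter U / (1 - \<delta>)\<^sup>2)\<^sup>2"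
      by (intro power_mono) auto
    then show ?thesis unfolding norm_hyperplane_diff[OF b] .
  qed
  have "emeasure cone_measure U = ennreal DIM('a) * emeasure lborel {z \<in> cball 0 1. sgn z \<in> U}"
    by (rule emeasure_cone_measure[OF U])
  also have "\<dots> \<le> ennreal DIM('a) *
      emeasure lborel {z. 0 < z \<bullet> b \<and> z \<bullet> b \<le> 1 \<and> (\<lambda>i\<in>?I. (z \<bullet> i) / (z \<bullet> b)) \<in> V}"
    using emeasure_gnomonic_cone(1)[OF b V, of 1] by (intro mult_left_mono emeasure_mono sub) auto
  also have "\<dots> = emeasure (lborel_PiM ?I) V"
    by (subst emeasure_gnomonic_cone(2)[OF b V]) auto
  also have "\<dots> \<le> ennreal (unit_ball_vol (real (card ?I)) * (diameter U / (1 - \<delta>)\<^sup>2 / 2) ^ card ?I)"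
    using diameter_ge_0[OF bU] by (intro isodiametric_inequality_PiM V diam) auto
  finally show ?thesis unfolding card .
qed

text \<open>
  The central projection from the tangent plane at \<open>b\<close> to the sphere does not increase the distance
  to \<open>b\<close>. So the cone over a disc of radius \<open>r\<close> in the tangent plane has directions in the cap of
  radius \<open>r\<close>, and up to height \<open>1 / (1 + r)\<close> it lies in the unit ball.
\<close>

lemma cone_measure_cap_ge_at_pole:
  fixes b :: "'a::euclidean_space"
  assumes b: "b \<in> Basis" and r: "0 < r"
  shows "ennreal ((1 / (1 + r)) ^ DIM('a) * unit_ball_vol (real (DIM('a) - 1)) * r ^ (DIM('a) - 1))
    \<le> emeasure cone_measure (sphere 0 1 \<inter> cball b r)"
proof -
  let ?I = "Basis - {b}"
  let ?c = "1 / (1 + r)"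
  have nb: "norm b = 1" using b by simp
  have card: "card ?I = DIM('a) - 1" using b by simp
  define V where "V = {f. sqrt (\<Sum>i\<in>?I. (f i)\<^sup>2) \<le> r} \<inter> space (lborel_PiM ?I)"
  have V: "V \<in> sets (lborel_PiM ?I)" unfolding V_def by measurable
  have [measurable]: "sphere (0::'a) 1 \<inter> cball b r \<in> sets borel" by (intro sets.Int borel_closed) auto
  have sub: "{z. 0 < z \<bullet> b \<and> z \<bullet> b \<le> ?c \<and> (\<lambda>i\<in>?I. (z \<bullet> i) / (z \<bullet> b)) \<in> V}
      \<subseteq> {z \<in> cball 0 1. sgn z \<in> sphere 0 1 \<inter> cball b r}"
  proof
    fix z :: 'a assume "z \<in> {z. 0 < z \<bullet> b \<and> z \<bullet> b \<le> ?c \<and> (\<lambda>i\<in>?I. (z \<bullet> i) / (z \<bullet> b)) \<in> V}"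
    then have z: "0 < z \<bullet> b" "z \<bullet> b \<le> ?c"
      and zV: "sqrt (\<Sum>i\<in>?I. ((z \<bullet> i) / (z \<bullet> b))\<^sup>2) \<le> r" by (auto simp: V_def)
    define y where "y = (1 / (z \<bullet> b)) *\<^sub>R z"
    have yb: "y \<bullet> b = 1" using z by (simp add: y_def)
    have "norm (y - b) ^ 2 = (\<Sum>i\<in>Basis. ((y - b) \<bullet> i)\<^sup>2)"
      unfolding power2_norm_eq_inner by (subst euclidean_inner) (simp add: power2_eq_square)
    also have "\<dots> = ((y - b) \<bullet> b)\<^sup>2 + (\<Sum>i\<in>?I. ((y - b) \<bullet> i)\<^sup>2)"
      using b by (subst sum.remove[of _ b]) auto
    also have "((y - b) \<bullet> b)\<^sup>2 = 0" using yb nb by (simp add: inner_diff_left power2_norm_eq_inner[symmetric])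
    also have "(\<Sum>i\<in>?I. ((y - b) \<bullet> i)\<^sup>2) = (\<Sum>i\<in>?I. ((z \<bullet> i) / (z \<bullet> b))\<^sup>2)"
      using b by (intro sum.cong refl) (auto simp: y_def inner_diff_left inner_Basis)
    finally have "norm (y - b) = sqrt (\<Sum>i\<in>?I. ((z \<bullet> i) / (z \<bullet> b))\<^sup>2)"
      by (metis add_0 norm_ge_zero real_sqrt_unique)
    then have yr: "norm (y - b) \<le> r" using zV by simp
    have y1: "1 \<le> norm y" using Cauchy_Schwarz_ineq2[of y b] yb nb by simp
    have sy: "sgn z = sgn y" using z by (simp add: y_def sgn_scaleR)
    have "norm (sgn y - b) \<le> norm (y - b)"
    proof -
      let ?m = "norm y"
      have m0: "?m > 0" using y1 by linarith
      have n2: "norm (x - b) ^ 2 = norm x ^ 2 - 2 * (x \<bullet> b) + 1" for x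
        using nb unfolding power2_norm_eq_inner
        by (simp add: inner_diff_left inner_diff_right inner_commute norm_eq_1)
      have s: "norm (sgn y - b) ^ 2 = 2 - 2 / ?m"
        using m0 yb by (subst n2) (auto simp: norm_sgn sgn_div_norm divide_inverse)
      have t: "norm (y - b) ^ 2 = ?m\<^sup>2 - 1"
        by (subst n2) (simp add: yb)
      have "0 \<le> (?m - 1)\<^sup>2 * (?m + 2)" using m0 by (intro mult_nonneg_nonneg) auto
      also have "\<dots> = ?m * (?m\<^sup>2 - 1 - (2 - 2 / ?m))"
        using m0 by (simp add: field_simps power2_eq_square)
      finally have "0 \<le> ?m\<^sup>2 - 1 - (2 - 2 / ?m)" using m0 by (simp add: zero_le_mult_iff)
      then have "norm (sgn y - b) ^ 2 \<le> norm (y - b) ^ 2" unfolding s t by simp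
      then show ?thesis by (rule power2_le_imp_le) simp
    qed
    then have "sgn z \<in> cball b r" using yr sy by (simp add: dist_norm norm_minus_commute)
    moreover have "norm z \<le> 1"
    proof -
      have "norm y \<le> 1 + r" using norm_triangle_ineq[of b "y - b"] nb yr by simp
      moreover have "norm z = (z \<bullet> b) * norm y" using z by (simp add: y_def)
      moreover have "(z \<bullet> b) * norm y \<le> ?c * (1 + r)" if "norm y \<le> 1 + r"
        using z r that by (intro mult_mono) auto
      ultimately have "norm z \<le> ?c * (1 + r)" by simp
      then show ?thesis using r by simp
    qed
    ultimately show "z \<in> {z \<in> cball 0 1. sgn z \<in> sphere 0 1 \<inter> cball b r}"
      using z by (auto simp: norm_sgn)
  qed
  have "ennreal (?c ^ DIM('a) * unit_ball_vol (real (card ?I)) * r ^ card ?I)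
      = ennreal (?c ^ DIM('a)) * emeasure (lborel_PiM ?I) V"
    using r unfolding V_def by (subst emeasure_cball_aux) (auto simp: ennreal_mult[symmetric] mult.assoc simp del: card_Diff_insert)
  also have "\<dots> = ennreal DIM('a) * emeasure lborel {z. 0 < z \<bullet> b \<and> z \<bullet> b \<le> ?c \<and> (\<lambda>i\<in>?I. (z \<bullet> i) / (z \<bullet> b)) \<in> V}"
    using r by (intro emeasure_gnomonic_cone(2)[OF b V, symmetric]) auto
  also have "\<dots> \<le> ennreal DIM('a) * emeasure lborel {z \<in> cball 0 1. sgn z \<in> sphere 0 1 \<inter> cball b r}"
    by (intro mult_left_mono emeasure_mono sub) auto
  also have "\<dots> = emeasure cone_measure (sphere 0 1 \<inter> cball b r)"
    by (rule emeasure_cone_measure[symmetric]) auto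
  finally show ?thesis unfolding card .
qed


section \<open>Hausdorff measure of subsets of the sphere\<close>

lemma emeasure_cone_measure_orthogonal:
  fixes f :: "'a::euclidean_space \<Rightarrow> 'a"
  assumes f: "orthogonal_transformation f" and A[measurable]: "A \<in> sets borel"
  shows "f -` A \<in> sets borel" and "emeasure cone_measure (f -` A) = emeasure cone_measure A"
proof -
  have lin: "linear f" and nrm: "norm (f x) = norm x" for x
    using f by (auto simp: orthogonal_transformation)
  have fm[measurable]: "f \<in> borel_measurable borel"
    using lin by (intro borel_measurable_continuous_onI linear_continuous_on) (simp add: linear_conv_bounded_linear)
  show fA: "f -` A \<in> sets borel" using measurable_sets[OF fm A] by simp
  have c[measurable]: "cball (0::'a) 1 \<in> sets borel" by auto
  have B[measurable]: "{z \<in> cball 0 1. sgn z \<in> A} \<in> sets borel" by measurable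
  have "{z \<in> cball 0 1. sgn z \<in> f -` A} = f -` {z \<in> cball 0 1. sgn z \<in> A}"
    by (auto simp: nrm sgn_div_norm linear_cmul[OF lin])
  then have "emeasure lborel {z \<in> cball 0 1. sgn z \<in> f -` A} = emeasure (distr lborel borel f) {z \<in> cball 0 1. sgn z \<in> A}"
    by (subst emeasure_distr) auto
  then show "emeasure cone_measure (f -` A) = emeasure cone_measure A"
    by (simp add: emeasure_cone_measure fA distr_lborel_orthogonal[OF f])
qed

text \<open>
  An orthogonal map carries a basis vector to \<open>a\<close>, which reduces the claim to the estimate at a
  pole.
\<close>

lemma cone_measure_le_diameter:
  fixes U :: "(real ^ 'n::finite) set"
  assumes U: "U \<in> sets borel" and sph: "U \<subseteq> sphere 0 1" and a: "a \<in> sphere 0 1"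
    and cl: "U \<subseteq> cball a \<delta>" and \<delta>: "0 \<le> \<delta>" "\<delta> < 1"
  shows "ennreal ((1 - \<delta>) ^ (2 * (CARD('n) - 1))) * emeasure cone_measure U \<le>
    ennreal (unit_ball_vol (real (CARD('n) - 1)) * (diameter U / 2) ^ (CARD('n) - 1))"
proof -
  define b :: "real ^ 'n" where "b = axis undefined 1"
  let ?d = "CARD('n) - 1"
  have b: "b \<in> Basis" by (auto simp: b_def Basis_vec_def)
  obtain f where f: "orthogonal_transformation f" "f b = a"
    using orthogonal_transformation_exists_1[of b a] b a by auto
  have dst: "dist (f x) (f y) = dist x y" for x y
    using f by (simp add: orthogonal_transformation_isometry)
  have bU: "bounded U" using cl bounded_subset bounded_cball by blast
  have sub: "f -` U \<subseteq> cball b \<delta>" using cl f(2) dst by (auto simp: subset_eq)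
  then have bf: "bounded (f -` U)" using bounded_subset bounded_cball by blast
  have diam: "diameter (f -` U) \<le> diameter U"
  proof (rule diameter_le)
    fix x y assume "x \<in> f -` U" "y \<in> f -` U"
    then show "norm (x - y) \<le> diameter U"
      using diameter_bounded_bound[OF bU, of "f x" "f y"] by (simp add: dst dist_norm[symmetric])
  qed (use diameter_ge_0[OF bU] in auto)
  have "emeasure cone_measure U = emeasure cone_measure (f -` U)"
    using emeasure_cone_measure_orthogonal(2)[OF f(1) U] by simp
  also have "\<dots> \<le> ennreal (unit_ball_vol (real (DIM(real ^ 'n) - 1)) *
      (diameter (f -` U) / (1 - \<delta>)\<^sup>2 / 2) ^ (DIM(real ^ 'n) - 1))"
    using sph f(1)
    by (intro cone_measure_le_near_pole[OF b emeasure_cone_measure_orthogonal(1)[OF f(1) U] _ sub \<delta>])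
      (auto simp: orthogonal_transformation)
  also have "\<dots> \<le> ennreal (unit_ball_vol (real ?d) * (diameter U / (1 - \<delta>)\<^sup>2 / 2) ^ ?d)"
  proof -
    have "(diameter (f -` U) / (1 - \<delta>)\<^sup>2 / 2) ^ ?d \<le> (diameter U / (1 - \<delta>)\<^sup>2 / 2) ^ ?d"
      using diameter_ge_0[OF bf] by (intro power_mono divide_right_mono diam divide_nonneg_nonneg) auto
    then show ?thesis by (auto intro!: ennreal_leI mult_left_mono)
  qed
  finally have "ennreal ((1 - \<delta>) ^ (2 * ?d)) * emeasure cone_measure U \<le>
      ennreal ((1 - \<delta>) ^ (2 * ?d)) * ennreal (unit_ball_vol (real ?d) * (diameter U / (1 - \<delta>)\<^sup>2 / 2) ^ ?d)"
    by (intro mult_left_mono) auto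
  also have "\<dots> = ennreal ((1 - \<delta>) ^ (2 * ?d) * (unit_ball_vol (real ?d) * (diameter U / (1 - \<delta>)\<^sup>2 / 2) ^ ?d))"
    using \<delta> by (subst ennreal_mult') auto
  also have "(1 - \<delta>) ^ (2 * ?d) * (unit_ball_vol (real ?d) * (diameter U / (1 - \<delta>)\<^sup>2 / 2) ^ ?d)
      = unit_ball_vol (real ?d) * (diameter U / 2) ^ ?d"
    using \<delta> by (simp add: power_mult power_divide field_simps)
  finally show ?thesis .
qed

lemma cone_measure_cap_ge:
  fixes a :: "real ^ 'n::finite"
  assumes a: "a \<in> sphere 0 1" and r: "0 < r"
  shows "ennreal (unit_ball_vol (real (CARD('n) - 1)) * r ^ (CARD('n) - 1))
    \<le> ennreal ((1 + r) ^ CARD('n)) * emeasure cone_measure (sphere 0 1 \<inter> cball a r)"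
proof -
  define b :: "real ^ 'n" where "b = axis undefined 1"
  let ?d = "CARD('n) - 1"
  have b: "b \<in> Basis" by (auto simp: b_def Basis_vec_def)
  obtain f where f: "orthogonal_transformation f" "f b = a"
    using orthogonal_transformation_exists_1[of b a] b a by auto
  have dst: "dist (f x) (f y) = dist x y" for x y
    using f by (simp add: orthogonal_transformation_isometry)
  have "f -` (sphere 0 1 \<inter> cball a r) = sphere 0 1 \<inter> cball b r"
    using f dst[of b] by (auto simp: orthogonal_transformation)
  moreover have "sphere (0::real ^ 'n) 1 \<inter> cball a r \<in> sets borel" by (intro sets.Int borel_closed) auto
  ultimately have eq: "emeasure cone_measure (sphere 0 1 \<inter> cball a r) = emeasure cone_measure (sphere 0 1 \<inter> cball b r)"
    using emeasure_cone_measure_orthogonal(2)[OF f(1)] by metis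
  have "ennreal (unit_ball_vol (real ?d) * r ^ ?d)
      = ennreal ((1 + r) ^ CARD('n)) * ennreal ((1 / (1 + r)) ^ CARD('n) * unit_ball_vol (real ?d) * r ^ ?d)"
    using r by (subst ennreal_mult'[symmetric]) (auto simp: power_divide field_simps)
  also have "\<dots> \<le> ennreal ((1 + r) ^ CARD('n)) * emeasure cone_measure (sphere 0 1 \<inter> cball b r)"
    using cone_measure_cap_ge_at_pole[OF b r] by (intro mult_left_mono) auto
  finally show ?thesis unfolding eq .
qed

text \<open>
  The pieces of a covering by sets of diameter at most \<open>\<delta>\<close> may be intersected with the sphere and
  closed without increasing their weights. By the previous estimates the cone measure of each piece
  is then at most its weight, up to a factor that tends to \<open>1\<close> with \<open>\<delta>\<close>.
\<close>

lemma cone_measure_le_hausdorff: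
  fixes A :: "(real ^ 'n::finite) set"
  assumes A: "A \<in> sets borel" "A \<subseteq> sphere 0 1"
  shows "emeasure cone_measure A \<le> hausdorff_outer (CARD('n) - 1) A"
proof -
  let ?d = "CARD('n) - 1"
  interpret finite_measure "cone_measure :: (real ^ 'n) measure" by (rule finite_measure_cone_measure)
  have *: "ennreal ((1 - \<delta>) ^ (2 * ?d)) * emeasure cone_measure A \<le> hausdorff_outer ?d A"
    if \<delta>: "0 < \<delta>" "\<delta> < 1" for \<delta>
  proof -
    have "ennreal ((1 - \<delta>) ^ (2 * ?d)) * emeasure cone_measure A \<le> (\<Sum>i. hausdorff_weight ?d (U i))"
      if U: "A \<subseteq> (\<Union>i. U i)" "\<And>i. bounded (U i)" "\<And>i. diameter (U i) \<le> \<delta>" for U :: "nat \<Rightarrow> (real ^ 'n) set"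
    proof -
      define W where "W i = closure (U i \<inter> sphere 0 1)" for i
      have W[measurable]: "W i \<in> sets borel" for i by (auto simp: W_def)
      have bUi: "bounded (U i \<inter> sphere 0 1)" for i using U(2) by auto
      have Wle: "ennreal ((1 - \<delta>) ^ (2 * ?d)) * emeasure cone_measure (W i) \<le> hausdorff_weight ?d (U i)" for i
      proof (cases "U i \<inter> sphere 0 1 = {}")
        case True
        then show ?thesis by (simp add: W_def)
      next
        case False
        then obtain a where a: "a \<in> U i" "a \<in> sphere 0 1" by auto
        have "U i \<inter> sphere 0 1 \<subseteq> cball a \<delta>"
          using diameter_bounded_bound[OF U(2) a(1)] U(3)[of i] by fastforce
        then have W1: "W i \<subseteq> cball a \<delta>" unfolding W_def by (rule closure_minimal) auto
        have W2: "W i \<subseteq> sphere 0 1" unfolding W_def by (rule closure_minimal) auto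
        have "diameter (W i) = diameter (U i \<inter> sphere 0 1)" unfolding W_def by (rule diameter_closure[OF bUi])
        also have "\<dots> \<le> diameter (U i)" by (rule diameter_subset[OF _ U(2)]) auto
        finally have dW: "diameter (W i) \<le> diameter (U i)" .
        have "ennreal ((1 - \<delta>) ^ (2 * ?d)) * emeasure cone_measure (W i) \<le>
            ennreal (unit_ball_vol (real ?d) * (diameter (W i) / 2) ^ ?d)"
          using \<delta> by (intro cone_measure_le_diameter[OF W W2 a(2) W1]) auto
        also have "\<dots> \<le> ennreal (unit_ball_vol (real ?d) * (diameter (U i) / 2) ^ ?d)"
          using dW bounded_closure[OF bUi, of i]
          by (intro ennreal_leI mult_left_mono power_mono) (auto simp: W_def intro!: diameter_ge_0)
        also have "\<dots> = hausdorff_weight ?d (U i)" using a by (auto simp: hausdorff_weight_def)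
        finally show ?thesis .
      qed
      have "A \<subseteq> (\<Union>i. W i)"
      proof
        fix x assume "x \<in> A"
        then obtain i where "x \<in> U i \<inter> sphere 0 1" using U(1) A(2) by blast
        then have "x \<in> W i" unfolding W_def by (rule subsetD[OF closure_subset])
        then show "x \<in> (\<Union>i. W i)" by (rule UN_I[OF UNIV_I])
      qed
      then have "emeasure cone_measure A \<le> emeasure cone_measure (\<Union>i. W i)"
        by (intro emeasure_mono) auto
      also have "\<dots> \<le> (\<Sum>i. emeasure cone_measure (W i))"
        by (intro emeasure_subadditive_countably) auto
      finally have "ennreal ((1 - \<delta>) ^ (2 * ?d)) * emeasure cone_measure A \<le>
          ennreal ((1 - \<delta>) ^ (2 * ?d)) * (\<Sum>i. emeasure cone_measure (W i))"
        by (intro mult_left_mono) auto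
      also have "\<dots> = (\<Sum>i. ennreal ((1 - \<delta>) ^ (2 * ?d)) * emeasure cone_measure (W i))"
        by simp
      also have "\<dots> \<le> (\<Sum>i. hausdorff_weight ?d (U i))"
        by (intro suminf_le Wle) auto
      finally show ?thesis .
    qed
    then have "ennreal ((1 - \<delta>) ^ (2 * ?d)) * emeasure cone_measure A \<le> hausdorff_premeasure ?d \<delta> A"
      unfolding hausdorff_premeasure_def by (intro INF_greatest) auto
    also have "\<dots> \<le> hausdorff_outer ?d A" by (rule hausdorff_premeasure_le_outer[OF \<delta>(1)])
    finally show ?thesis .
  qed
  let ?m = "measure cone_measure A"
  have "((\<lambda>\<delta>. ennreal ((1 - \<delta>) ^ (2 * ?d) * ?m)) \<longlongrightarrow> ennreal ((1 - 0) ^ (2 * ?d) * ?m)) (at_right 0)"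
    by (intro tendsto_intros)
  then have "ennreal ((1 - 0) ^ (2 * ?d) * ?m) \<le> hausdorff_outer ?d A"
  proof (rule tendsto_upperbound)
    show "\<forall>\<^sub>F \<delta> in at_right 0. ennreal ((1 - \<delta>) ^ (2 * ?d) * ?m) \<le> hausdorff_outer ?d A"
      using * by (intro eventually_at_rightI[of 0 1]) (auto simp: emeasure_eq_measure ennreal_mult)
  qed simp
  then show ?thesis by (simp add: emeasure_eq_measure)
qed

text \<open>
  Vitali's covering lemma, applied to the balls of radius at most \<open>\<rho>\<close> with centres on the sphere,
  yields disjoint closed balls such that, for every \<open>m\<close>, the first \<open>m\<close> balls together with the
  five times enlarged remaining ones cover the sphere: a point outside the first \<open>m\<close> balls is the
  centre of a ball disjoint from them. The weight of a cap is almost at most its cone measure, and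
  the caps are disjoint, so the sum of all weights is almost at most the cone measure of the
  sphere. The contribution of the enlarged balls is a tail of this convergent series and vanishes
  as \<open>m\<close> tends to infinity.
\<close>

lemma hausdorff_sphere_le_cone_measure:
  "hausdorff_outer (CARD('n) - 1) (sphere (0::real ^ 'n) 1) \<le> emeasure cone_measure (sphere (0::real ^ 'n::finite) 1)"
proof -
  let ?d = "CARD('n) - 1"
  let ?S = "sphere (0::real ^ 'n) 1"
  interpret finite_measure "cone_measure :: (real ^ 'n) measure" by (rule finite_measure_cone_measure)
  define \<alpha> where "\<alpha> = unit_ball_vol (real ?d)"
  have \<alpha>: "0 \<le> \<alpha>" by (simp add: \<alpha>_def)
  have *: "hausdorff_premeasure ?d (10 * \<rho>) ?S \<le> ennreal ((1 + \<rho>) ^ CARD('n)) * emeasure cone_measure ?S"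
    if \<rho>: "0 < \<rho>" for \<rho>
  proof -
    define K where "K = ?S \<times> {0<..\<rho>}"
    obtain C where C: "countable C" "C \<subseteq> K"
      "pairwise (\<lambda>i j. disjnt (cball (fst i) (snd i)) (cball (fst j) (snd j))) C"
      "\<And>i. i \<in> K \<Longrightarrow> \<exists>j. j \<in> C \<and> \<not> disjnt (cball (fst i) (snd i)) (cball (fst j) (snd j)) \<and>
          cball (fst i) (snd i) \<subseteq> ball (fst j) (5 * snd j)"
    proof (rule Vitali_covering_lemma_cballs_balls[of K snd \<rho> fst])
      show "0 < snd i \<and> snd i \<le> \<rho>" if "i \<in> K" for i using that by (auto simp: K_def)
    qed blast
    (* e enumerates the chosen balls, as pairs of centre and radius; N is its domain, and indices
       outside N get the empty cap and the weight 0 *)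
    define e where "e = from_nat_into C"
    define N where "N = to_nat_on C ` C"
    have eC: "e i \<in> C" if "i \<in> N" for i using that C(1) by (auto simp: e_def N_def)
    have eN: "\<exists>i\<in>N. e i = c" if "c \<in> C" for c using that C(1) by (auto simp: e_def N_def)
    have einj: "i = j" if "i \<in> N" "j \<in> N" "e i = e j" for i j using that C(1) by (auto simp: e_def N_def)
    define T where "T i = (if i \<in> N then \<alpha> * snd (e i) ^ ?d else 0)" for i
    have eK: "fst (e i) \<in> ?S" "0 < snd (e i)" "snd (e i) \<le> \<rho>" if "i \<in> N" for i
      using eC[OF that] C(2) by (auto simp: K_def)
    have T0: "0 \<le> T i" for i using eK(2)[of i] \<alpha> by (auto simp: T_def)
    define cap where "cap i = (if i \<in> N then ?S \<inter> cball (fst (e i)) (snd (e i)) else {})" for i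
    have cap[measurable]: "cap i \<in> sets borel" for i by (auto simp: cap_def intro!: borel_closed sets.Int)
    have "disjoint_family cap"
      unfolding disjoint_family_on_def
    proof (intro ballI impI)
      fix i j :: nat assume "i \<noteq> j"
      show "cap i \<inter> cap j = {}"
      proof (cases "i \<in> N \<and> j \<in> N")
        case True
        then have "e i \<noteq> e j" using einj \<open>i \<noteq> j\<close> by auto
        then have "disjnt (cball (fst (e i)) (snd (e i))) (cball (fst (e j)) (snd (e j)))"
          using C(3) eC True by (auto simp: pairwise_def)
        then show ?thesis using True by (auto simp: cap_def disjnt_def)
      qed (auto simp: cap_def)
    qed
    then have capsum: "(\<Sum>i. emeasure cone_measure (cap i)) = emeasure cone_measure (\<Union>i. cap i)"
      by (intro suminf_emeasure) auto
    have "ennreal (T i) \<le> ennreal ((1 + \<rho>) ^ CARD('n)) * emeasure cone_measure (cap i)" for i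
    proof (cases "i \<in> N")
      case True
      have "ennreal (T i) \<le> ennreal ((1 + snd (e i)) ^ CARD('n)) * emeasure cone_measure (cap i)"
        using cone_measure_cap_ge[OF eK(1,2)] True by (simp add: T_def cap_def \<alpha>_def)
      also have "\<dots> \<le> ennreal ((1 + \<rho>) ^ CARD('n)) * emeasure cone_measure (cap i)"
        using eK[OF True] by (intro mult_right_mono ennreal_leI power_mono) auto
      finally show ?thesis .
    qed (simp add: T_def)
    then have "(\<Sum>i. ennreal (T i)) \<le> (\<Sum>i. ennreal ((1 + \<rho>) ^ CARD('n)) * emeasure cone_measure (cap i))"
      by (intro suminf_le) auto
    also have "\<dots> = ennreal ((1 + \<rho>) ^ CARD('n)) * emeasure cone_measure (\<Union>i. cap i)"
      by (simp add: capsum)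
    also have "\<dots> \<le> ennreal ((1 + \<rho>) ^ CARD('n)) * emeasure cone_measure ?S"
      by (intro mult_left_mono emeasure_mono) (auto simp: cap_def split: if_splits)
    finally have Tsum: "(\<Sum>i. ennreal (T i)) \<le> ennreal ((1 + \<rho>) ^ CARD('n)) * emeasure cone_measure ?S" .
    then have "(\<Sum>i. ennreal (T i)) \<noteq> top"
      by (auto simp: top_unique ennreal_mult_eq_top_iff emeasure_eq_measure)
    then have sumT: "summable T" using T0 by (intro summable_suminf_not_top) auto
    have fine: "hausdorff_premeasure ?d (10 * \<rho>) ?S \<le> ennreal ((\<Sum>i<m. T i) + 5 ^ ?d * (\<Sum>i. T (i + m)))" for m
    proof -
      define U where "U i = (if i \<in> N then cball (fst (e i)) (if i < m then snd (e i) else 5 * snd (e i)) else {})" for i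
      have "?S \<subseteq> (\<Union>i. U i)"
      proof
        fix x assume x: "x \<in> ?S"
        define Z where "Z = (\<Union>i\<in>{i\<in>N. i < m}. cball (fst (e i)) (snd (e i)))"
        have "closed Z" unfolding Z_def by (intro closed_UN) auto
        show "x \<in> (\<Union>i. U i)"
        proof (cases "x \<in> Z")
          case True
          then show ?thesis by (auto simp: Z_def U_def intro!: exI)
        next
          case False
          then have "open (- Z)" "x \<in> - Z" using \<open>closed Z\<close> by auto
          then obtain r0 where r0: "r0 > 0" "cball x r0 \<subseteq> - Z" using open_contains_cball by blast
          define r where "r = min r0 \<rho>"
          have r: "0 < r" "r \<le> \<rho>" "cball x r \<subseteq> - Z" using r0 \<rho> by (auto simp: r_def)
          then have "(x, r) \<in> K" using x by (auto simp: K_def)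
          from C(4)[OF this] obtain c where c: "c \<in> C" "\<not> disjnt (cball x r) (cball (fst c) (snd c))"
            "cball x r \<subseteq> ball (fst c) (5 * snd c)" by auto
          obtain i where i: "i \<in> N" "e i = c" using eN[OF c(1)] by auto
          have "\<not> i < m"
          proof
            assume "i < m"
            then have "cball (fst c) (snd c) \<subseteq> Z" using i by (auto simp: Z_def)
            then show False using c(2) r(3) by (auto simp: disjnt_def)
          qed
          moreover have "x \<in> ball (fst c) (5 * snd c)" using c(3) r(1) by (rule_tac subsetD) auto
          then have "x \<in> cball (fst c) (5 * snd c)" by simp
          ultimately have "x \<in> U i" using i by (auto simp: U_def)
          then show ?thesis by auto
        qed
      qed
      then have "hausdorff_premeasure ?d (10 * \<rho>) ?S \<le> (\<Sum>i. hausdorff_weight ?d (U i))"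
      proof (rule hausdorff_premeasure_le)
        fix i
        show "bounded (U i)" by (simp add: U_def)
        show "diameter (U i) \<le> 10 * \<rho>" using eK(2,3)[of i] \<rho> by (auto simp: U_def)
      qed
      also have "\<dots> = (\<Sum>i. hausdorff_weight ?d (U (i + m))) + (\<Sum>i<m. hausdorff_weight ?d (U i))"
        by (intro suminf_offset) auto
      also have "\<dots> \<le> (\<Sum>i. ennreal (5 ^ ?d * T (i + m))) + (\<Sum>i<m. ennreal (T i))"
      proof (intro add_mono suminf_le sum_mono)
        fix i show "hausdorff_weight ?d (U (i + m)) \<le> ennreal (5 ^ ?d * T (i + m))"
          using eK(2)[of "i + m"] by (auto simp: hausdorff_weight_def U_def T_def \<alpha>_def power_mult_distrib intro!: ennreal_leI)
      next
        fix i assume "i \<in> {..<m}"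
        then show "hausdorff_weight ?d (U i) \<le> ennreal (T i)"
          using eK(2)[of i] by (auto simp: hausdorff_weight_def U_def T_def \<alpha>_def intro!: ennreal_leI)
      qed auto
      also have "\<dots> = ennreal (\<Sum>i. 5 ^ ?d * T (i + m)) + ennreal (\<Sum>i<m. T i)"
        using T0 sumT by (subst suminf_ennreal2) (auto intro: summable_mult summable_ignore_initial_segment)
      also have "\<dots> = ennreal ((\<Sum>i. 5 ^ ?d * T (i + m)) + (\<Sum>i<m. T i))"
        using T0 sumT by (intro ennreal_plus[symmetric] suminf_nonneg sum_nonneg)
          (auto intro: summable_mult summable_ignore_initial_segment)
      also have "(\<Sum>i. 5 ^ ?d * T (i + m)) = 5 ^ ?d * (\<Sum>i. T (i + m))"
        using sumT by (intro suminf_mult) (auto intro: summable_ignore_initial_segment)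
      finally show ?thesis by (simp add: add.commute)
    qed
    have "(\<lambda>m. (\<Sum>i<m. T i) + 5 ^ ?d * (suminf T - (\<Sum>i<m. T i))) \<longlonglongrightarrow> suminf T + 5 ^ ?d * (suminf T - suminf T)"
      using sumT by (intro tendsto_intros summable_LIMSEQ)
    then have "(\<lambda>m. ennreal ((\<Sum>i<m. T i) + 5 ^ ?d * (\<Sum>i. T (i + m)))) \<longlonglongrightarrow> ennreal (suminf T)"
      using sumT by (auto simp: suminf_minus_initial_segment intro!: tendsto_ennrealI)
    then have "hausdorff_premeasure ?d (10 * \<rho>) ?S \<le> ennreal (suminf T)"
      by (rule LIMSEQ_le_const) (use fine in auto)
    also have "\<dots> = (\<Sum>i. ennreal (T i))" using T0 sumT by (intro suminf_ennreal2[symmetric]) auto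
    finally show ?thesis using Tsum by (rule order_trans)
  qed
  let ?m = "measure cone_measure ?S"
  show ?thesis
    unfolding hausdorff_outer_def
  proof (rule SUP_least)
    fix \<delta> :: real assume \<delta>: "\<delta> \<in> {0<..}"
    have "((\<lambda>\<rho>. ennreal ((1 + \<rho>) ^ CARD('n) * ?m)) \<longlongrightarrow> ennreal ((1 + 0) ^ CARD('n) * ?m)) (at_right 0)"
      by (intro tendsto_intros)
    then have "hausdorff_premeasure ?d \<delta> ?S \<le> ennreal ((1 + 0) ^ CARD('n) * ?m)"
    proof (rule tendsto_lowerbound)
      show "\<forall>\<^sub>F \<rho> in at_right 0. hausdorff_premeasure ?d \<delta> ?S \<le> ennreal ((1 + \<rho>) ^ CARD('n) * ?m)"
      proof (rule eventually_at_rightI[of 0 "\<delta> / 10"])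
        fix \<rho> assume \<rho>: "\<rho> \<in> {0<..<\<delta> / 10}"
        have "hausdorff_premeasure ?d \<delta> ?S \<le> hausdorff_premeasure ?d (10 * \<rho>) ?S"
          using \<rho> by (intro hausdorff_premeasure_antimono) auto
        also have "\<dots> \<le> ennreal ((1 + \<rho>) ^ CARD('n)) * emeasure cone_measure ?S" using \<rho> by (intro *) auto
        finally show "hausdorff_premeasure ?d \<delta> ?S \<le> ennreal ((1 + \<rho>) ^ CARD('n) * ?m)"
          using \<rho> by (simp add: emeasure_eq_measure ennreal_mult)
      qed (use \<delta> in auto)
    qed simp
    then show "hausdorff_premeasure ?d \<delta> ?S \<le> emeasure cone_measure ?S" by (simp add: emeasure_eq_measure)
  qed
qed

text \<open>
  One inequality holds for every Borel set and the other for the whole sphere. Passing to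
  complements in the sphere, where the total mass is finite, gives equality for every set.
\<close>

theorem hausdorff_measure_sphere:
  fixes A :: "(real ^ 'n::finite) set"
  assumes A: "A \<in> sets borel" "A \<subseteq> sphere 0 1"
  shows "emeasure (hausdorff_measure (CARD('n) - 1)) A = emeasure cone_measure A"
proof (rule antisym)
  let ?H = "hausdorff_measure (CARD('n) - 1) :: (real ^ 'n) measure"
  let ?S = "sphere (0::real ^ 'n) 1"
  interpret finite_measure "cone_measure :: (real ^ 'n) measure" by (rule finite_measure_cone_measure)
  have S: "?S \<in> sets borel" by simp
  have SA: "?S - A \<in> sets borel" using A by auto
  have le: "emeasure cone_measure B \<le> emeasure ?H B" if "B \<in> sets borel" "B \<subseteq> ?S" for B
    using cone_measure_le_hausdorff[OF that] that by (simp add: emeasure_hausdorff_measure)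
  show "emeasure cone_measure A \<le> emeasure ?H A" using le A by simp
  have U: "A \<union> (?S - A) = ?S" using A by auto
  have "emeasure ?H A + emeasure cone_measure (?S - A) \<le> emeasure ?H A + emeasure ?H (?S - A)"
    using SA by (intro add_left_mono le) auto
  also have "\<dots> = emeasure ?H ?S" using A SA U by (subst plus_emeasure) auto
  also have "\<dots> \<le> emeasure cone_measure ?S"
    using hausdorff_sphere_le_cone_measure S by (simp add: emeasure_hausdorff_measure)
  also have "\<dots> = emeasure cone_measure A + emeasure cone_measure (?S - A)"
    using A SA U by (subst plus_emeasure) auto
  finally show "emeasure ?H A \<le> emeasure cone_measure A"
    by (simp add: add.commute[of _ "emeasure cone_measure (?S - A)"] ennreal_add_left_cancel_le)
qed

corollary nn_integral_hausdorff_sphere: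
  fixes F :: "real ^ 'n::finite \<Rightarrow> ennreal"
  assumes [measurable]: "F \<in> borel_measurable borel"
  shows "(\<integral>\<^sup>+w. F w * indicator (sphere 0 1) w \<partial>hausdorff_measure (CARD('n) - 1)) = (\<integral>\<^sup>+w. F w \<partial>cone_measure)"
proof -
  let ?H = "hausdorff_measure (CARD('n) - 1) :: (real ^ 'n) measure"
  have S[measurable]: "sphere (0::real ^ 'n) 1 \<in> sets borel" by simp
  have "density ?H (indicator (sphere 0 1)) = cone_measure"
  proof (rule measure_eqI)
    fix A assume "A \<in> sets (density ?H (indicator (sphere 0 1)))"
    then have A[measurable]: "A \<in> sets borel" by simp
    have "emeasure (density ?H (indicator (sphere 0 1))) A = (\<integral>\<^sup>+w. indicator (sphere 0 1) w * indicator A w \<partial>?H)"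
      by (rule emeasure_density) auto
    also have "\<dots> = (\<integral>\<^sup>+w. indicator (A \<inter> sphere 0 1) w \<partial>?H)"
      by (intro nn_integral_cong) (simp only: indicator_inter_arith mult.commute)
    also have "\<dots> = emeasure ?H (A \<inter> sphere 0 1)" by (rule nn_integral_indicator) simp
    also have "\<dots> = emeasure cone_measure (A \<inter> sphere 0 1)" by (intro hausdorff_measure_sphere) auto
    also have "\<dots> = emeasure cone_measure A"
    proof (rule emeasure_eq_AE)
      show "AE w in cone_measure. w \<in> A \<inter> sphere 0 1 \<longleftrightarrow> w \<in> A"
        using AE_cone_measure_norm by eventually_elim auto
    qed auto
    finally show "emeasure (density ?H (indicator (sphere 0 1))) A = emeasure cone_measure A" .
  qed simp
  then have "(\<integral>\<^sup>+w. F w \<partial>cone_measure) = (\<integral>\<^sup>+w. F w \<partial>density ?H (indicator (sphere 0 1)))" by simp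
  also have "\<dots> = (\<integral>\<^sup>+w. F w * indicator (sphere 0 1) w \<partial>?H)"
    by (subst nn_integral_density) (auto simp: mult.commute)
  finally show ?thesis ..
qed


section \<open>Polar coordinates\<close>

lemma emeasure_lborel_scaleR:
  fixes r :: real
  assumes r: "0 < r" and B[measurable]: "B \<in> sets (borel :: 'a::euclidean_space measure)"
  shows "emeasure lborel B = ennreal (r ^ DIM('a)) * emeasure lborel {x. r *\<^sub>R x \<in> B}"
proof -
  have m: "(\<lambda>x::'a. 0 + r *\<^sub>R x) \<in> borel_measurable borel" by measurable
  have "emeasure lborel B = emeasure (density (distr lborel borel (\<lambda>x::'a. 0 + r *\<^sub>R x)) (\<lambda>_. \<bar>r\<bar> ^ DIM('a))) B"
    using r by (subst lborel_affine[of r 0]) auto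
  also have "\<dots> = ennreal (r ^ DIM('a)) * emeasure (distr lborel borel (\<lambda>x::'a. 0 + r *\<^sub>R x)) B"
    using r by (subst emeasure_density_const) auto
  also have "emeasure (distr lborel borel (\<lambda>x::'a. 0 + r *\<^sub>R x)) B = emeasure lborel {x. r *\<^sub>R x \<in> B}"
    using m by (subst emeasure_distr) (auto simp: vimage_def)
  finally show ?thesis .
qed

lemma AE_lborel_norm_neq: "AE z in (lborel :: 'a::euclidean_space measure). norm z \<noteq> r"
proof -
  have "negligible (sphere (0::'a) r)" by (rule negligible_sphere)
  then have "sphere (0::'a) r \<in> null_sets lborel"
    by (simp add: negligible_iff_null_sets null_sets_completion_iff)
  then have "AE z in lborel. z \<notin> sphere (0::'a) r" by (rule AE_not_in)
  then show ?thesis by eventually_elim auto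
qed

lemma nn_integral_exp_greaterThan:
  fixes n x :: real
  assumes n: "0 < n"
  shows "(\<integral>\<^sup>+t. ennreal (exp (- (n * t))) * indicator {x<..} t \<partial>lborel) = ennreal (exp (- (n * x)) / n)"
proof -
  have "(\<integral>\<^sup>+t. ennreal (exp (- (n * t))) * indicator {x<..} t \<partial>lborel)
      = (\<integral>\<^sup>+t. ennreal (exp (- (n * t))) * indicator {x..} t \<partial>lborel)"
    using AE_lborel_singleton[of x] by (intro nn_integral_cong_AE) (auto elim!: eventually_mono split: split_indicator)
  also have "\<dots> = ennreal (0 - - exp (- (n * x)) / n)"
  proof (rule nn_integral_FTC_atLeast)
    show "((\<lambda>t. - exp (- (n * t)) / n) has_real_derivative exp (- (n * t))) (at t)" for t
      using n by (auto intro!: derivative_eq_intros)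
    have "filterlim (\<lambda>t. n * t) at_top at_top"
      using n by (intro filterlim_tendsto_pos_mult_at_top[OF tendsto_const n filterlim_ident])
    then have "((\<lambda>t. exp (- (n * t))) \<longlongrightarrow> 0) at_top"
      by (intro filterlim_compose[OF exp_at_bot] filterlim_compose[OF filterlim_uminus_at_bot_at_top])
    then show "((\<lambda>t. - exp (- (n * t)) / n) \<longlongrightarrow> 0) at_top"
      using tendsto_divide[OF tendsto_minus tendsto_const[of n]] n by fastforce
  qed auto
  finally show ?thesis by simp
qed

text \<open>
  With \<open>z = exp (- t) w\<close> the claim says that the image of the Lebesgue measure under
  \<open>z \<mapsto> (sgn z, - ln (norm z))\<close> is the product of the cone measure and the measure with density
  \<open>exp (- n t)\<close>. Product measures are determined by rectangles, and measures on the line that are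
  finite on the half lines \<open>{x<..}\<close> are determined by those. What remains is that the part of a
  cone inside the ball of radius \<open>exp (- x)\<close> has \<open>exp (- n x)\<close> times the volume of the part inside
  the unit ball. The logarithmic radius is used because the substitution in the energy is then
  linear.
\<close>

lemma nn_integral_polar:
  fixes F :: "'a::euclidean_space \<Rightarrow> ennreal"
  assumes F[measurable]: "F \<in> borel_measurable borel"
  shows "(\<integral>\<^sup>+z. F z \<partial>lborel) =
    (\<integral>\<^sup>+w. (\<integral>\<^sup>+t. ennreal (exp (- (real DIM('a) * t))) * F (exp (- t) *\<^sub>R w) \<partial>lborel) \<partial>cone_measure)"
proof -
  let ?n = "real DIM('a)"
  let ?\<phi> = "\<lambda>z::'a. (sgn z, - ln (norm z))"
  define M where "M = distr lborel (borel \<Otimes>\<^sub>M borel) ?\<phi>"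
  define N where "N = density lborel (\<lambda>t. ennreal (exp (- (?n * t))))"
  have \<phi>[measurable]: "?\<phi> \<in> borel \<rightarrow>\<^sub>M borel \<Otimes>\<^sub>M borel" by measurable
  have n: "0 < ?n" by simp
  interpret cone: finite_measure "cone_measure :: 'a measure" by (rule finite_measure_cone_measure)
  have sfN: "sigma_finite_measure N"
    unfolding N_def by (subst sigma_finite_measure.sigma_finite_iff_density_finite[OF sigma_finite_lborel]) auto
  interpret N: sigma_finite_measure N by (rule sfN)
  have setsN[measurable_cong]: "sets N = sets borel" by (simp add: N_def)
  have c[measurable]: "cball (0::'a) 1 \<in> sets borel" by auto
  have prod: "cone_measure \<Otimes>\<^sub>M N = M"
  proof (rule pair_measure_eqI)
    show "sigma_finite_measure (cone_measure :: 'a measure)" ..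
    show "sigma_finite_measure N" by (rule sfN)
    show "sets (cone_measure \<Otimes>\<^sub>M N) = sets M"
      by (simp add: M_def N_def cong: sets_pair_measure_cong)
    fix A B assume "A \<in> sets (cone_measure :: 'a measure)" and "B \<in> sets N"
    then have A[measurable]: "A \<in> sets borel" and B[measurable]: "B \<in> sets borel" by (auto simp: N_def)
    let ?c = "emeasure cone_measure A"
    have cfin: "?c < top" using cone.emeasure_finite[of A] by (simp add: less_top[symmetric])
    define M' where "M' = distr (density lborel (\<lambda>z. indicator A (sgn z))) borel (\<lambda>z::'a. - ln (norm z))"
    define N' where "N' = density lborel (\<lambda>t. ?c * ennreal (exp (- (?n * t))))"
    have M': "emeasure M' C = emeasure M (A \<times> C)" if [measurable]: "C \<in> sets borel" for C
    proof -
      have "(\<lambda>z::'a. - ln (norm z)) \<in> borel_measurable borel" by measurable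
      from measurable_sets[OF this that]
      have C': "(\<lambda>z::'a. - ln (norm z)) -` C \<in> sets borel" by simp
      have "emeasure M' C = (\<integral>\<^sup>+z. indicator A (sgn z) * indicator ((\<lambda>z. - ln (norm z)) -` C) z \<partial>lborel)"
        unfolding M'_def using C' by (subst emeasure_distr, measurable, subst emeasure_density) auto
      also have "\<dots> = (\<integral>\<^sup>+z. indicator (?\<phi> -` (A \<times> C)) z \<partial>lborel)"
        by (intro nn_integral_cong) (auto split: split_indicator)
      also have "\<dots> = emeasure lborel (?\<phi> -` (A \<times> C))"
        using measurable_sets[OF \<phi>, of "A \<times> C"] by (intro nn_integral_indicator) auto
      also have "\<dots> = emeasure M (A \<times> C)"
        unfolding M_def by (subst emeasure_distr) auto
      finally show ?thesis .
    qed
    have N': "emeasure N' C = ?c * emeasure N C" if [measurable]: "C \<in> sets borel" for C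
      unfolding N'_def N_def
      by (subst (1 2) emeasure_density) (auto simp: mult.assoc nn_integral_cmult)
    have tail_N: "emeasure N' {x<..} = ?c * ennreal (exp (- (?n * x)) / ?n)" for x
      unfolding N'[OF borel_open[OF open_greaterThan]] unfolding N_def
      by (subst emeasure_density) (auto simp: nn_integral_exp_greaterThan[OF n])
    have tail_M: "emeasure M' {x<..} = ?c * ennreal (exp (- (?n * x)) / ?n)" for x
    proof -
      let ?r = "exp (- x)"
      have D[measurable]: "{z. norm z < ?r \<and> sgn z \<in> A} \<in> sets borel"
        "{z. norm z < 1 \<and> sgn z \<in> A} \<in> sets borel" by measurable
      have "emeasure M' {x<..} = emeasure lborel (?\<phi> -` (A \<times> {x<..}))"
        unfolding M'[OF borel_open[OF open_greaterThan]] unfolding M_def by (subst emeasure_distr) auto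
      also have "\<dots> = emeasure lborel {z. norm z < ?r \<and> sgn z \<in> A}"
      proof (rule emeasure_eq_AE)
        show "AE z in lborel. z \<in> ?\<phi> -` (A \<times> {x<..}) \<longleftrightarrow> z \<in> {z. norm z < ?r \<and> sgn z \<in> A}"
          using AE_lborel_singleton[of "0::'a"]
        proof eventually_elim
          case (elim z)
          then have "x < - ln (norm z) \<longleftrightarrow> norm z < ?r"
            using ln_less_cancel_iff[of "norm z" ?r] by (simp add: less_minus_iff minus_less_iff)
          then show ?case by auto
        qed
        show "?\<phi> -` (A \<times> {x<..}) \<in> sets lborel" using measurable_sets[OF \<phi>, of "A \<times> {x<..}"] by auto
      qed auto
      also have "\<dots> = ennreal (?r ^ DIM('a)) * emeasure lborel {z. ?r *\<^sub>R z \<in> {z. norm z < ?r \<and> sgn z \<in> A}}"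
        by (rule emeasure_lborel_scaleR) auto
      also have "{z. ?r *\<^sub>R z \<in> {z. norm z < ?r \<and> sgn z \<in> A}} = {z. norm z < 1 \<and> sgn z \<in> A}"
        by (auto simp: sgn_scaleR)
      also have "emeasure lborel {z. norm z < 1 \<and> sgn z \<in> A} = emeasure lborel {z \<in> cball 0 1. sgn z \<in> A}"
        by (rule emeasure_eq_AE) (use AE_lborel_norm_neq[of 1] in \<open>auto elim!: eventually_mono\<close>)
      also have "ennreal (?r ^ DIM('a)) * emeasure lborel {z \<in> cball 0 1. sgn z \<in> A} = ?c * ennreal (exp (- (?n * x)) / ?n)"
      proof -
        have e: "?r ^ DIM('a) = ?n * (exp (- (?n * x)) / ?n)"
          using n by (simp add: exp_of_nat_mult[symmetric])
        have "ennreal (?r ^ DIM('a)) = ennreal ?n * ennreal (exp (- (?n * x)) / ?n)"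
          unfolding e by (rule ennreal_mult) auto
        then show ?thesis unfolding emeasure_cone_measure[OF A] by (simp only: ac_simps)
      qed
      finally show ?thesis .
    qed
    have "M' = N'"
    proof (rule measure_eqI_lessThan)
      show "emeasure M' {x<..} < \<infinity>" for x
        unfolding tail_M using cfin by (auto simp: ennreal_mult_less_top)
      show "emeasure M' {x<..} = emeasure N' {x<..}" for x unfolding tail_M tail_N ..
    qed (auto simp: M'_def N'_def)
    then show "?c * emeasure N B = emeasure M (A \<times> B)" using M'[OF B] N'[OF B] by simp
  qed
  have G[measurable]: "(\<lambda>y. F (exp (- snd y) *\<^sub>R fst y)) \<in> borel_measurable (borel \<Otimes>\<^sub>M borel)" by measurable
  have "(\<integral>\<^sup>+z. F z \<partial>lborel) = (\<integral>\<^sup>+z. F (exp (- snd (?\<phi> z)) *\<^sub>R fst (?\<phi> z)) \<partial>lborel)"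
  proof (rule nn_integral_cong_AE)
    show "AE z in lborel. F z = F (exp (- snd (?\<phi> z)) *\<^sub>R fst (?\<phi> z))"
      using AE_lborel_singleton[of "0::'a"] by eventually_elim (simp add: sgn_div_norm)
  qed
  also have "\<dots> = (\<integral>\<^sup>+y. F (exp (- snd y) *\<^sub>R fst y) \<partial>M)"
    unfolding M_def by (subst nn_integral_distr) auto
  also have "\<dots> = (\<integral>\<^sup>+w. (\<integral>\<^sup>+t. F (exp (- t) *\<^sub>R w) \<partial>N) \<partial>cone_measure)"
    unfolding prod[symmetric] by (subst N.nn_integral_fst[symmetric]) (auto cong: measurable_cong_sets)
  also have "\<dots> = (\<integral>\<^sup>+w. (\<integral>\<^sup>+t. ennreal (exp (- (?n * t))) * F (exp (- t) *\<^sub>R w) \<partial>lborel) \<partial>cone_measure)"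
    unfolding N_def by (intro nn_integral_cong, subst nn_integral_density) auto
  finally show ?thesis .
qed

text \<open>
  An orthogonal map carries \<open>norm v\<close> times the \<open>k\<close>-th unit vector to \<open>v\<close>, and it preserves the
  cone measure.
\<close>

lemma nn_integral_cone_measure_inner_powr:
  fixes v :: "real ^ 'n::finite" and k :: 'n
  assumes q: "0 < q"
  shows "(\<integral>\<^sup>+w. ennreal (\<bar>v \<bullet> w\<bar> powr q) \<partial>cone_measure)
    = ennreal (norm v powr q) * (\<integral>\<^sup>+w. ennreal (\<bar>w $ k\<bar> powr q) \<partial>cone_measure)"
proof -
  obtain f :: "real ^ 'n \<Rightarrow> real ^ 'n" where f: "orthogonal_transformation f" "f (norm v *\<^sub>R axis k 1) = v"
    using orthogonal_transformation_exists[of "norm v *\<^sub>R axis k 1 :: real ^ 'n" v] by auto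
  have lin: "linear f" using f by (auto simp: orthogonal_transformation)
  have fm[measurable]: "f \<in> borel_measurable borel"
    using lin by (intro borel_measurable_continuous_onI linear_continuous_on) (simp add: linear_conv_bounded_linear)
  have d: "distr cone_measure borel f = cone_measure"
  proof (rule measure_eqI)
    fix A assume "A \<in> sets (distr cone_measure borel f)"
    then show "emeasure (distr cone_measure borel f) A = emeasure cone_measure A"
      using emeasure_cone_measure_orthogonal(2)[OF f(1), of A] by (subst emeasure_distr) auto
  qed simp
  have "(\<integral>\<^sup>+w. ennreal (\<bar>v \<bullet> w\<bar> powr q) \<partial>cone_measure) = (\<integral>\<^sup>+w. ennreal (\<bar>v \<bullet> w\<bar> powr q) \<partial>distr cone_measure borel f)"
    by (simp only: d)
  also have "\<dots> = (\<integral>\<^sup>+w. ennreal (\<bar>v \<bullet> f w\<bar> powr q) \<partial>cone_measure)"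
    by (subst nn_integral_distr) auto
  also have "\<dots> = (\<integral>\<^sup>+w. ennreal (norm v powr q) * ennreal (\<bar>w $ k\<bar> powr q) \<partial>cone_measure)"
  proof (rule nn_integral_cong)
    fix w :: "real ^ 'n"
    have "v \<bullet> f w = f (norm v *\<^sub>R axis k 1) \<bullet> f w" using f by simp
    also have "\<dots> = (norm v *\<^sub>R axis k 1) \<bullet> w" using f(1) by (simp add: orthogonal_transformation_def)
    also have "\<dots> = norm v * (w $ k)" by (simp add: inner_axis')
    finally show "ennreal (\<bar>v \<bullet> f w\<bar> powr q) = ennreal (norm v powr q) * ennreal (\<bar>w $ k\<bar> powr q)"
      by (simp add: abs_mult powr_mult ennreal_mult)
  qed
  also have "\<dots> = ennreal (norm v powr q) * (\<integral>\<^sup>+w. ennreal (\<bar>w $ k\<bar> powr q) \<partial>cone_measure)"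
    by (rule nn_integral_cmult) auto
  finally show ?thesis .
qed


section \<open>Test functions\<close>

lemma partial_deriv_eq: "(\<phi> has_derivative \<phi>') (at x) \<Longrightarrow> partial_deriv i \<phi> x = \<phi>' (axis i 1)"
  unfolding partial_deriv_def by (simp add: frechet_derivative_at[symmetric])

lemma C_k_SucD: "C_k (Suc k) \<phi> \<Longrightarrow> C_k k \<phi>"
proof (induction k arbitrary: \<phi>)
  case 0
  then show ?case by (auto simp: continuous_on_eq_continuous_at differentiable_imp_continuous_within)
next
  case (Suc k)
  then show ?case by (metis C_k.simps(2))
qed

lemma C_k_const: "C_k k (\<lambda>x::real ^ 'n::finite. c)"
proof (induction k arbitrary: c)
  case (Suc k)
  have "partial_deriv i (\<lambda>x::real ^ 'n. c) = (\<lambda>x. 0)" for i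
    by (rule ext, subst partial_deriv_eq[OF has_derivative_const]) simp
  then show ?case using Suc by simp
qed simp

lemma C_k_add: "C_k k \<phi> \<Longrightarrow> C_k k \<psi> \<Longrightarrow> C_k k (\<lambda>x. \<phi> x + \<psi> x)"
proof (induction k arbitrary: \<phi> \<psi>)
  case (Suc k)
  have "partial_deriv i (\<lambda>x. \<phi> x + \<psi> x) = (\<lambda>x. partial_deriv i \<phi> x + partial_deriv i \<psi> x)" for i
  proof
    fix x
    have d: "(\<phi> has_derivative frechet_derivative \<phi> (at x)) (at x)" "(\<psi> has_derivative frechet_derivative \<psi> (at x)) (at x)"
      using Suc.prems by (auto simp: frechet_derivative_works)
    show "partial_deriv i (\<lambda>x. \<phi> x + \<psi> x) x = partial_deriv i \<phi> x + partial_deriv i \<psi> x"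
      by (subst partial_deriv_eq[OF has_derivative_add[OF d]]) (simp add: partial_deriv_def)
  qed
  then show ?case using Suc by auto
qed (auto intro: continuous_intros)

lemma C_k_mult: "C_k k \<phi> \<Longrightarrow> C_k k \<psi> \<Longrightarrow> C_k k (\<lambda>x. \<phi> x * \<psi> x)"
proof (induction k arbitrary: \<phi> \<psi>)
  case (Suc k)
  have "partial_deriv i (\<lambda>x. \<phi> x * \<psi> x) = (\<lambda>x. \<phi> x * partial_deriv i \<psi> x + partial_deriv i \<phi> x * \<psi> x)" for i
  proof
    fix x
    have d: "(\<phi> has_derivative frechet_derivative \<phi> (at x)) (at x)" "(\<psi> has_derivative frechet_derivative \<psi> (at x)) (at x)"
      using Suc.prems by (auto simp: frechet_derivative_works)
    show "partial_deriv i (\<lambda>x. \<phi> x * \<psi> x) x = \<phi> x * partial_deriv i \<psi> x + partial_deriv i \<phi> x * \<psi> x"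
      by (subst partial_deriv_eq[OF has_derivative_mult[OF d]]) (simp add: partial_deriv_def)
  qed
  moreover have "C_k k (\<lambda>x. \<phi> x * partial_deriv i \<psi> x + partial_deriv i \<phi> x * \<psi> x)" for i
    using Suc.prems C_k_SucD[OF Suc.prems(1)] C_k_SucD[OF Suc.prems(2)] by (intro C_k_add Suc.IH) auto
  ultimately show ?case using Suc.prems by auto
qed (auto intro: continuous_intros)

lemma C_k_prod: "finite I \<Longrightarrow> (\<And>i. i \<in> I \<Longrightarrow> C_k k (f i)) \<Longrightarrow> C_k k (\<lambda>x. \<Prod>i\<in>I. f i x)"
  by (induction I rule: finite_induct) (auto intro: C_k_const C_k_mult)

lemma partial_deriv_translate:
  assumes "\<And>x. \<phi> differentiable (at x)"
  shows "partial_deriv i (\<lambda>x. \<phi> (x - c)) = (\<lambda>x. partial_deriv i \<phi> (x - c))"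
proof
  fix x
  have "(\<phi> has_derivative frechet_derivative \<phi> (at (x - c))) (at (x - c))"
    using assms by (auto simp: frechet_derivative_works)
  moreover have "((\<lambda>x. x - c) has_derivative (\<lambda>h. h)) (at x)" by (auto intro!: derivative_eq_intros)
  ultimately have "((\<lambda>x. \<phi> (x - c)) has_derivative frechet_derivative \<phi> (at (x - c))) (at x)"
    using has_derivative_compose[of "\<lambda>x. x - c" "\<lambda>h. h" x UNIV \<phi>] by blast
  then show "partial_deriv i (\<lambda>x. \<phi> (x - c)) x = partial_deriv i \<phi> (x - c)"
    by (subst partial_deriv_eq) (auto simp: partial_deriv_def)
qed

lemma C_k_translate: "C_k k \<phi> \<Longrightarrow> C_k k (\<lambda>x. \<phi> (x - c))"
proof (induction k arbitrary: \<phi>)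
  case 0
  have "continuous_on UNIV (\<lambda>x. x - c)" by (intro continuous_intros)
  then show ?case using 0 continuous_on_compose2[of UNIV \<phi> UNIV "\<lambda>x. x - c"] by simp
next
  case (Suc k)
  have "(\<lambda>x. \<phi> (x - c)) differentiable (at x)" for x
  proof -
    have "\<phi> differentiable (at (x - c))" using Suc.prems by simp
    moreover have "(\<lambda>x. x - c) differentiable (at x)" by simp
    ultimately show ?thesis using differentiable_chain_at[of "\<lambda>x. x - c" x \<phi>] by (simp add: o_def)
  qed
  moreover have "partial_deriv i (\<lambda>x. \<phi> (x - c)) = (\<lambda>x. partial_deriv i \<phi> (x - c))" for i
    using Suc.prems by (intro partial_deriv_translate) auto
  ultimately show ?case using Suc by simp
qed

lemma test_function_translate:
  assumes "test_function \<phi>"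
  shows "test_function (\<lambda>x. \<phi> (x - c))"
proof -
  have "{x. \<phi> (x - c) \<noteq> 0} = (\<lambda>x. c + x) ` {x. \<phi> x \<noteq> 0}"
    by (auto intro!: image_eqI[of _ _ "x - c" for x])
  then have "closure {x. \<phi> (x - c) \<noteq> 0} = (\<lambda>x. c + x) ` closure {x. \<phi> x \<noteq> 0}"
    by (simp add: closure_translation)
  then show ?thesis using assms by (auto simp: test_function_def C_k_translate compact_translation)
qed

lemma test_functionD:
  assumes "test_function \<phi>"
  shows "\<phi> differentiable (at x)" "continuous_on UNIV \<phi>" "continuous_on UNIV (partial_deriv i \<phi>)"
proof -
  have "C_k 0 \<phi>" "C_k (Suc 0) \<phi>" using assms by (simp_all only: test_function_def)
  then show "\<phi> differentiable (at x)" "continuous_on UNIV \<phi>" "continuous_on UNIV (partial_deriv i \<phi>)"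
    by simp_all
qed

lemma test_function_support:
  assumes "test_function \<phi>"
  obtains K where "compact K" "\<And>x. x \<notin> K \<Longrightarrow> \<phi> x = 0" "\<And>x i. x \<notin> K \<Longrightarrow> partial_deriv i \<phi> x = 0"
proof
  let ?K = "closure {x. \<phi> x \<noteq> 0}"
  show "compact ?K" using assms by (simp add: test_function_def)
  show 0: "\<phi> x = 0" if "x \<notin> ?K" for x using that closure_subset[of "{x. \<phi> x \<noteq> 0}"] by auto
  show "partial_deriv i \<phi> x = 0" if x: "x \<notin> ?K" for x i
  proof -
    have "((\<lambda>x. 0) has_derivative (\<lambda>h. 0)) (at x)" by simp
    then have "(\<phi> has_derivative (\<lambda>h. 0)) (at x)"
    proof (rule has_derivative_transform_within_open)
      show "open (- ?K)" by auto
      show "x \<in> - ?K" using x by simp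
      show "0 = \<phi> y" if "y \<in> - ?K" for y
        by (rule 0[symmetric]) (use that in simp)
    qed
    then show ?thesis by (simp add: partial_deriv_eq)
  qed
qed

lemma compact_support_bounded:
  fixes \<psi> :: "'a::topological_space \<Rightarrow> real"
  assumes K: "compact K" and c: "continuous_on UNIV \<psi>" and z: "\<And>x. x \<notin> K \<Longrightarrow> \<psi> x = 0"
  shows "\<exists>C. \<forall>x. \<bar>\<psi> x\<bar> \<le> C"
proof -
  have "compact (\<psi> ` K)" using K c by (intro compact_continuous_image) (auto intro: continuous_on_subset)
  then obtain C where C: "\<And>y. y \<in> \<psi> ` K \<Longrightarrow> norm y \<le> C" using compact_imp_bounded by (metis bounded_iff)
  have "\<bar>\<psi> x\<bar> \<le> max C 0" for x using C[of "\<psi> x"] z[of x] by (cases "x \<in> K") (auto simp: le_max_iff_disj)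
  then show ?thesis by blast
qed

text \<open>
  The flat function \<open>exp (- (c / t))\<close> together with the functions \<open>t powr (- j) * exp (- (c / t))\<close>
  that occur in its derivatives. This family is closed under differentiation up to linear
  combinations.
\<close>

definition exp_flat :: "real \<Rightarrow> nat \<Rightarrow> real \<Rightarrow> real" where
  "exp_flat c j t = (if 0 < t then (1 / t) ^ j * exp (- (c / t)) else 0)"

lemma power_times_exp_tendsto_0:
  fixes c :: real
  assumes c: "0 < c"
  shows "((\<lambda>x. x ^ j * exp (- (c * x))) \<longlongrightarrow> 0) at_top"
proof -
  have "filterlim (\<lambda>x. c * x) at_top at_top"
    by (intro filterlim_tendsto_pos_mult_at_top[OF tendsto_const c filterlim_ident])
  from filterlim_compose[OF tendsto_power_div_exp_0[of j] this]
  have "((\<lambda>x. (1 / c ^ j) * ((c * x) ^ j / exp (c * x))) \<longlongrightarrow> (1 / c ^ j) * 0) at_top"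
    by (intro tendsto_intros)
  then show ?thesis using c by (simp add: power_mult_distrib exp_minus field_simps)
qed

lemma exp_flat_deriv:
  assumes c: "0 < c"
  shows "(exp_flat c j has_real_derivative (c * exp_flat c (j + 2) t - real j * exp_flat c (j + 1) t)) (at t)"
proof (cases t "0::real" rule: linorder_cases)
  case less
  have "((\<lambda>t. 0) has_real_derivative 0) (at t)" by simp
  then have "(exp_flat c j has_real_derivative 0) (at t)"
    by (rule has_field_derivative_transform_within_open[where S="{..<0}"]) (use less in \<open>auto simp: exp_flat_def\<close>)
  then show ?thesis using less by (simp add: exp_flat_def)
next
  case greater
  have "((\<lambda>t. (1 / t) ^ j * exp (- (c / t))) has_real_derivative
      (c * ((1 / t) ^ (j + 2) * exp (- (c / t))) - real j * ((1 / t) ^ (j + 1) * exp (- (c / t))))) (at t)"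
  proof -
    have inv: "((\<lambda>t. 1 / t) has_real_derivative - ((1 / t)\<^sup>2)) (at t)"
      using greater by (auto intro!: derivative_eq_intros simp: power2_eq_square)
    have pow: "((\<lambda>t. (1 / t) ^ j) has_real_derivative (- real j * (1 / t) ^ (j + 1))) (at t)"
    proof (cases j)
      case (Suc m)
      have "(1 + real m) * (- (y\<^sup>2) * y ^ m) = - real (Suc m) * y ^ (Suc m + 1)" for y :: real
        by (simp add: power2_eq_square algebra_simps)
      from DERIV_cong[OF DERIV_power_Suc[OF inv] this] show ?thesis by (simp only: Suc)
    qed simp
    have "((\<lambda>t. exp (- (c / t))) has_real_derivative (exp (- (c / t)) * (c * (1 / t)\<^sup>2))) (at t)"
      using greater by (auto intro!: derivative_eq_intros simp: power2_eq_square)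
    from DERIV_mult[OF pow this] show ?thesis
      by (rule DERIV_cong) (simp add: algebra_simps power_add power2_eq_square)
  qed
  then have "(exp_flat c j has_real_derivative
      (c * ((1 / t) ^ (j + 2) * exp (- (c / t))) - real j * ((1 / t) ^ (j + 1) * exp (- (c / t))))) (at t)"
    by (rule has_field_derivative_transform_within_open[where S="{0<..}"]) (use greater in \<open>auto simp: exp_flat_def\<close>)
  then show ?thesis using greater by (simp add: exp_flat_def)
next
  case equal
  have "((\<lambda>h. exp_flat c j h / h) \<longlongrightarrow> 0) (at_right 0)"
  proof -
    have "((\<lambda>h. (inverse h) ^ Suc j * exp (- (c * inverse h))) \<longlongrightarrow> 0) (at_right 0)"
      by (rule filterlim_compose[OF power_times_exp_tendsto_0[OF c] filterlim_inverse_at_top_right])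
    then show ?thesis
      by (rule Lim_transform_eventually)
        (auto simp: eventually_at_filter exp_flat_def divide_inverse mult_ac power_inverse)
  qed
  moreover have "((\<lambda>h. exp_flat c j h / h) \<longlongrightarrow> 0) (at_left 0)"
    by (rule Lim_transform_eventually[OF tendsto_const]) (auto simp: eventually_at_filter exp_flat_def)
  ultimately have "((\<lambda>h. exp_flat c j h / h) \<longlongrightarrow> 0) (at 0)" by (intro filterlim_split_at)
  then show ?thesis using equal by (simp add: has_field_derivative_iff exp_flat_def)
qed

lemma C_k_exp_flat:
  fixes i :: "'n::finite"
  assumes c: "0 < c"
  shows "C_k k (\<lambda>x::real ^ 'n. exp_flat c j (\<sigma> * (x $ i) + b))"
proof (induction k arbitrary: j)
  case 0
  have "continuous_on UNIV (exp_flat c j)"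
    by (rule continuous_at_imp_continuous_on) (use DERIV_isCont[OF exp_flat_deriv[OF c]] in blast)
  moreover have "continuous_on UNIV (\<lambda>x::real ^ 'n. \<sigma> * (x $ i) + b)" by (intro continuous_intros)
  ultimately show ?case
    using continuous_on_compose2[of UNIV "exp_flat c j" UNIV "\<lambda>x. \<sigma> * (x $ i) + b"] by simp
next
  case (Suc k)
  let ?D = "\<lambda>t. c * exp_flat c (j + 2) t - real j * exp_flat c (j + 1) t"
  have d: "((\<lambda>x::real ^ 'n. exp_flat c j (\<sigma> * (x $ i) + b)) has_derivative
      (\<lambda>h. ?D (\<sigma> * (x $ i) + b) * (\<sigma> * (h $ i)))) (at x)" for x
  proof -
    have "((\<lambda>x::real ^ 'n. \<sigma> * (x $ i) + b) has_derivative (\<lambda>h. \<sigma> * (h $ i))) (at x)"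
      by (auto intro!: derivative_eq_intros bounded_linear.has_derivative[OF bounded_linear_vec_nth])
    moreover have "(exp_flat c j has_derivative (\<lambda>h. ?D (\<sigma> * (x $ i) + b) * h)) (at (\<sigma> * (x $ i) + b))"
      using exp_flat_deriv[OF c] by (simp add: has_field_derivative_def)
    ultimately show ?thesis
      using has_derivative_compose[of "\<lambda>x::real ^ 'n. \<sigma> * (x $ i) + b" "\<lambda>h. \<sigma> * (h $ i)" x UNIV "exp_flat c j"
        "\<lambda>h. ?D (\<sigma> * (x $ i) + b) * h"] by blast
  qed
  have "partial_deriv l (\<lambda>x::real ^ 'n. exp_flat c j (\<sigma> * (x $ i) + b)) =
     (\<lambda>x. (\<sigma> * (axis l 1 $ i)) * (c * exp_flat c (j + 2) (\<sigma> * (x $ i) + b) +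
        (- real j) * exp_flat c (j + 1) (\<sigma> * (x $ i) + b)))" for l
    by (rule ext, subst partial_deriv_eq[OF d]) (simp add: algebra_simps)
  moreover have "C_k k (\<lambda>x::real ^ 'n. (\<sigma> * (axis l 1 $ i)) * (c * exp_flat c (j + 2) (\<sigma> * (x $ i) + b) +
        (- real j) * exp_flat c (j + 1) (\<sigma> * (x $ i) + b)))" for l
    by (intro C_k_mult C_k_add C_k_const Suc.IH)
  ultimately show ?case using d by (auto simp: differentiable_def)
qed

text \<open>
  The factors are \<open>exp (- (1 / (m t)))\<close>, with \<open>m\<close> read as \<open>Suc m\<close>, at the distances \<open>t\<close> of \<open>x\<close>
  from the faces of the box. They increase to \<open>1\<close> inside the box, so that these test functions
  tend to its indicator function.
\<close>

definition box_bump :: "nat \<Rightarrow> real ^ 'n::finite \<Rightarrow> real ^ 'n \<Rightarrow> real ^ 'n \<Rightarrow> real" where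
  "box_bump m a b x =
     (\<Prod>i\<in>UNIV. exp_flat (1 / real (Suc m)) 0 (1 * (x $ i) + (- a $ i)) *
                exp_flat (1 / real (Suc m)) 0 ((-1) * (x $ i) + b $ i))"

lemma exp_flat_0_bounds: "0 < c \<Longrightarrow> 0 \<le> exp_flat c 0 t \<and> exp_flat c 0 t \<le> 1"
  by (auto simp: exp_flat_def)

lemma box_bump_bounds: "0 \<le> box_bump m a b x" "box_bump m a b x \<le> 1"
  unfolding box_bump_def by (intro prod_nonneg prod_le_1; simp add: exp_flat_0_bounds mult_le_one)+

lemma box_bump_outside: "x \<notin> box a b \<Longrightarrow> box_bump m a b x = 0"
proof -
  assume "x \<notin> box a b"
  then obtain i where "x $ i \<le> a $ i \<or> b $ i \<le> x $ i" by (auto simp: mem_box_cart not_less)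
  then show ?thesis
    unfolding box_bump_def by (intro prod_zero bexI[of _ i]) (auto simp: exp_flat_def)
qed

lemma test_function_box_bump: "test_function (box_bump m a b)"
proof -
  have "C_k k (box_bump m a b)" for k
    unfolding box_bump_def by (intro C_k_prod C_k_mult C_k_exp_flat) auto
  moreover have "closure {x. box_bump m a b x \<noteq> 0} \<subseteq> cbox a b"
    using box_bump_outside[of _ a b m] box_subset_cbox[of a b] by (intro closure_minimal) auto
  then have "compact (closure {x. box_bump m a b x \<noteq> 0})"
    using compact_Int_closed[OF compact_cbox[of a b] closed_closure[of "{x. box_bump m a b x \<noteq> 0}"]]
    by (simp add: Int_absorb1)
  ultimately show ?thesis by (simp add: test_function_def)
qed

lemma box_bump_tendsto:
  fixes x :: "real ^ 'n::finite"
  shows "(\<lambda>m. box_bump m a b x) \<longlonglongrightarrow> indicator (box a b) x"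
proof (cases "x \<in> box a b")
  case True
  have *: "(\<lambda>m. exp_flat (1 / real (Suc m)) 0 t) \<longlonglongrightarrow> 1" if "0 < t" for t
  proof -
    have "(\<lambda>m. exp (- ((1 / real (Suc m)) / t))) \<longlonglongrightarrow> exp (- (0 / t))"
      using that by (intro tendsto_intros LIMSEQ_Suc lim_1_over_n) auto
    then show ?thesis using that by (simp add: exp_flat_def)
  qed
  have "(\<lambda>m. box_bump m a b x) \<longlonglongrightarrow> (\<Prod>i\<in>(UNIV :: 'n set). 1 * 1)"
    unfolding box_bump_def
  proof (rule Limits.tendsto_prod)
    fix i
    have "0 < 1 * (x $ i) + (- a $ i)" "0 < (-1) * (x $ i) + b $ i" using True by (auto simp: mem_box_cart)
    then show "(\<lambda>m. exp_flat (1 / real (Suc m)) 0 (1 * (x $ i) + (- a $ i)) *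
        exp_flat (1 / real (Suc m)) 0 ((-1) * (x $ i) + b $ i)) \<longlonglongrightarrow> 1 * 1"
      by (intro tendsto_mult *)
  qed
  then show ?thesis using True by simp
qed (simp add: box_bump_outside)


section \<open>The fundamental lemma of the calculus of variations\<close>

text \<open>
  Balls suffice, since every compact set is contained in one. Borel measurability is included so
  that the Fubini theorems for \<open>lborel\<close> apply.
\<close>

definition loc_integrable :: "('a::euclidean_space \<Rightarrow> real) \<Rightarrow> bool" where
  "loc_integrable f \<longleftrightarrow> f \<in> borel_measurable borel \<and>
     (\<forall>R. integrable lborel (\<lambda>x. indicator (cball 0 R) x * f x))"

lemma loc_integrable_measurable [measurable_dest]: "loc_integrable f \<Longrightarrow> f \<in> borel_measurable borel"
  by (simp add: loc_integrable_def)

lemma loc_integrable_mult_bounded: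
  assumes f: "loc_integrable f" and \<psi>[measurable]: "\<psi> \<in> borel_measurable borel"
    and bd: "\<And>x. \<bar>\<psi> x\<bar> \<le> C" and supp: "\<And>x. R < norm x \<Longrightarrow> \<psi> x = 0"
  shows "integrable lborel (\<lambda>x. f x * \<psi> x)"
proof (rule Bochner_Integration.integrable_bound)
  have [measurable]: "f \<in> borel_measurable borel" using f by (rule loc_integrable_measurable)
  show "integrable lborel (\<lambda>x. C * (indicator (cball 0 R) x * f x))"
    using f by (simp add: loc_integrable_def)
  show "(\<lambda>x. f x * \<psi> x) \<in> borel_measurable lborel" by measurable
  have "C \<ge> 0" using bd[of 0] by linarith
  then have "norm (f x * \<psi> x) \<le> norm (C * (indicator (cball 0 R) x * f x))" for x
    using bd[of x] supp[of x] by (cases "norm x \<le> R") (auto simp: abs_mult mult.commute[of "\<bar>f x\<bar>"] intro: mult_right_mono)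
  then show "AE x in lborel. norm (f x * \<psi> x) \<le> norm (C * (indicator (cball 0 R) x * f x))" by simp
qed

lemma nn_integral_lborel_translate:
  fixes F :: "'a::euclidean_space \<Rightarrow> ennreal"
  assumes [measurable]: "F \<in> borel_measurable borel"
  shows "(\<integral>\<^sup>+x. F (x + c) \<partial>lborel) = (\<integral>\<^sup>+x. F x \<partial>lborel)"
proof -
  have "(\<integral>\<^sup>+x. F x \<partial>lborel) = (\<integral>\<^sup>+x. F x \<partial>distr lborel borel ((+) c))" by (simp only: lborel_distr_plus)
  also have "\<dots> = (\<integral>\<^sup>+x. F (c + x) \<partial>lborel)" by (subst nn_integral_distr) auto
  finally show ?thesis by (simp add: add.commute)
qed

lemma integral_lborel_translate:
  fixes F :: "'a::euclidean_space \<Rightarrow> real"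
  assumes [measurable]: "F \<in> borel_measurable borel"
  shows "(\<integral>x. F (x + c) \<partial>lborel) = (\<integral>x. F x \<partial>lborel)"
proof -
  have "(\<integral>x. F x \<partial>lborel) = (\<integral>x. F x \<partial>distr lborel borel ((+) c))" by (simp only: lborel_distr_plus)
  also have "\<dots> = (\<integral>x. F (c + x) \<partial>lborel)" by (subst integral_distr) auto
  finally show ?thesis by (simp add: add.commute)
qed

text \<open>
  Both integrands vanish unless \<open>t\<close> lies in the unit interval and the argument of \<open>f\<close> lies in a
  fixed ball. They are related by the translation \<open>y = x + t h\<close>.
\<close>

lemma integrable_shear:
  fixes f \<psi> :: "'a::euclidean_space \<Rightarrow> real" and h :: 'a
  assumes f: "loc_integrable f" and \<psi>[measurable]: "\<psi> \<in> borel_measurable borel"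
    and bd: "\<And>x. \<bar>\<psi> x\<bar> \<le> C" and supp: "\<And>x. R < norm x \<Longrightarrow> \<psi> x = 0"
  shows "integrable (lborel \<Otimes>\<^sub>M lborel) (\<lambda>(y, t). indicator {0..1::real} t * (f y * \<psi> (y - t *\<^sub>R h)))"
    and "integrable (lborel \<Otimes>\<^sub>M lborel) (\<lambda>(x, t). indicator {0..1::real} t * (f (x + t *\<^sub>R h) * \<psi> x))"
proof -
  have [measurable]: "f \<in> borel_measurable borel" using f by (rule loc_integrable_measurable)
  have cb[measurable]: "cball (0::'a) r \<in> sets borel" for r by auto
  let ?R = "R + norm h"
  have C: "C \<ge> 0" using bd[of 0] by linarith
  have fin: "(\<integral>\<^sup>+y. ennreal (C * (indicator (cball 0 ?R) y * \<bar>f y\<bar>)) \<partial>lborel) < \<infinity>"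
  proof -
    have "integrable lborel (\<lambda>y. C * (indicator (cball 0 ?R) y * f y))" using f by (simp add: loc_integrable_def)
    then have "(\<integral>\<^sup>+y. ennreal (norm (C * (indicator (cball 0 ?R) y * f y))) \<partial>lborel) < \<infinity>"
      by (simp only: integrable_iff_bounded)
    then show ?thesis using C by (simp add: abs_mult)
  qed
  have pt: "\<bar>indicator {0..1::real} t * (f y * \<psi> (y - t *\<^sub>R h))\<bar>
      \<le> indicator {0..1::real} t * (C * (indicator (cball 0 ?R) y * \<bar>f y\<bar>))" for y t
  proof (cases "t \<in> {0..1} \<and> \<psi> (y - t *\<^sub>R h) \<noteq> 0")
    case True
    then have t: "0 \<le> t" "t \<le> 1" by auto
    have "norm (y - t *\<^sub>R h) \<le> R" using True supp[of "y - t *\<^sub>R h"] by (meson not_le)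
    moreover have "norm y \<le> norm (y - t *\<^sub>R h) + norm (t *\<^sub>R h)" using norm_triangle_ineq[of "y - t *\<^sub>R h" "t *\<^sub>R h"] by simp
    moreover have "norm (t *\<^sub>R h) \<le> norm h" using t by (simp add: mult_left_le_one_le)
    ultimately have "norm y \<le> ?R" by linarith
    then show ?thesis using True bd[of "y - t *\<^sub>R h"] by (simp add: abs_mult mult.commute[of "\<bar>f y\<bar>"] mult_right_mono)
  next
    case False
    then show ?thesis using C by (auto simp: indicator_def)
  qed
  have bound: "(\<integral>\<^sup>+t. ennreal (indicator {0..1::real} t) * K \<partial>lborel) = K" for K
    by (subst nn_integral_multc) (auto simp: ennreal_indicator)
  show "integrable (lborel \<Otimes>\<^sub>M lborel) (\<lambda>(y, t). indicator {0..1::real} t * (f y * \<psi> (y - t *\<^sub>R h)))"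
  proof (rule integrableI_bounded)
    show "(\<lambda>(y, t). indicator {0..1::real} t * (f y * \<psi> (y - t *\<^sub>R h))) \<in> borel_measurable (lborel \<Otimes>\<^sub>M lborel)"
      by measurable
    have "(\<integral>\<^sup>+x. ennreal (norm (case x of (y, t) \<Rightarrow> indicator {0..1::real} t * (f y * \<psi> (y - t *\<^sub>R h)))) \<partial>(lborel \<Otimes>\<^sub>M lborel))
       = (\<integral>\<^sup>+t. \<integral>\<^sup>+y. ennreal \<bar>indicator {0..1::real} t * (f y * \<psi> (y - t *\<^sub>R h))\<bar> \<partial>lborel \<partial>lborel)"
      by (subst lborel_pair.nn_integral_snd[symmetric]) auto
    also have "\<dots> \<le> (\<integral>\<^sup>+t. \<integral>\<^sup>+y. ennreal (indicator {0..1::real} t) * ennreal (C * (indicator (cball 0 ?R) y * \<bar>f y\<bar>)) \<partial>lborel \<partial>lborel)"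
      using pt C by (intro nn_integral_mono) (auto simp: ennreal_mult[symmetric] intro!: ennreal_leI)
    also have "\<dots> = (\<integral>\<^sup>+y. ennreal (C * (indicator (cball 0 ?R) y * \<bar>f y\<bar>)) \<partial>lborel)"
      by (subst nn_integral_cmult) (auto simp: bound)
    finally show "(\<integral>\<^sup>+x. ennreal (norm (case x of (y, t) \<Rightarrow> indicator {0..1::real} t * (f y * \<psi> (y - t *\<^sub>R h)))) \<partial>(lborel \<Otimes>\<^sub>M lborel)) < \<infinity>"
      using fin by simp
  qed
  show "integrable (lborel \<Otimes>\<^sub>M lborel) (\<lambda>(x, t). indicator {0..1::real} t * (f (x + t *\<^sub>R h) * \<psi> x))"
  proof (rule integrableI_bounded)
    show "(\<lambda>(x, t). indicator {0..1::real} t * (f (x + t *\<^sub>R h) * \<psi> x)) \<in> borel_measurable (lborel \<Otimes>\<^sub>M lborel)"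
      by measurable
    have "(\<integral>\<^sup>+x. ennreal (norm (case x of (x, t) \<Rightarrow> indicator {0..1::real} t * (f (x + t *\<^sub>R h) * \<psi> x))) \<partial>(lborel \<Otimes>\<^sub>M lborel))
       = (\<integral>\<^sup>+t. \<integral>\<^sup>+x. ennreal \<bar>indicator {0..1::real} t * (f (x + t *\<^sub>R h) * \<psi> x)\<bar> \<partial>lborel \<partial>lborel)"
      by (subst lborel_pair.nn_integral_snd[symmetric]) auto
    also have "\<dots> = (\<integral>\<^sup>+t. \<integral>\<^sup>+y. ennreal \<bar>indicator {0..1::real} t * (f y * \<psi> (y - t *\<^sub>R h))\<bar> \<partial>lborel \<partial>lborel)"
    proof (rule nn_integral_cong)
      fix t :: real
      show "(\<integral>\<^sup>+x. ennreal \<bar>indicator {0..1::real} t * (f (x + t *\<^sub>R h) * \<psi> x)\<bar> \<partial>lborel)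
        = (\<integral>\<^sup>+y. ennreal \<bar>indicator {0..1::real} t * (f y * \<psi> (y - t *\<^sub>R h))\<bar> \<partial>lborel)"
        using nn_integral_lborel_translate[of "\<lambda>y. ennreal \<bar>indicator {0..1::real} t * (f y * \<psi> (y - t *\<^sub>R h))\<bar>" "t *\<^sub>R h"]
        by simp
    qed
    also have "\<dots> \<le> (\<integral>\<^sup>+t. \<integral>\<^sup>+y. ennreal (indicator {0..1::real} t) * ennreal (C * (indicator (cball 0 ?R) y * \<bar>f y\<bar>)) \<partial>lborel \<partial>lborel)"
      using pt C by (intro nn_integral_mono) (auto simp: ennreal_mult[symmetric] intro!: ennreal_leI)
    also have "\<dots> = (\<integral>\<^sup>+y. ennreal (C * (indicator (cball 0 ?R) y * \<bar>f y\<bar>)) \<partial>lborel)"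
      by (subst nn_integral_cmult) (auto simp: bound)
    finally show "(\<integral>\<^sup>+x. ennreal (norm (case x of (x, t) \<Rightarrow> indicator {0..1::real} t * (f (x + t *\<^sub>R h) * \<psi> x))) \<partial>(lborel \<Otimes>\<^sub>M lborel)) < \<infinity>"
      using fin by simp
  qed
qed

lemma enn2real_diff_eq_0D: "enn2real A - enn2real B = 0 \<Longrightarrow> A \<noteq> \<infinity> \<Longrightarrow> B \<noteq> \<infinity> \<Longrightarrow> A = B"
  by (cases A; cases B) auto

text \<open>
  Testing with \<open>box_bump\<close> shows that \<open>f\<close> has integral zero over every box. The positive and the
  negative part of \<open>f\<close>, restricted to a large box, are therefore densities of measures that agree
  on boxes. So these measures are equal, and \<open>f\<close> vanishes almost everywhere.
\<close>

lemma fundamental_lemma_calculus_of_variations: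
  fixes f :: "real ^ 'n::finite \<Rightarrow> real"
  assumes f: "loc_integrable f" and z: "\<And>\<phi>. test_function \<phi> \<Longrightarrow> (\<integral>x. f x * \<phi> x \<partial>lborel) = 0"
  shows "AE x in lborel. f x = 0"
proof -
  have fm[measurable]: "f \<in> borel_measurable borel" using f by (rule loc_integrable_measurable)
  have int_box: "integrable lborel (\<lambda>x. f x * indicator (box a b) x)" for a b :: "real ^ 'n"
  proof -
    obtain R where "\<And>x. x \<in> box a b \<Longrightarrow> norm x \<le> R" using bounded_box[of a b] by (auto simp: bounded_iff)
    then show ?thesis
      by (intro loc_integrable_mult_bounded[OF f, of _ 1 R]) (auto simp: indicator_def not_le[symmetric])
  qed
  have box0: "(\<integral>x. f x * indicator (box a b) x \<partial>lborel) = 0" for a b :: "real ^ 'n"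
  proof -
    have bm: "box_bump m a b \<in> borel_measurable borel" for m
      using test_functionD(2)[OF test_function_box_bump] by (rule_tac borel_measurable_continuous_onI)
    have "(\<lambda>m. \<integral>x. f x * box_bump m a b x \<partial>lborel) \<longlonglongrightarrow> (\<integral>x. f x * indicator (box a b) x \<partial>lborel)"
    proof (rule integral_dominated_convergence)
      show "integrable lborel (\<lambda>x. norm (f x * indicator (box a b) x))" using int_box by (rule integrable_norm)
      show "AE x in lborel. (\<lambda>m. f x * box_bump m a b x) \<longlonglongrightarrow> f x * indicator (box a b) x"
        by (intro AE_I2 tendsto_mult tendsto_const box_bump_tendsto)
      show "AE x in lborel. norm (f x * box_bump m a b x) \<le> norm (f x * indicator (box a b) x)" for m
      proof (rule AE_I2)
        fix x show "norm (f x * box_bump m a b x) \<le> norm (f x * indicator (box a b) x)"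
          using box_bump_bounds[of m a b x] box_bump_outside[of x a b m]
          by (cases "x \<in> box a b") (auto simp: abs_mult intro: mult_left_le)
      qed
    qed (use bm in auto)
    moreover have "(\<lambda>m. \<integral>x. f x * box_bump m a b x \<partial>lborel) = (\<lambda>m. 0)"
      by (simp add: z test_function_box_bump)
    ultimately show ?thesis by (simp add: LIMSEQ_const_iff)
  qed
  have "AE x in lborel. x \<in> box (- (real N *\<^sub>R One)) (real N *\<^sub>R One) \<longrightarrow> f x = 0" for N
  proof -
    let ?B = "box (- (real N *\<^sub>R One)) (real N *\<^sub>R One) :: (real ^ 'n) set"
    define P where "P = density lborel (\<lambda>x. ennreal (f x * indicator ?B x))"
    define Q where "Q = density lborel (\<lambda>x. ennreal (- (f x * indicator ?B x)))"
    have PQ: "emeasure P (box a b) = emeasure Q (box a b) \<and> emeasure P (box a b) \<noteq> \<infinity>" for a b :: "real ^ 'n"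
    proof -
      obtain c d where cd: "?B \<inter> box a b = box c d" by (rule that, rule box_Int_box)
      let ?g = "\<lambda>x. f x * indicator (box c d) x"
      have g: "f x * indicator ?B x * indicator (box a b) x = ?g x" for x
        unfolding cd[symmetric] by (simp add: indicator_def)
      have P: "emeasure P (box a b) = (\<integral>\<^sup>+x. ennreal (?g x) \<partial>lborel)"
        unfolding P_def g[symmetric]
        by (subst emeasure_density) (auto intro!: nn_integral_cong simp: ennreal_indicator[symmetric] ennreal_mult''[symmetric])
      have Q: "emeasure Q (box a b) = (\<integral>\<^sup>+x. ennreal (- ?g x) \<partial>lborel)"
        unfolding Q_def g[symmetric]
        by (subst emeasure_density) (auto intro!: nn_integral_cong simp: ennreal_indicator[symmetric] ennreal_mult''[symmetric])
      have fin: "(\<integral>\<^sup>+x. ennreal (?g x) \<partial>lborel) \<noteq> \<infinity>" "(\<integral>\<^sup>+x. ennreal (- ?g x) \<partial>lborel) \<noteq> \<infinity>"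
        using int_box[of c d] unfolding real_integrable_def by auto
      have "enn2real (\<integral>\<^sup>+x. ennreal (?g x) \<partial>lborel) - enn2real (\<integral>\<^sup>+x. ennreal (- ?g x) \<partial>lborel) = 0"
        using real_lebesgue_integral_def[OF int_box[of c d]] box0[of c d] by simp
      then have "(\<integral>\<^sup>+x. ennreal (?g x) \<partial>lborel) = (\<integral>\<^sup>+x. ennreal (- ?g x) \<partial>lborel)"
        by (rule enn2real_diff_eq_0D[OF _ fin])
      with fin show ?thesis unfolding P Q by blast
    qed
    have "P = Q"
    proof (rule measure_eqI_generator_eq)
      let ?E = "range (\<lambda>(a, b). box a b::(real ^ 'n) set)"
      show "Int_stable ?E" by (auto simp: Int_stable_def box_Int_box)
      show "?E \<subseteq> Pow UNIV" "sets P = sigma_sets UNIV ?E" "sets Q = sigma_sets UNIV ?E"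
        by (simp_all add: P_def Q_def borel_eq_box)
      let ?A = "\<lambda>n::nat. box (- (real n *\<^sub>R One)) (real n *\<^sub>R One) :: (real ^ 'n) set"
      show "range ?A \<subseteq> ?E" "(\<Union>i. ?A i) = UNIV" unfolding UN_box_eq_UNIV by auto
      show "emeasure P (?A i) \<noteq> \<infinity>" for i using PQ by blast
      show "emeasure P X = emeasure Q X" if "X \<in> ?E" for X using that PQ by auto
    qed
    then have "AE x in lborel. ennreal (f x * indicator ?B x) = ennreal (- (f x * indicator ?B x))"
      unfolding P_def Q_def by (subst (asm) sigma_finite_measure.density_unique_iff[OF sigma_finite_lborel]) auto
    then show ?thesis
    proof eventually_elim
      case (elim x)
      have "v = 0" if "ennreal v = ennreal (- v)" for v :: real
        using that by (cases "0 \<le> v") (auto simp: ennreal_neg ennreal_eq_0_iff)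
      from this[OF elim] have "f x * indicator ?B x = 0" .
      then show ?case by (auto simp: indicator_def split: if_splits)
    qed
  qed
  then have "AE x in lborel. \<forall>N. x \<in> box (- (real N *\<^sub>R One)) (real N *\<^sub>R One) \<longrightarrow> f x = 0"
    by (intro AE_all_countable[THEN iffD2] allI)
  then show ?thesis
  proof eventually_elim
    case (elim x)
    have "x \<in> (\<Union>N. box (- (real N *\<^sub>R One)) (real N *\<^sub>R One))" unfolding UN_box_eq_UNIV by simp
    then show ?case using elim by blast
  qed
qed


section \<open>Weak gradients along segments\<close>

lemma integrable_lborel_translate:
  fixes F :: "'a::euclidean_space \<Rightarrow> real"
  assumes F: "integrable lborel F"
  shows "integrable lborel (\<lambda>x. F (x + c))"
proof -
  have e: "(\<lambda>x. x + c) = (+) c" by (auto simp: add.commute)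
  have [measurable]: "F \<in> borel_measurable borel" using borel_measurable_integrable[OF F] by simp
  have "integrable (distr lborel borel ((+) c)) F" using F by (simp only: lborel_distr_plus)
  then show ?thesis by (subst (asm) integrable_distr_eq) (auto simp: add.commute)
qed

text \<open>
  The difference \<open>F\<close> of the two sides is locally integrable, so it suffices to test it. By
  translation, testing \<open>u (x + h) - u x\<close> with \<open>\<phi>\<close> amounts to integrating \<open>u\<close> against
  \<open>\<phi> (y - h) - \<phi> y\<close>, which is the integral over \<open>t\<close> of a derivative of \<open>\<phi> (y - t h)\<close>. For each
  \<open>t\<close> the definition of the weak gradient moves this derivative to \<open>u\<close>, and translating back
  gives the segment integral of \<open>g\<close>.
\<close>

lemma weak_gradient_line:
  fixes u :: "real ^ 'n::finite \<Rightarrow> real" and g :: "real ^ 'n \<Rightarrow> real ^ 'n"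
  assumes u: "loc_integrable u" and g: "\<And>i. loc_integrable (\<lambda>x. g x $ i)"
    and weak: "\<And>\<phi> i. test_function \<phi> \<Longrightarrow>
      (\<integral>x. u x * partial_deriv i \<phi> x \<partial>lborel) = - (\<integral>x. g x $ i * \<phi> x \<partial>lborel)"
  shows "AE x in lborel. (\<forall>i. integrable lborel (\<lambda>t. indicator {0..1::real} t * (g (x + t *\<^sub>R h) $ i))) \<and>
    u (x + h) - u x = (\<Sum>i\<in>UNIV. h $ i * (\<integral>t. indicator {0..1} t * (g (x + t *\<^sub>R h) $ i) \<partial>lborel))"
proof -
  have um[measurable]: "u \<in> borel_measurable borel" using u by (rule loc_integrable_measurable)
  have gm[measurable]: "(\<lambda>x. g x $ i) \<in> borel_measurable borel" for i using g by (rule loc_integrable_measurable)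
  have cb[measurable]: "cball (0::real ^ 'n) r \<in> sets borel" for r by auto
  define G where "G i x = (\<integral>t. indicator {0..1::real} t * (g (x + t *\<^sub>R h) $ i) \<partial>lborel)" for i x
  have Gm[measurable]: "G i \<in> borel_measurable borel" for i
  proof -
    have "(\<lambda>(x, t). indicator {0..1::real} t * (g (x + t *\<^sub>R h) $ i)) \<in> borel_measurable (lborel \<Otimes>\<^sub>M lborel)"
      by measurable
    from lborel.borel_measurable_lebesgue_integral[OF this] show ?thesis by (simp add: G_def[abs_def])
  qed
  have AEint: "AE x in lborel. integrable lborel (\<lambda>t. indicator {0..1::real} t * (g (x + t *\<^sub>R h) $ i))" for i
  proof -
    have "AE x in lborel. norm x \<le> real N \<longrightarrow> integrable lborel (\<lambda>t. indicator {0..1::real} t * (g (x + t *\<^sub>R h) $ i))" for N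
    proof -
      have "integrable (lborel \<Otimes>\<^sub>M lborel)
          (\<lambda>(x, t). indicator {0..1::real} t * ((\<lambda>x. g x $ i) (x + t *\<^sub>R h) * indicator (cball 0 (real N)) x))"
        by (rule integrable_shear(2)[OF g, where C=1 and R="real N"]) (auto simp: indicator_def)
      from lborel_pair.AE_integrable_fst'[OF this] show ?thesis
        by eventually_elim (auto simp: indicator_def)
    qed
    then have "AE x in lborel. \<forall>N. norm x \<le> real N \<longrightarrow> integrable lborel (\<lambda>t. indicator {0..1::real} t * (g (x + t *\<^sub>R h) $ i))"
      by (intro AE_all_countable[THEN iffD2] allI)
    then show ?thesis
    proof eventually_elim
      case (elim x)
      obtain N where "norm x \<le> real N" using real_arch_simple by blast
      then show ?case using elim by blast
    qed
  qed
  have AEall: "AE x in lborel. \<forall>i. integrable lborel (\<lambda>t. indicator {0..1::real} t * (g (x + t *\<^sub>R h) $ i))"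
  proof -
    have "AE x in lborel. \<forall>i\<in>(UNIV :: 'n set). integrable lborel (\<lambda>t. indicator {0..1::real} t * (g (x + t *\<^sub>R h) $ i))"
      by (subst AE_finite_all) (simp_all only: finite AEint ball_UNIV simp_thms)
    then show ?thesis by (simp only: ball_UNIV)
  qed
  have Gint: "integrable (lborel \<Otimes>\<^sub>M lborel) (\<lambda>(x, t). indicator {0..1::real} t * (g (x + t *\<^sub>R h) $ i * \<psi> x))
      \<and> integrable lborel (\<lambda>x. G i x * \<psi> x)
      \<and> (\<integral>x. G i x * \<psi> x \<partial>lborel) = (\<integral>t. \<integral>x. indicator {0..1::real} t * (g (x + t *\<^sub>R h) $ i * \<psi> x) \<partial>lborel \<partial>lborel)"
    if \<psi>: "\<psi> \<in> borel_measurable borel" "\<And>x. \<bar>\<psi> x\<bar> \<le> C" "\<And>x. R < norm x \<Longrightarrow> \<psi> x = 0" for \<psi> i C R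
  proof -
    have int: "integrable (lborel \<Otimes>\<^sub>M lborel) (\<lambda>(x, t). indicator {0..1::real} t * (g (x + t *\<^sub>R h) $ i * \<psi> x))"
      using integrable_shear(2)[OF g[of i] \<psi>] by simp
    have e: "(\<integral>t. indicator {0..1::real} t * (g (x + t *\<^sub>R h) $ i * \<psi> x) \<partial>lborel) = G i x * \<psi> x" for x
      unfolding G_def by (simp add: mult.assoc[symmetric])
    have "integrable lborel (\<lambda>x. G i x * \<psi> x)"
      using lborel_pair.integrable_fst'[OF int] by (simp add: e)
    moreover have "(\<integral>x. G i x * \<psi> x \<partial>lborel) = (\<integral>t. \<integral>x. indicator {0..1::real} t * (g (x + t *\<^sub>R h) $ i * \<psi> x) \<partial>lborel \<partial>lborel)"
      using lborel_pair.Fubini_integral[OF int] by (simp add: e)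
    ultimately show ?thesis using int by blast
  qed
  define F where "F x = u (x + h) - u x - (\<Sum>i\<in>UNIV. h $ i * G i x)" for x
  have uh: "integrable lborel (\<lambda>x. u (x + h) * \<psi> x)"
    if [measurable]: "\<psi> \<in> borel_measurable borel" and \<psi>: "\<And>x. \<bar>\<psi> x\<bar> \<le> C" "\<And>x. R < norm x \<Longrightarrow> \<psi> x = 0" for \<psi> C R
  proof -
    have "integrable lborel (\<lambda>y. u y * \<psi> (y - h))"
    proof (rule loc_integrable_mult_bounded[OF u, where C=C and R="R + norm h"])
      fix y :: "real ^ 'n" assume "R + norm h < norm y"
      then have "R < norm (y - h)" using norm_triangle_ineq2[of y h] by linarith
      then show "\<psi> (y - h) = 0" by (rule \<psi>)
    qed (use \<psi> in auto)
    from integrable_lborel_translate[OF this, of h] show ?thesis by simp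
  qed
  have Fint: "integrable lborel (\<lambda>x. F x * \<psi> x) \<and> (\<integral>x. F x * \<psi> x \<partial>lborel) =
      (\<integral>y. u y * \<psi> (y - h) \<partial>lborel) - (\<integral>y. u y * \<psi> y \<partial>lborel) - (\<Sum>i\<in>UNIV. h $ i * (\<integral>x. G i x * \<psi> x \<partial>lborel))"
    if [measurable]: "\<psi> \<in> borel_measurable borel" and \<psi>: "\<And>x. \<bar>\<psi> x\<bar> \<le> C" "\<And>x. R < norm x \<Longrightarrow> \<psi> x = 0" for \<psi> C R
  proof -
    have e: "F x * \<psi> x = u (x + h) * \<psi> x - u x * \<psi> x - (\<Sum>i\<in>UNIV. h $ i * (G i x * \<psi> x))" for x
      by (simp add: F_def left_diff_distrib sum_distrib_right mult.assoc)
    have i1: "integrable lborel (\<lambda>x. u (x + h) * \<psi> x)" by (rule uh[OF that])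
    have i2: "integrable lborel (\<lambda>x. u x * \<psi> x)" by (rule loc_integrable_mult_bounded[OF u that])
    have i3: "integrable lborel (\<lambda>x. h $ i * (G i x * \<psi> x))" for i using Gint[OF that, where i=i] by simp
    have sh: "(\<integral>x. u (x + h) * \<psi> x \<partial>lborel) = (\<integral>y. u y * \<psi> (y - h) \<partial>lborel)"
      using integral_lborel_translate[of "\<lambda>y. u y * \<psi> (y - h)" h] by simp
    show ?thesis
      unfolding e using i1 i2 i3 by (simp add: sh)
  qed
  have F: "loc_integrable F"
    unfolding loc_integrable_def
  proof (intro conjI allI)
    show "F \<in> borel_measurable borel" unfolding F_def[abs_def] by measurable
    fix R
    have "integrable lborel (\<lambda>x. F x * indicator (cball 0 R) x)"
      using Fint[of "indicator (cball 0 R)" 1 R] by (auto simp: indicator_def)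
    then show "integrable lborel (\<lambda>x. indicator (cball 0 R) x * F x)" by (simp add: mult.commute)
  qed
  have "AE x in lborel. F x = 0"
  proof (rule fundamental_lemma_calculus_of_variations[OF F])
    fix \<phi> :: "real ^ 'n \<Rightarrow> real" assume \<phi>: "test_function \<phi>"
    obtain K where K: "compact K" "\<And>x. x \<notin> K \<Longrightarrow> \<phi> x = 0" "\<And>x i. x \<notin> K \<Longrightarrow> partial_deriv i \<phi> x = 0"
      using test_function_support[OF \<phi>] by metis
    obtain R where R: "\<And>x. x \<in> K \<Longrightarrow> norm x \<le> R" using compact_imp_bounded[OF K(1)] by (auto simp: bounded_iff)
    have \<phi>m[measurable]: "\<phi> \<in> borel_measurable borel" and dm[measurable]: "partial_deriv i \<phi> \<in> borel_measurable borel" for i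
      using test_functionD[OF \<phi>] by (auto intro: borel_measurable_continuous_onI)
    obtain C where C: "\<And>x. \<bar>\<phi> x\<bar> \<le> C" using compact_support_bounded[OF K(1) test_functionD(2)[OF \<phi>]] K by blast
    have "\<forall>i. \<exists>C. \<forall>x. \<bar>partial_deriv i \<phi> x\<bar> \<le> C" using compact_support_bounded[OF K(1) test_functionD(3)[OF \<phi>]] K by blast
    then obtain D where D: "\<And>i x. \<bar>partial_deriv i \<phi> x\<bar> \<le> D i" by metis
    have sR: "R < norm x \<Longrightarrow> \<phi> x = 0" "R < norm x \<Longrightarrow> partial_deriv i \<phi> x = 0" for x i
      using R[of x] K(2,3)[of x] by (auto simp: not_le[symmetric])
    have ftc: "(\<integral>t. (\<Sum>i\<in>UNIV. h $ i * partial_deriv i \<phi> (y - t *\<^sub>R h)) * indicator {0..1} t \<partial>lborel) = \<phi> y - \<phi> (y - h)" for y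
    proof -
      have "(\<integral>t. (\<Sum>i\<in>UNIV. h $ i * partial_deriv i \<phi> (y - t *\<^sub>R h)) * indicator {0..1} t \<partial>lborel)
          = - \<phi> (y - 1 *\<^sub>R h) - (- \<phi> (y - 0 *\<^sub>R h))"
      proof (rule integral_FTC_Icc_real)
        fix t :: real
        let ?x = "y - t *\<^sub>R h"
        have d: "(\<phi> has_derivative frechet_derivative \<phi> (at ?x)) (at ?x)"
          using test_functionD(1)[OF \<phi>] by (simp add: frechet_derivative_works)
        have lin: "linear (frechet_derivative \<phi> (at ?x))" using d by (rule has_derivative_linear)
        have hsum: "frechet_derivative \<phi> (at ?x) h = (\<Sum>i\<in>UNIV. h $ i * partial_deriv i \<phi> ?x)"
        proof -
          have "frechet_derivative \<phi> (at ?x) (\<Sum>i\<in>UNIV. h $ i *s axis i 1) = (\<Sum>i\<in>UNIV. h $ i * partial_deriv i \<phi> ?x)"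
            by (simp add: linear_sum[OF lin] scalar_mult_eq_scaleR linear_cmul[OF lin] partial_deriv_def)
          then show ?thesis by (simp only: basis_expansion)
        qed
        have "((\<lambda>t. y - t *\<^sub>R h) has_derivative (\<lambda>s. - (s *\<^sub>R h))) (at t)"
          by (auto intro!: derivative_eq_intros)
        from has_derivative_compose[OF this, of \<phi> "frechet_derivative \<phi> (at ?x)"] d
        have "((\<lambda>t. \<phi> (y - t *\<^sub>R h)) has_derivative (\<lambda>s. frechet_derivative \<phi> (at ?x) (- (s *\<^sub>R h)))) (at t)"
          by simp
        also have "(\<lambda>s. frechet_derivative \<phi> (at ?x) (- (s *\<^sub>R h))) = (\<lambda>s. - (\<Sum>i\<in>UNIV. h $ i * partial_deriv i \<phi> ?x) * s)"
          by (auto simp: linear_neg[OF lin] linear_cmul[OF lin] hsum mult.commute)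
        finally have "((\<lambda>t. \<phi> (y - t *\<^sub>R h)) has_real_derivative - (\<Sum>i\<in>UNIV. h $ i * partial_deriv i \<phi> ?x)) (at t)"
          unfolding has_field_derivative_def .
        from DERIV_minus[OF this]
        show "((\<lambda>t. - \<phi> (y - t *\<^sub>R h)) has_real_derivative (\<Sum>i\<in>UNIV. h $ i * partial_deriv i \<phi> ?x)) (at t)" by simp
        have c1: "isCont (partial_deriv i \<phi>) z" for i z
          using test_functionD(3)[OF \<phi>] by (simp add: continuous_on_eq_continuous_at)
        have c2: "isCont (\<lambda>t. y - t *\<^sub>R h) t" by (intro continuous_intros)
        show "isCont (\<lambda>t. \<Sum>i\<in>UNIV. h $ i * partial_deriv i \<phi> (y - t *\<^sub>R h)) t"
          by (intro continuous_sum continuous_mult continuous_const isCont_o2[OF c2 c1])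
      qed simp
      then show ?thesis by simp
    qed
    have B: "(\<integral>y. (\<integral>t. indicator {0..1::real} t * (u y * partial_deriv i \<phi> (y - t *\<^sub>R h)) \<partial>lborel) \<partial>lborel)
        = - (\<integral>x. G i x * \<phi> x \<partial>lborel)" for i
    proof -
      have "(\<integral>y. (\<integral>t. indicator {0..1::real} t * (u y * partial_deriv i \<phi> (y - t *\<^sub>R h)) \<partial>lborel) \<partial>lborel)
         = (\<integral>t. (\<integral>y. indicator {0..1::real} t * (u y * partial_deriv i \<phi> (y - t *\<^sub>R h)) \<partial>lborel) \<partial>lborel)"
        using lborel_pair.Fubini_integral[OF integrable_shear(1)[OF u dm D sR(2)]] by simp
      also have "\<dots> = (\<integral>t. - (\<integral>x. indicator {0..1::real} t * (g (x + t *\<^sub>R h) $ i * \<phi> x) \<partial>lborel) \<partial>lborel)"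
      proof (rule Bochner_Integration.integral_cong[OF refl])
        fix t :: real
        have "(\<integral>y. u y * partial_deriv i \<phi> (y - t *\<^sub>R h) \<partial>lborel) = - (\<integral>x. g x $ i * \<phi> (x - t *\<^sub>R h) \<partial>lborel)"
          using weak[OF test_function_translate[OF \<phi>, of "t *\<^sub>R h"], of i]
          by (simp add: partial_deriv_translate[OF test_functionD(1)[OF \<phi>]])
        also have "(\<integral>x. g x $ i * \<phi> (x - t *\<^sub>R h) \<partial>lborel) = (\<integral>x. g (x + t *\<^sub>R h) $ i * \<phi> x \<partial>lborel)"
          using integral_lborel_translate[of "\<lambda>x. g x $ i * \<phi> (x - t *\<^sub>R h)" "t *\<^sub>R h"] by simp
        finally show "(\<integral>y. indicator {0..1::real} t * (u y * partial_deriv i \<phi> (y - t *\<^sub>R h)) \<partial>lborel)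
            = - (\<integral>x. indicator {0..1::real} t * (g (x + t *\<^sub>R h) $ i * \<phi> x) \<partial>lborel)" by simp
      qed
      also have "\<dots> = - (\<integral>x. G i x * \<phi> x \<partial>lborel)"
        using Gint[OF \<phi>m C sR(1), where i=i] by simp
      finally show ?thesis .
    qed
    have int_y: "integrable lborel (\<lambda>y. \<integral>t. indicator {0..1::real} t * (u y * partial_deriv i \<phi> (y - t *\<^sub>R h)) \<partial>lborel)" for i
      using lborel_pair.integrable_fst'[OF integrable_shear(1)[OF u dm D sR(2)]] by simp
    have ind_int: "integrable lborel (\<lambda>t. partial_deriv i \<phi> (y - t *\<^sub>R h) * indicator {0..1} t)" for i y
    proof (rule Bochner_Integration.integrable_bound)
      show "integrable lborel (\<lambda>t. D i * indicator {0..1::real} t)" by simp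
      show "AE t in lborel. norm (partial_deriv i \<phi> (y - t *\<^sub>R h) * indicator {0..1} t) \<le> norm (D i * indicator {0..1::real} t)"
        using D by (intro AE_I2) (auto simp: indicator_def intro: order_trans[OF _ abs_ge_self])
    qed measurable
    have A: "u y * (\<phi> y - \<phi> (y - h)) = (\<Sum>i\<in>UNIV. h $ i * (\<integral>t. indicator {0..1::real} t * (u y * partial_deriv i \<phi> (y - t *\<^sub>R h)) \<partial>lborel))" for y
    proof -
      have "\<phi> y - \<phi> (y - h) = (\<integral>t. (\<Sum>i\<in>UNIV. h $ i * (partial_deriv i \<phi> (y - t *\<^sub>R h) * indicator {0..1} t)) \<partial>lborel)"
        unfolding ftc[symmetric] by (simp add: sum_distrib_right mult.assoc)
      also have "\<dots> = (\<Sum>i\<in>UNIV. h $ i * (\<integral>t. partial_deriv i \<phi> (y - t *\<^sub>R h) * indicator {0..1} t \<partial>lborel))"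
        using ind_int by simp
      finally have "u y * (\<phi> y - \<phi> (y - h)) = (\<Sum>i\<in>UNIV. h $ i * (u y * (\<integral>t. partial_deriv i \<phi> (y - t *\<^sub>R h) * indicator {0..1} t \<partial>lborel)))"
        by (simp add: sum_distrib_left mult.left_commute)
      moreover have "(u y * (\<integral>t. partial_deriv i \<phi> (y - t *\<^sub>R h) * indicator {0..1} t \<partial>lborel))
          = (\<integral>t. indicator {0..1::real} t * (u y * partial_deriv i \<phi> (y - t *\<^sub>R h)) \<partial>lborel)" for i
        by (simp add: integral_mult_right_zero[symmetric] mult.left_commute mult.commute del: integral_mult_right_zero)
      ultimately show ?thesis by (simp only:)
    qed
    have i1: "integrable lborel (\<lambda>y. u y * \<phi> y)" by (rule loc_integrable_mult_bounded[OF u \<phi>m C sR(1)])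
    have i2: "integrable lborel (\<lambda>y. u y * \<phi> (y - h))"
      using integrable_lborel_translate[OF uh[OF \<phi>m C sR(1)], where c="- h"] by simp
    have "(\<integral>y. u y * \<phi> y \<partial>lborel) - (\<integral>y. u y * \<phi> (y - h) \<partial>lborel) = (\<integral>y. u y * (\<phi> y - \<phi> (y - h)) \<partial>lborel)"
      using i1 i2 by (simp add: right_diff_distrib)
    also have "\<dots> = (\<Sum>i\<in>UNIV. h $ i * (\<integral>y. (\<integral>t. indicator {0..1::real} t * (u y * partial_deriv i \<phi> (y - t *\<^sub>R h)) \<partial>lborel) \<partial>lborel))"
      unfolding A using int_y by simp
    also have "\<dots> = - (\<Sum>i\<in>UNIV. h $ i * (\<integral>x. G i x * \<phi> x \<partial>lborel))"
      unfolding B by (simp add: sum_negf)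
    finally show "(\<integral>x. F x * \<phi> x \<partial>lborel) = 0"
      using Fint[OF \<phi>m C sR(1)] by simp
  qed
  then show ?thesis using AEall
    by eventually_elim (simp add: F_def G_def)
qed


section \<open>Continuity of translations in $L^q$\<close>

definition powr_integral :: "real \<Rightarrow> ('a::euclidean_space \<Rightarrow> real) \<Rightarrow> ennreal" where
  "powr_integral q f = (\<integral>\<^sup>+x. ennreal (\<bar>f x\<bar> powr q) \<partial>lborel)"

lemma powr_add_le:
  fixes a b q :: real
  assumes "0 < q"
  shows "\<bar>a + b\<bar> powr q \<le> 2 powr q * (\<bar>a\<bar> powr q + \<bar>b\<bar> powr q)"
proof -
  have "\<bar>a + b\<bar> powr q \<le> (2 * max \<bar>a\<bar> \<bar>b\<bar>) powr q" using assms by (intro powr_mono2) auto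
  also have "\<dots> = 2 powr q * max \<bar>a\<bar> \<bar>b\<bar> powr q" by (simp add: powr_mult)
  also have "\<dots> \<le> 2 powr q * (\<bar>a\<bar> powr q + \<bar>b\<bar> powr q)"
    by (intro mult_left_mono) (auto simp: max_def)
  finally show ?thesis .
qed

lemma powr_integral_add_le:
  assumes q: "0 < q" and [measurable]: "f \<in> borel_measurable borel" "g \<in> borel_measurable borel"
  shows "powr_integral q (\<lambda>x. f x + g x) \<le> ennreal (2 powr q) * (powr_integral q f + powr_integral q g)"
proof -
  have "powr_integral q (\<lambda>x. f x + g x) \<le> (\<integral>\<^sup>+x. ennreal (2 powr q) * (ennreal (\<bar>f x\<bar> powr q) + ennreal (\<bar>g x\<bar> powr q)) \<partial>lborel)"
    unfolding powr_integral_def using powr_add_le[OF q]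
    by (intro nn_integral_mono) (simp add: ennreal_mult[symmetric] ennreal_plus[symmetric] ennreal_leI del: ennreal_plus)
  also have "\<dots> = ennreal (2 powr q) * (powr_integral q f + powr_integral q g)"
    unfolding powr_integral_def by (subst nn_integral_cmult) (auto simp: nn_integral_add)
  finally show ?thesis .
qed

lemma powr_integral_translate:
  assumes [measurable]: "f \<in> borel_measurable borel"
  shows "powr_integral q (\<lambda>x. f (x + c)) = powr_integral q f"
  unfolding powr_integral_def using nn_integral_lborel_translate[of "\<lambda>x. ennreal (\<bar>f x\<bar> powr q)" c] by simp

lemma powr_integral_minus: "powr_integral q (\<lambda>x. f x - g x) = powr_integral q (\<lambda>x. g x - f x)"
  unfolding powr_integral_def by (simp add: abs_minus_commute)

lemma ennreal_tendsto_0I: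
  fixes X :: "'a \<Rightarrow> ennreal"
  assumes "\<And>e. 0 < e \<Longrightarrow> \<forall>\<^sub>F j in F. X j \<le> ennreal e"
  shows "(X \<longlongrightarrow> 0) F"
proof (rule order_tendstoI)
  fix a :: ennreal assume a: "0 < a"
  obtain e where e: "0 < e" "ennreal e < a"
  proof (cases a)
    case (real r)
    then show ?thesis using a by (intro that[of "r / 2"]) (auto simp: ennreal_lessI)
  next
    case top
    then show ?thesis by (intro that[of 1]) auto
  qed
  show "\<forall>\<^sub>F j in F. X j < a"
    using assms[OF e(1)] by eventually_elim (use e in auto)
qed simp

lemma ennreal_tendsto_0D:
  fixes X :: "'a \<Rightarrow> ennreal"
  assumes "(X \<longlongrightarrow> 0) F" "0 < e"
  shows "\<forall>\<^sub>F j in F. X j \<le> ennreal e"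
  using order_tendstoD(2)[OF assms(1), of "ennreal e"] assms(2) by (auto elim: eventually_mono)

text \<open>
  Sequences of translations are enough, since the limits to be taken will be tested on sequences.
\<close>

definition translation_continuous :: "real \<Rightarrow> ('a::euclidean_space \<Rightarrow> real) \<Rightarrow> bool" where
  "translation_continuous q f \<longleftrightarrow> f \<in> borel_measurable borel \<and>
     (\<forall>h. h \<longlonglongrightarrow> 0 \<longrightarrow> (\<lambda>j::nat. powr_integral q (\<lambda>x. f (x + h j) - f x)) \<longlonglongrightarrow> 0)"

lemma translation_continuous_add:
  assumes q: "0 < q" and f: "translation_continuous q f" and g: "translation_continuous q g"
  shows "translation_continuous q (\<lambda>x. f x + g x)"
  unfolding translation_continuous_def
proof (intro conjI allI impI)
  have [measurable]: "f \<in> borel_measurable borel" "g \<in> borel_measurable borel"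
    using f g by (auto simp: translation_continuous_def)
  show "(\<lambda>x. f x + g x) \<in> borel_measurable borel" by measurable
  fix h :: "nat \<Rightarrow> 'a" assume h: "h \<longlonglongrightarrow> 0"
  have lim: "(\<lambda>j. ennreal (2 powr q) * (powr_integral q (\<lambda>x. f (x + h j) - f x) + powr_integral q (\<lambda>x. g (x + h j) - g x)))
      \<longlonglongrightarrow> ennreal (2 powr q) * (0 + 0)"
    using f g h by (intro ennreal_tendsto_cmult tendsto_add) (auto simp: translation_continuous_def)
  show "(\<lambda>j. powr_integral q (\<lambda>x. f (x + h j) + g (x + h j) - (f x + g x))) \<longlonglongrightarrow> 0"
  proof (rule tendsto_sandwich[OF _ _ tendsto_const])
    show "\<forall>\<^sub>F j in sequentially. powr_integral q (\<lambda>x. f (x + h j) + g (x + h j) - (f x + g x)) \<le>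
        ennreal (2 powr q) * (powr_integral q (\<lambda>x. f (x + h j) - f x) + powr_integral q (\<lambda>x. g (x + h j) - g x))"
    proof (rule always_eventually, rule allI)
      fix j
      show "powr_integral q (\<lambda>x. f (x + h j) + g (x + h j) - (f x + g x)) \<le>
        ennreal (2 powr q) * (powr_integral q (\<lambda>x. f (x + h j) - f x) + powr_integral q (\<lambda>x. g (x + h j) - g x))"
        using powr_integral_add_le[OF q, of "\<lambda>x. f (x + h j) - f x" "\<lambda>x. g (x + h j) - g x"]
        by (simp add: algebra_simps)
    qed
    show "(\<lambda>j. ennreal (2 powr q) * (powr_integral q (\<lambda>x. f (x + h j) - f x) + powr_integral q (\<lambda>x. g (x + h j) - g x))) \<longlonglongrightarrow> 0"
      using lim by simp
  qed simp
qed

lemma translation_continuous_cmult: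
  assumes q: "0 < q" and f: "translation_continuous q f"
  shows "translation_continuous q (\<lambda>x. c * f x)"
  unfolding translation_continuous_def
proof (intro conjI allI impI)
  have [measurable]: "f \<in> borel_measurable borel" using f by (auto simp: translation_continuous_def)
  show "(\<lambda>x. c * f x) \<in> borel_measurable borel" by measurable
  fix h :: "nat \<Rightarrow> 'a" assume h: "h \<longlonglongrightarrow> 0"
  have e: "powr_integral q (\<lambda>x. c * f (x + h j) - c * f x) = ennreal (\<bar>c\<bar> powr q) * powr_integral q (\<lambda>x. f (x + h j) - f x)" for j
    unfolding powr_integral_def
    by (subst nn_integral_cmult[symmetric])
      (auto simp: right_diff_distrib[symmetric] abs_mult powr_mult ennreal_mult)
  have "(\<lambda>j. ennreal (\<bar>c\<bar> powr q) * powr_integral q (\<lambda>x. f (x + h j) - f x)) \<longlonglongrightarrow> ennreal (\<bar>c\<bar> powr q) * 0"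
    using f h by (intro ennreal_tendsto_cmult) (auto simp: translation_continuous_def)
  then show "(\<lambda>j. powr_integral q (\<lambda>x. c * f (x + h j) - c * f x)) \<longlonglongrightarrow> 0" unfolding e by simp
qed

lemma translation_continuous_limit:
  assumes q: "0 < q" and [measurable]: "f \<in> borel_measurable borel"
    and approx: "\<And>e. 0 < e \<Longrightarrow> \<exists>f'. translation_continuous q f' \<and> powr_integral q (\<lambda>x. f x - f' x) \<le> ennreal e"
  shows "translation_continuous q f"
  unfolding translation_continuous_def
proof (intro conjI allI impI)
  show "f \<in> borel_measurable borel" by measurable
  fix h :: "nat \<Rightarrow> 'a" assume h: "h \<longlonglongrightarrow> 0"
  let ?C = "2 powr q"
  have C: "?C > 0" by simp
  show "(\<lambda>j. powr_integral q (\<lambda>x. f (x + h j) - f x)) \<longlonglongrightarrow> 0"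
  proof (rule ennreal_tendsto_0I)
    fix e :: real assume e: "0 < e"
    (* the inequality for sums is used twice, which produces this factor *)
    define e' where "e' = e / (?C * (?C * 2 + 1))"
    have pos: "0 < ?C * (?C * 2 + 1)" by (intro mult_pos_pos add_pos_pos) auto
    have e': "0 < e'" unfolding e'_def by (rule divide_pos_pos[OF e pos])
    obtain f' where f': "translation_continuous q f'" "powr_integral q (\<lambda>x. f x - f' x) \<le> ennreal e'"
      using approx[OF e'] by blast
    then have [measurable]: "f' \<in> borel_measurable borel" by (auto simp: translation_continuous_def)
    have "\<forall>\<^sub>F j in sequentially. powr_integral q (\<lambda>x. f' (x + h j) - f' x) \<le> ennreal e'"
      using f'(1) h e' by (intro ennreal_tendsto_0D) (auto simp: translation_continuous_def)
    then show "\<forall>\<^sub>F j in sequentially. powr_integral q (\<lambda>x. f (x + h j) - f x) \<le> ennreal e"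
    proof eventually_elim
      case (elim j)
      have d: "powr_integral q (\<lambda>x. f (x + h j) - f' (x + h j)) \<le> ennreal e'"
        using powr_integral_translate[of "\<lambda>x. f x - f' x" q "h j"] f'(2) by simp
      have d': "powr_integral q (\<lambda>x. f' x - f x) \<le> ennreal e'" using f'(2) by (simp add: powr_integral_minus[of q f'])
      have "powr_integral q (\<lambda>x. f (x + h j) - f x)
          = powr_integral q (\<lambda>x. ((f (x + h j) - f' (x + h j)) + (f' x - f x)) + (f' (x + h j) - f' x))" by simp
      also have "\<dots> \<le> ennreal ?C * (powr_integral q (\<lambda>x. (f (x + h j) - f' (x + h j)) + (f' x - f x))
          + powr_integral q (\<lambda>x. f' (x + h j) - f' x))"
        by (intro powr_integral_add_le q) measurable
      also have "\<dots> \<le> ennreal ?C * (ennreal ?C * (ennreal e' + ennreal e') + ennreal e')"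
      proof (intro mult_left_mono add_mono elim)
        have "powr_integral q (\<lambda>x. (f (x + h j) - f' (x + h j)) + (f' x - f x)) \<le>
            ennreal ?C * (powr_integral q (\<lambda>x. f (x + h j) - f' (x + h j)) + powr_integral q (\<lambda>x. f' x - f x))"
          by (intro powr_integral_add_le q) measurable
        also have "\<dots> \<le> ennreal ?C * (ennreal e' + ennreal e')" using d d' by (intro mult_left_mono add_mono) auto
        finally show "powr_integral q (\<lambda>x. (f (x + h j) - f' (x + h j)) + (f' x - f x)) \<le> ennreal ?C * (ennreal e' + ennreal e')" .
      qed simp
      also have "\<dots> = ennreal (?C * (?C * (e' + e') + e'))"
        using e' by (simp add: ennreal_mult[symmetric] ennreal_plus[symmetric] del: ennreal_plus)
      also have "?C * (?C * (e' + e') + e') = e'  * (?C * (?C * 2 + 1))" by (simp add: algebra_simps)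
      also have "\<dots> = e" unfolding e'_def using pos by (intro nonzero_eq_divide_eq[THEN iffD1]) auto
      finally show ?case .
    qed
  qed
qed

text \<open>
  For an open set \<open>U\<close> of finite measure the translated indicators converge pointwise on \<open>U\<close>. The
  part of the error outside \<open>U\<close> is, after a translation, of the same form with the opposite shift.
  A general Borel set is approximated from outside by open sets.
\<close>

lemma translation_continuous_indicator:
  fixes A :: "'a::euclidean_space set"
  assumes q: "0 < q" and A[measurable]: "A \<in> sets borel" and fin: "emeasure lborel A < \<infinity>"
  shows "translation_continuous q (indicator A :: 'a \<Rightarrow> real)"
proof -
  have opn: "translation_continuous q (indicator U :: 'a \<Rightarrow> real)"
    if U: "open U" and Ufin: "emeasure lborel U < \<infinity>" for U
    unfolding translation_continuous_def
  proof (intro conjI allI impI)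
    have Um[measurable]: "U \<in> sets borel" using U by simp
    show "(indicator U :: 'a \<Rightarrow> real) \<in> borel_measurable borel" by measurable
    fix h :: "nat \<Rightarrow> 'a" assume h: "h \<longlonglongrightarrow> 0"
    have lim: "(\<lambda>j. \<integral>\<^sup>+x. indicator U x * indicator (- U) (x + k j) \<partial>lborel) \<longlonglongrightarrow> 0"
      if k: "k \<longlonglongrightarrow> 0" for k :: "nat \<Rightarrow> 'a"
    proof -
      have "(\<lambda>j. \<integral>\<^sup>+x. indicator U x * indicator (- U) (x + k j) \<partial>lborel) \<longlonglongrightarrow> (\<integral>\<^sup>+x. 0 \<partial>(lborel :: 'a measure))"
      proof (rule nn_integral_dominated_convergence[where w="indicator U"])
        show "(\<integral>\<^sup>+x. indicator U x \<partial>lborel) < \<infinity>" using Ufin by simp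
        show "AE x in lborel. (\<lambda>j. indicator U x * indicator (- U) (x + k j)) \<longlonglongrightarrow> (0::ennreal)"
        proof (rule AE_I2)
          fix x
          show "(\<lambda>j. indicator U x * indicator (- U) (x + k j)) \<longlonglongrightarrow> (0::ennreal)"
          proof (cases "x \<in> U")
            case True
            have "(\<lambda>j. x + k j) \<longlonglongrightarrow> x + 0" by (intro tendsto_intros k)
            then have "\<forall>\<^sub>F j in sequentially. x + k j \<in> U" using U True by (intro topological_tendstoD) auto
            then have "\<forall>\<^sub>F j in sequentially. indicator U x * indicator (- U) (x + k j) = (0::ennreal)"
              by eventually_elim simp
            then show ?thesis by (rule tendsto_eventually)
          qed simp
        qed
      qed (auto simp: indicator_def)
      then show ?thesis by simp
    qed
    have split: "powr_integral q (\<lambda>x. indicator U (x + h j) - indicator U x)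
        = (\<integral>\<^sup>+x. indicator U x * indicator (- U) (x + h j) \<partial>lborel) + (\<integral>\<^sup>+x. indicator U x * indicator (- U) (x + (- h j)) \<partial>lborel)" for j
    proof -
      have t: "(\<integral>\<^sup>+x. indicator U x * indicator (- U) (x + (- h j)) \<partial>lborel) = (\<integral>\<^sup>+x. indicator U (x + h j) * indicator (- U) x \<partial>lborel)"
        using nn_integral_lborel_translate[of "\<lambda>x. indicator U x * indicator (- U) (x + (- h j)) :: ennreal" "h j"] by simp
      show ?thesis
        unfolding powr_integral_def t
        by (subst nn_integral_add[symmetric]) (auto intro!: nn_integral_cong simp: indicator_def)
    qed
    have "(\<lambda>j. - h j) \<longlonglongrightarrow> 0" using tendsto_minus[OF h] by simp
    from tendsto_add[OF lim[OF h] lim[OF this]]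
    show "(\<lambda>j. powr_integral q (\<lambda>x. indicator U (x + h j) - indicator U x)) \<longlonglongrightarrow> 0"
      unfolding split by simp
  qed
  show ?thesis
  proof (rule translation_continuous_limit[OF q])
    fix e :: real assume e: "0 < e"
    have "A \<in> sets lebesgue" using A by auto
    then obtain U where U: "open U" "A \<subseteq> U" "emeasure lebesgue (U - A) < ennreal e"
      using sets_lebesgue_outer_open[OF _ e] by metis
    have Um[measurable]: "U \<in> sets borel" using U by simp
    have UA: "emeasure lborel (U - A) < ennreal e" using U(3) Um A by (simp add: emeasure_completion)
    have "emeasure lborel U = emeasure lborel A + emeasure lborel (U - A)"
      using U(2) by (subst plus_emeasure) (auto simp: Un_absorb1)
    also have "\<dots> < \<infinity>" using fin UA by (auto simp: ennreal_add_eq_top less_top[symmetric])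
    finally have "translation_continuous q (indicator U :: 'a \<Rightarrow> real)" using U(1) by (intro opn)
    moreover have "powr_integral q (\<lambda>x. indicator A x - indicator U x) = emeasure lborel (U - A)"
    proof -
      have "powr_integral q (\<lambda>x. indicator A x - indicator U x) = (\<integral>\<^sup>+x. indicator (U - A) x \<partial>lborel)"
        unfolding powr_integral_def using U(2) by (intro nn_integral_cong) (auto simp: indicator_def)
      then show ?thesis by simp
    qed
    ultimately show "\<exists>f'. translation_continuous q f' \<and> powr_integral q (\<lambda>x. indicator A x - f' x) \<le> ennreal e"
      using UA by (intro exI[of _ "indicator U"]) auto
  qed simp
qed

text \<open>
  The functions with this property are closed under linear combinations and under limits in
  \<open>L\<^sup>q\<close>. They contain the indicators of sets of finite measure, hence the simple functions in
  \<open>L\<^sup>q\<close>, which are dense.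
\<close>

theorem translation_continuous_Lq:
  fixes f :: "'a::euclidean_space \<Rightarrow> real"
  assumes q: "0 < q" and fm[measurable]: "f \<in> borel_measurable borel" and fin: "powr_integral q f < \<infinity>"
  shows "translation_continuous q f"
proof (rule translation_continuous_limit[OF q fm])
  fix e :: real assume e: "0 < e"
  obtain s where s: "\<And>i. simple_function lborel (s i)" "\<And>x. (\<lambda>i. s i x) \<longlonglongrightarrow> f x" "\<And>i x. \<bar>s i x\<bar> \<le> 2 * \<bar>f x\<bar>"
    using borel_measurable_implies_sequence_metric[of f lborel 0] by auto
  have sm[measurable]: "s i \<in> borel_measurable borel" for i
    using borel_measurable_simple_function[OF s(1)[of i]] by simp
  have "(\<lambda>i. \<integral>\<^sup>+x. ennreal (\<bar>f x - s i x\<bar> powr q) \<partial>lborel) \<longlonglongrightarrow> (\<integral>\<^sup>+x. 0 \<partial>(lborel :: 'a measure))"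
  proof (rule nn_integral_dominated_convergence[where w="\<lambda>x. ennreal (3 powr q) * ennreal (\<bar>f x\<bar> powr q)"])
    show "AE x in lborel. ennreal (\<bar>f x - s j x\<bar> powr q) \<le> ennreal (3 powr q) * ennreal (\<bar>f x\<bar> powr q)" for j
    proof (rule AE_I2)
      fix x
      have "\<bar>f x - s j x\<bar> \<le> 3 * \<bar>f x\<bar>" using s(3)[of j x] by linarith
      then have "\<bar>f x - s j x\<bar> powr q \<le> (3 * \<bar>f x\<bar>) powr q" using q by (intro powr_mono2) auto
      then show "ennreal (\<bar>f x - s j x\<bar> powr q) \<le> ennreal (3 powr q) * ennreal (\<bar>f x\<bar> powr q)"
        by (simp add: powr_mult ennreal_mult[symmetric] ennreal_leI)
    qed
    show "(\<integral>\<^sup>+x. ennreal (3 powr q) * ennreal (\<bar>f x\<bar> powr q) \<partial>lborel) < \<infinity>"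
      using fin by (subst nn_integral_cmult) (auto simp: powr_integral_def ennreal_mult_less_top)
    show "AE x in lborel. (\<lambda>i. ennreal (\<bar>f x - s i x\<bar> powr q)) \<longlonglongrightarrow> 0"
    proof (rule AE_I2)
      fix x
      have "(\<lambda>i. \<bar>f x - s i x\<bar> powr q) \<longlonglongrightarrow> \<bar>f x - f x\<bar> powr q"
        using q s(2)[of x] by (intro tendsto_powr' tendsto_intros) auto
      then show "(\<lambda>i. ennreal (\<bar>f x - s i x\<bar> powr q)) \<longlonglongrightarrow> 0"
        using q by (auto dest: tendsto_ennrealI)
    qed
  qed auto
  then have "(\<lambda>i. powr_integral q (\<lambda>x. f x - s i x)) \<longlonglongrightarrow> 0" by (simp add: powr_integral_def)
  from ennreal_tendsto_0D[OF this e] obtain i where i: "powr_integral q (\<lambda>x. f x - s i x) \<le> ennreal e"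
    by (auto simp: eventually_sequentially)
  have fr: "finite (range (s i))" using s(1)[of i] by (auto simp: simple_function_def)
  have tc0: "translation_continuous q (\<lambda>x::'a. 0)" by (auto simp: translation_continuous_def powr_integral_def)
  have piece: "translation_continuous q (\<lambda>x. y * indicator (s i -` {y}) x)" for y
  proof (cases "y = 0")
    case True
    then show ?thesis using tc0 by simp
  next
    case False
    have m[measurable]: "s i -` {y} \<in> sets borel" using measurable_sets[OF sm, of "{y}" i] by simp
    have c: "0 < \<bar>y\<bar> powr q" using False by simp
    have "ennreal (\<bar>y\<bar> powr q) * emeasure lborel (s i -` {y}) = (\<integral>\<^sup>+x. ennreal (\<bar>y\<bar> powr q) * indicator (s i -` {y}) x \<partial>lborel)"
      by (subst nn_integral_cmult) auto
    also have "\<dots> \<le> (\<integral>\<^sup>+x. ennreal (2 powr q) * ennreal (\<bar>f x\<bar> powr q) \<partial>lborel)"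
    proof (rule nn_integral_mono)
      fix x
      have "\<bar>s i x\<bar> powr q \<le> (2 * \<bar>f x\<bar>) powr q" using q s(3) by (intro powr_mono2) auto
      then show "ennreal (\<bar>y\<bar> powr q) * indicator (s i -` {y}) x \<le> ennreal (2 powr q) * ennreal (\<bar>f x\<bar> powr q)"
        by (auto simp: indicator_def powr_mult ennreal_mult[symmetric] ennreal_leI)
    qed
    also have "\<dots> < \<infinity>"
      using fin by (subst nn_integral_cmult) (auto simp: powr_integral_def ennreal_mult_less_top)
    finally have "emeasure lborel (s i -` {y}) < \<infinity>"
      using c by (auto simp: ennreal_mult_less_top)
    then show ?thesis by (intro translation_continuous_cmult translation_continuous_indicator q m)
  qed
  have "translation_continuous q (\<lambda>x. \<Sum>y\<in>Y. y * indicator (s i -` {y}) x)" if "finite Y" for Y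
    using that
  proof induction
    case (insert y Y)
    then show ?case using translation_continuous_add[OF q piece[of y] insert.IH] by (simp only: sum.insert[OF insert.hyps])
  qed (simp add: tc0)
  from this[OF fr] have "translation_continuous q (\<lambda>x. \<Sum>y\<in>range (s i). y * indicator (s i -` {y}) x)" .
  also have "(\<lambda>x. \<Sum>y\<in>range (s i). y * indicator (s i -` {y}) x) = s i"
  proof
    fix x
    have "(\<Sum>y\<in>range (s i). y * indicator (s i -` {y}) x) = (\<Sum>y\<in>range (s i). if y = s i x then s i x else 0)"
      by (intro sum.cong) (auto simp: indicator_def)
    then show "(\<Sum>y\<in>range (s i). y * indicator (s i -` {y}) x) = s i x" using fr by simp
  qed
  finally show "\<exists>f'. translation_continuous q f' \<and> powr_integral q (\<lambda>x. f x - f' x) \<le> ennreal e"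
    using i by blast
qed


section \<open>Difference quotients\<close>

text \<open>
  With \<open>m\<close> the integral of \<open>\<bar>F\<bar>\<close>, integrate Young's inequality for the product of \<open>\<bar>F t\<bar>\<close> and
  \<open>m powr (q - 1)\<close> over the unit interval, and cancel the
  common factor \<open>1 / q\<close>.
\<close>

lemma jensen_powr_unit_interval:
  fixes F :: "real \<Rightarrow> real"
  assumes q: "1 < q" and F: "integrable lborel (\<lambda>t. indicator {0..1} t * F t)"
  shows "ennreal (\<bar>\<integral>t. indicator {0..1} t * F t \<partial>lborel\<bar> powr q)
    \<le> (\<integral>\<^sup>+t. indicator {0..1} t * ennreal (\<bar>indicator {0..1} t * F t\<bar> powr q) \<partial>lborel)" (is "_ \<le> ?I")
proof (cases "?I < \<infinity>")
  case False
  then show ?thesis by (simp add: less_top[symmetric])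
next
  case fin: True
  let ?J = "indicator {0..1::real} :: real \<Rightarrow> real"
  let ?f = "\<lambda>t. ?J t * F t"
  have [measurable]: "?f \<in> borel_measurable borel" using borel_measurable_integrable[OF F] by simp
  define r where "r = q / (q - 1)"
  have r: "1 < r" "1 / q + 1 / r = 1" using q by (auto simp: r_def field_simps)
  define m where "m = (\<integral>t. \<bar>?f t\<bar> \<partial>lborel)"
  have m0: "0 \<le> m" by (simp add: m_def)
  have le_m: "\<bar>\<integral>t. ?f t \<partial>lborel\<bar> \<le> m" unfolding m_def using integral_abs_bound by blast
  have Iint: "integrable lborel (\<lambda>t. ?J t * (\<bar>?f t\<bar> powr q))"
  proof (rule integrableI_nonneg)
    have "(\<integral>\<^sup>+t. ennreal (?J t * (\<bar>?f t\<bar> powr q)) \<partial>lborel) = ?I"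
      by (intro nn_integral_cong) (auto simp: indicator_def)
    then show "(\<integral>\<^sup>+t. ennreal (?J t * (\<bar>?f t\<bar> powr q)) \<partial>lborel) < \<infinity>" using fin by simp
  qed auto
  have Ieq: "?I = ennreal (\<integral>t. ?J t * (\<bar>?f t\<bar> powr q) \<partial>lborel)"
    by (subst nn_integral_eq_integral[OF Iint, symmetric]) (auto intro!: nn_integral_cong simp: indicator_def)
  have "m powr q \<le> (\<integral>t. ?J t * (\<bar>?f t\<bar> powr q) \<partial>lborel)"
  proof (cases "m = 0")
    case True
    then show ?thesis using q by (auto intro!: integral_nonneg_AE)
  next
    case False
    then have m: "0 < m" using m0 by simp
    let ?c = "m powr (q - 1)"
    have cr: "?c powr r = m powr q" using q by (simp add: powr_powr r_def)
    have mc: "m * ?c = m powr q" using m by (simp add: powr_diff)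
    have pt: "\<bar>?f t\<bar> * ?c \<le> (1 / q) * (?J t * (\<bar>?f t\<bar> powr q)) + (m powr q / r) * ?J t" for t
    proof (cases "t \<in> {0..1}")
      case True
      then show ?thesis using Youngs_inequality[OF q r, of "\<bar>?f t\<bar>" ?c] by (simp add: cr)
    next
      case False
      then show ?thesis by (auto simp: indicator_def)
    qed
    have Fa: "integrable lborel (\<lambda>t. \<bar>?f t\<bar>)" using F by (rule integrable_abs)
    have Ji: "integrable lborel ?J" by simp
    have "m * ?c = (\<integral>t. \<bar>?f t\<bar> * ?c \<partial>lborel)" unfolding m_def by (rule integral_mult_left_zero[symmetric])
    also have "\<dots> \<le> (\<integral>t. (1 / q) * (?J t * (\<bar>?f t\<bar> powr q)) + (m powr q / r) * ?J t \<partial>lborel)"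
      using Fa Iint Ji pt
      by (intro integral_mono Bochner_Integration.integrable_add integrable_mult_right integrable_mult_left)
    also have "\<dots> = (1 / q) * (\<integral>t. ?J t * (\<bar>?f t\<bar> powr q) \<partial>lborel) + (m powr q / r)"
    proof -
      have "(\<integral>t. ?J t \<partial>lborel) = 1" by simp
      then show ?thesis using Iint Ji
        by (subst Bochner_Integration.integral_add) (auto simp del: integral_indicator)
    qed
    finally have "m powr q \<le> (1 / q) * (\<integral>t. ?J t * (\<bar>?f t\<bar> powr q) \<partial>lborel) + m powr q * (1 / r)"
      unfolding mc by simp
    also have "1 / r = 1 - 1 / q" using r by simp
    finally have "m powr q * (1 / q) \<le> (1 / q) * (\<integral>t. ?J t * (\<bar>?f t\<bar> powr q) \<partial>lborel)"
      by (simp add: right_diff_distrib)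
    then show ?thesis using q by (simp add: field_simps)
  qed
  then have "\<bar>\<integral>t. ?f t \<partial>lborel\<bar> powr q \<le> (\<integral>t. ?J t * (\<bar>?f t\<bar> powr q) \<partial>lborel)"
    using le_m q by (meson abs_ge_zero dual_order.trans less_imp_le order_less_trans powr_mono2 zero_less_one)
  then show ?thesis unfolding Ieq by (rule ennreal_leI)
qed

context
  fixes u :: "'a::euclidean_space \<Rightarrow> real" and \<gamma> :: "'a \<Rightarrow> real" and w :: 'a and q :: real
  assumes q: "1 < q" and um[measurable]: "u \<in> borel_measurable borel" and gm[measurable]: "\<gamma> \<in> borel_measurable borel"
    and line: "\<And>r. r \<noteq> 0 \<Longrightarrow> AE x in lborel. integrable lborel (\<lambda>t. indicator {0..1} t * \<gamma> (x + t *\<^sub>R (r *\<^sub>R w))) \<and>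
        u (x + r *\<^sub>R w) - u x = r * (\<integral>t. indicator {0..1} t * \<gamma> (x + t *\<^sub>R (r *\<^sub>R w)) \<partial>lborel)"
begin

text \<open>
  The difference quotient is an average of translates of \<open>\<gamma>\<close>, so this is Jensen's inequality
  followed by Fubini and translation invariance.
\<close>

lemma powr_integral_difference_quotient_le:
  assumes r: "0 < r"
  shows "powr_integral q (\<lambda>x. (u (x + r *\<^sub>R w) - u x) / r) \<le> powr_integral q \<gamma>"
proof -
  have "powr_integral q (\<lambda>x. (u (x + r *\<^sub>R w) - u x) / r)
      \<le> (\<integral>\<^sup>+x. \<integral>\<^sup>+t. indicator {0..1} t * ennreal (\<bar>\<gamma> (x + t *\<^sub>R (r *\<^sub>R w))\<bar> powr q) \<partial>lborel \<partial>lborel)"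
    unfolding powr_integral_def
  proof (rule nn_integral_mono_AE)
    show "AE x in lborel. ennreal (\<bar>(u (x + r *\<^sub>R w) - u x) / r\<bar> powr q) \<le>
        (\<integral>\<^sup>+t. indicator {0..1} t * ennreal (\<bar>\<gamma> (x + t *\<^sub>R (r *\<^sub>R w))\<bar> powr q) \<partial>lborel)"
      using line[OF less_imp_neq[OF r, symmetric]]
    proof eventually_elim
      case (elim x)
      have "(u (x + r *\<^sub>R w) - u x) / r = (\<integral>t. indicator {0..1} t * \<gamma> (x + t *\<^sub>R (r *\<^sub>R w)) \<partial>lborel)"
        using elim r by simp
      then have "ennreal (\<bar>(u (x + r *\<^sub>R w) - u x) / r\<bar> powr q) \<le>
          (\<integral>\<^sup>+t. indicator {0..1} t * ennreal (\<bar>indicator {0..1} t * \<gamma> (x + t *\<^sub>R (r *\<^sub>R w))\<bar> powr q) \<partial>lborel)"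
        using jensen_powr_unit_interval[OF q conjunct1[OF elim]] by (simp only:)
      also have "\<dots> = (\<integral>\<^sup>+t. indicator {0..1} t * ennreal (\<bar>\<gamma> (x + t *\<^sub>R (r *\<^sub>R w))\<bar> powr q) \<partial>lborel)"
        by (intro nn_integral_cong) (auto simp: indicator_def)
      finally show ?case .
    qed
  qed
  also have "\<dots> = (\<integral>\<^sup>+t. \<integral>\<^sup>+x. indicator {0..1} t * ennreal (\<bar>\<gamma> (x + t *\<^sub>R (r *\<^sub>R w))\<bar> powr q) \<partial>lborel \<partial>lborel)"
    by (rule lborel_pair.Fubini'[symmetric]) measurable
  also have "\<dots> = (\<integral>\<^sup>+t. indicator {0..1::real} t * powr_integral q (\<lambda>x. \<gamma> (x + t *\<^sub>R (r *\<^sub>R w))) \<partial>lborel)"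
    unfolding powr_integral_def by (intro nn_integral_cong nn_integral_cmult) measurable
  also have "\<dots> = (\<integral>\<^sup>+t. indicator {0..1::real} t * powr_integral q \<gamma> \<partial>lborel)"
    by (simp add: powr_integral_translate)
  also have "\<dots> = powr_integral q \<gamma>" by (subst nn_integral_multc) auto
  finally show ?thesis .
qed

text \<open>
  The error is an average of \<open>\<gamma> (x + t r w) - \<gamma> x\<close> over \<open>t\<close> in the unit interval. By Jensen's
  inequality its \<open>q\<close>-th power integral is at most an average of translation errors of \<open>\<gamma>\<close>, which
  tend to zero boundedly.
\<close>

lemma powr_integral_difference_quotient_tendsto:
  assumes fin: "powr_integral q \<gamma> < \<infinity>" and r: "r \<longlonglongrightarrow> 0" and rpos: "\<And>j. 0 < r j"
  shows "(\<lambda>j::nat. powr_integral q (\<lambda>x. (u (x + r j *\<^sub>R w) - u x) / r j - \<gamma> x)) \<longlonglongrightarrow> 0"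
proof -
  have q0: "0 < q" using q by simp
  define B where "B j t = powr_integral q (\<lambda>x. \<gamma> (x + t *\<^sub>R (r j *\<^sub>R w)) - \<gamma> x)" for j t
  have Bm[measurable]: "B j \<in> borel_measurable borel" for j
  proof -
    have "(\<lambda>(t, x). ennreal (\<bar>\<gamma> (x + t *\<^sub>R (r j *\<^sub>R w)) - \<gamma> x\<bar> powr q)) \<in> borel_measurable (lborel \<Otimes>\<^sub>M lborel)"
      by measurable
    from lborel.borel_measurable_nn_integral[OF this] show ?thesis by (simp add: B_def[abs_def] powr_integral_def)
  qed
  have "powr_integral q (\<lambda>x. (u (x + r j *\<^sub>R w) - u x) / r j - \<gamma> x) \<le> (\<integral>\<^sup>+t. indicator {0..1::real} t * B j t \<partial>lborel)" for j
  proof -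
    have "powr_integral q (\<lambda>x. (u (x + r j *\<^sub>R w) - u x) / r j - \<gamma> x)
      \<le> (\<integral>\<^sup>+x. \<integral>\<^sup>+t. indicator {0..1} t * ennreal (\<bar>\<gamma> (x + t *\<^sub>R (r j *\<^sub>R w)) - \<gamma> x\<bar> powr q) \<partial>lborel \<partial>lborel)"
      unfolding powr_integral_def
    proof (rule nn_integral_mono_AE)
      show "AE x in lborel. ennreal (\<bar>(u (x + r j *\<^sub>R w) - u x) / r j - \<gamma> x\<bar> powr q) \<le>
          (\<integral>\<^sup>+t. indicator {0..1} t * ennreal (\<bar>\<gamma> (x + t *\<^sub>R (r j *\<^sub>R w)) - \<gamma> x\<bar> powr q) \<partial>lborel)"
        using line[OF less_imp_neq[OF rpos[of j], symmetric]]
      proof eventually_elim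
        case (elim x)
        have c: "integrable lborel (\<lambda>t. indicator {0..1::real} t * \<gamma> x)" by simp
        have c1: "(\<integral>t. indicator {0..1::real} t * \<gamma> x \<partial>lborel) = \<gamma> x" by simp
        have i: "integrable lborel (\<lambda>t. indicator {0..1} t * (\<gamma> (x + t *\<^sub>R (r j *\<^sub>R w)) - \<gamma> x))"
          unfolding right_diff_distrib using elim c by (intro Bochner_Integration.integrable_diff) auto
        have "(u (x + r j *\<^sub>R w) - u x) / r j - \<gamma> x = (\<integral>t. indicator {0..1} t * (\<gamma> (x + t *\<^sub>R (r j *\<^sub>R w)) - \<gamma> x) \<partial>lborel)"
          unfolding right_diff_distrib using elim c rpos[of j]
          by (subst Bochner_Integration.integral_diff) (simp_all only: c1, auto)
        then have "ennreal (\<bar>(u (x + r j *\<^sub>R w) - u x) / r j - \<gamma> x\<bar> powr q) \<le>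
            (\<integral>\<^sup>+t. indicator {0..1} t * ennreal (\<bar>indicator {0..1} t * (\<gamma> (x + t *\<^sub>R (r j *\<^sub>R w)) - \<gamma> x)\<bar> powr q) \<partial>lborel)"
          using jensen_powr_unit_interval[OF q i] by (simp only:)
        also have "\<dots> = (\<integral>\<^sup>+t. indicator {0..1} t * ennreal (\<bar>\<gamma> (x + t *\<^sub>R (r j *\<^sub>R w)) - \<gamma> x\<bar> powr q) \<partial>lborel)"
          by (intro nn_integral_cong) (auto simp: indicator_def)
        finally show ?case .
      qed
    qed
    also have "\<dots> = (\<integral>\<^sup>+t. \<integral>\<^sup>+x. indicator {0..1} t * ennreal (\<bar>\<gamma> (x + t *\<^sub>R (r j *\<^sub>R w)) - \<gamma> x\<bar> powr q) \<partial>lborel \<partial>lborel)"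
      by (rule lborel_pair.Fubini'[symmetric]) measurable
    also have "\<dots> = (\<integral>\<^sup>+t. indicator {0..1::real} t * B j t \<partial>lborel)"
      unfolding B_def powr_integral_def by (intro nn_integral_cong nn_integral_cmult) measurable
    finally show ?thesis .
  qed
  note le = this
  have tc: "translation_continuous q \<gamma>" by (rule translation_continuous_Lq[OF q0 gm fin])
  have lim: "(\<lambda>j. \<integral>\<^sup>+t. indicator {0..1::real} t * B j t \<partial>lborel) \<longlonglongrightarrow> (\<integral>\<^sup>+t. 0 \<partial>(lborel :: real measure))"
  proof (rule nn_integral_dominated_convergence[where w="\<lambda>t. indicator {0..1} t * (ennreal (2 powr q) * (powr_integral q \<gamma> + powr_integral q \<gamma>))"])
    show "AE t in lborel. indicator {0..1::real} t * B j t \<le> indicator {0..1} t * (ennreal (2 powr q) * (powr_integral q \<gamma> + powr_integral q \<gamma>))" for j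
    proof (rule AE_I2, rule mult_left_mono)
      fix t
      have "B j t = powr_integral q (\<lambda>x. \<gamma> (x + t *\<^sub>R (r j *\<^sub>R w)) + - \<gamma> x)" by (simp add: B_def)
      also have "\<dots> \<le> ennreal (2 powr q) * (powr_integral q (\<lambda>x. \<gamma> (x + t *\<^sub>R (r j *\<^sub>R w))) + powr_integral q (\<lambda>x. - \<gamma> x))"
        by (intro powr_integral_add_le q0) measurable
      also have "powr_integral q (\<lambda>x. \<gamma> (x + t *\<^sub>R (r j *\<^sub>R w))) = powr_integral q \<gamma>" by (rule powr_integral_translate) measurable
      also have "powr_integral q (\<lambda>x. - \<gamma> x) = powr_integral q \<gamma>" by (simp add: powr_integral_def)
      finally show "B j t \<le> ennreal (2 powr q) * (powr_integral q \<gamma> + powr_integral q \<gamma>)" .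
    qed simp
    show "(\<integral>\<^sup>+t. indicator {0..1::real} t * (ennreal (2 powr q) * (powr_integral q \<gamma> + powr_integral q \<gamma>)) \<partial>lborel) < \<infinity>"
      using fin by (subst nn_integral_multc) (auto simp: ennreal_mult_less_top)
    show "AE t in lborel. (\<lambda>j. indicator {0..1::real} t * B j t) \<longlonglongrightarrow> 0"
    proof (rule AE_I2)
      fix t :: real
      have "(\<lambda>j. t *\<^sub>R (r j *\<^sub>R w)) \<longlonglongrightarrow> t *\<^sub>R (0 *\<^sub>R w)" by (intro tendsto_intros r)
      then have "(\<lambda>j. B j t) \<longlonglongrightarrow> 0" using tc by (auto simp: B_def translation_continuous_def)
      then have "(\<lambda>j. indicator {0..1::real} t * B j t) \<longlonglongrightarrow> indicator {0..1::real} t * 0"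
        by (intro ennreal_tendsto_cmult) (auto simp: indicator_def)
      then show "(\<lambda>j. indicator {0..1::real} t * B j t) \<longlonglongrightarrow> 0" by simp
    qed
  qed auto
  show ?thesis
    by (rule tendsto_sandwich[OF _ _ tendsto_const lim[simplified]]) (auto simp: le)
qed

end


section \<open>Borel representatives\<close>

lemma AE_lborel_dense:
  fixes P :: "'a::euclidean_space \<Rightarrow> bool"
  assumes "AE y in lborel. P y"
  obtains D where "countable D" "\<And>y. y \<in> D \<Longrightarrow> P y" "\<And>y e. 0 < e \<Longrightarrow> \<exists>d\<in>D. dist d y < e"
proof -
  obtain D0 :: "'a set" where D0: "countable D0" "\<And>X. open X \<Longrightarrow> X \<noteq> {} \<Longrightarrow> \<exists>d\<in>D0. d \<in> X"
    by (erule countable_dense_setE)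
  obtain N where N: "{y. \<not> P y} \<subseteq> N" "N \<in> null_sets lborel"
    using assms by (auto simp: eventually_ae_filter)
  have ex: "\<exists>y. P y \<and> dist y q < 1 / real (Suc m)" for q m
  proof (rule ccontr)
    assume "\<nexists>y. P y \<and> dist y q < 1 / real (Suc m)"
    then have "ball q (1 / real (Suc m)) \<subseteq> N" using N(1) by (auto simp: dist_commute)
    then have "emeasure lborel (ball q (1 / real (Suc m))) \<le> emeasure lborel N"
      using N(2) by (intro emeasure_mono) auto
    also have "\<dots> = 0" using N(2) by auto
    finally have "unit_ball_vol (real DIM('a)) * (1 / real (Suc m)) ^ DIM('a) \<le> 0"
      by (simp add: emeasure_ball ennreal_eq_0_iff)
    moreover have "0 < unit_ball_vol (real DIM('a)) * (1 / real (Suc m)) ^ DIM('a)"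
      by (intro mult_pos_pos zero_less_power unit_ball_vol_pos) auto
    ultimately show False by linarith
  qed
  then obtain f where f: "\<And>q m. P (f q m)" "\<And>q m. dist (f q m) q < 1 / real (Suc m)" by metis
  show ?thesis
  proof
    show "countable ((\<lambda>(q, m). f q m) ` (D0 \<times> UNIV))" using D0(1) by (intro countable_image countable_SIGMA) auto
    show "P y" if "y \<in> (\<lambda>(q, m). f q m) ` (D0 \<times> UNIV)" for y using that f(1) by auto
    fix y :: 'a and e :: real assume e: "0 < e"
    obtain m where m: "1 / real (Suc m) < e / 2" using nat_approx_posE[of "e/2"] e by auto
    obtain q where q: "q \<in> D0" "q \<in> ball y (e / 2)" using D0(2)[of "ball y (e/2)"] e by auto
    have "dist (f q m) y \<le> dist (f q m) q + dist q y" by (rule dist_triangle)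
    also have "\<dots> < e" using f(2)[of q m] m q(2) by (simp add: dist_commute)
    finally have "dist (f q m) y < e" .
    moreover have "f q m \<in> (\<lambda>(q, m). f q m) ` (D0 \<times> UNIV)"
      using q(1) by (intro image_eqI[of _ _ "(q, m)"]) auto
    ultimately show "\<exists>d\<in>(\<lambda>(q, m). f q m) ` (D0 \<times> UNIV). dist d y < e" by (rule bexI)
  qed
qed

text \<open>
  Lebesgue measurability on the product says nothing about the diagonal, where the limit
  evaluates \<open>p\<close> and \<open>a\<close>; together with continuity in the second variable it does. Take a Borel
  function that agrees with \<open>f\<close> almost everywhere, and a countable dense set \<open>D\<close> of points \<open>d\<close>
  such that the two functions agree at \<open>(x, d)\<close> for almost every \<open>x\<close>. Outside one null set \<open>N\<close>
  of points \<open>x\<close>, the values of \<open>f x\<close> on \<open>D\<close> are then given by Borel functions of \<open>x\<close>, and they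
  determine \<open>f x\<close> by continuity. Replacing \<open>f x\<close> by a constant for \<open>x\<close> in \<open>N\<close> keeps the
  continuity for every \<open>x\<close>.
\<close>

lemma caratheodory_function_borel:
  fixes f :: "'a::euclidean_space \<Rightarrow> 'a \<Rightarrow> real"
  assumes f: "(\<lambda>(x, y). f x y) \<in> borel_measurable lebesgue" and cont: "\<And>x. continuous_on UNIV (f x)"
  obtains N where "N \<in> null_sets lborel"
    and "(\<lambda>(x, y). if x \<in> N then c else f x y) \<in> borel_measurable (borel \<Otimes>\<^sub>M borel)"
proof -
  obtain f2 where f2m: "f2 \<in> borel_measurable lborel" and f2: "AE z in lborel. (case z of (x, y) \<Rightarrow> f x y) = f2 z"
    using completion_ex_borel_measurable_real[OF f] by blast
  have f2m'[measurable]: "f2 \<in> borel_measurable (borel \<Otimes>\<^sub>M borel)" using f2m by (simp add: borel_prod)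
  obtain N2 where N2: "{z. \<not> (case z of (x, y) \<Rightarrow> f x y) = f2 z} \<subseteq> N2" "N2 \<in> null_sets (lborel :: ('a \<times> 'a) measure)"
    using f2 by (auto simp: eventually_ae_filter)
  have N2m[measurable]: "N2 \<in> sets (lborel \<Otimes>\<^sub>M lborel)"
    unfolding lborel_prod by (rule null_setsD2[OF N2(2)])
  have "AE z in lborel \<Otimes>\<^sub>M lborel. z \<notin> N2" unfolding lborel_prod by (rule AE_not_in[OF N2(2)])
  then have "AE x in lborel. AE y in lborel. (x, y) \<notin> N2" by (rule lborel_pair.AE_pair)
  then have "AE y in lborel. AE x in lborel. (x, y) \<notin> N2"
  proof (rule lborel_pair.AE_commute[THEN iffD1, rotated])
    have "{z \<in> space (lborel \<Otimes>\<^sub>M lborel). (fst z, snd z) \<notin> N2} = space (lborel \<Otimes>\<^sub>M lborel) - N2" by auto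
    then show "{z \<in> space (lborel \<Otimes>\<^sub>M lborel). (fst z, snd z) \<notin> N2} \<in> sets (lborel \<Otimes>\<^sub>M lborel)"
      using sets.compl_sets[OF N2m] by (simp only:)
  qed
  then have good: "AE y in lborel. AE x in lborel. f x y = f2 (x, y)"
  proof eventually_elim
    case (elim y)
    then show ?case
    proof eventually_elim
      case (elim x)
      have "(x, y) \<in> {z. \<not> (case z of (x, y) \<Rightarrow> f x y) = f2 z} \<Longrightarrow> (x, y) \<in> N2" by (rule subsetD[OF N2(1)])
      then show ?case using elim by auto
    qed
  qed
  obtain D where D: "countable D" "\<And>y. y \<in> D \<Longrightarrow> AE x in lborel. f x y = f2 (x, y)"
    "\<And>y e. 0 < e \<Longrightarrow> \<exists>d\<in>D. dist d y < e"
    using AE_lborel_dense[OF good] by metis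
  have Dne: "D \<noteq> {}" using D(3)[of 1 0] by auto
  have "AE x in lborel. \<forall>d\<in>D. f x d = f2 (x, d)" using D(1,2) by (simp add: AE_ball_countable)
  then obtain N where N: "{x. \<not> (\<forall>d\<in>D. f x d = f2 (x, d))} \<subseteq> N" "N \<in> null_sets lborel"
    by (auto simp: eventually_ae_filter)
  have Nm[measurable]: "N \<in> sets borel" using N(2) by auto
  define e where "e = from_nat_into D"
  have eD: "e i \<in> D" for i using from_nat_into[OF Dne] by (simp add: e_def)
  (* the first point of the enumeration of D that is close to y; it depends measurably on y *)
  define k where "k m y = (LEAST i. dist (e i) y < 1 / real (Suc m))" for m y
  have kprop: "dist (e (k m y)) y < 1 / real (Suc m)" for m y
  proof -
    obtain d where "d \<in> D" "dist d y < 1 / real (Suc m)" using D(3)[of "1 / real (Suc m)" y] by auto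
    then obtain i where "dist (e i) y < 1 / real (Suc m)"
      using from_nat_into_surj[OF D(1)] by (metis e_def)
    then show ?thesis unfolding k_def by (rule LeastI)
  qed
  have km[measurable]: "k m \<in> borel \<rightarrow>\<^sub>M count_space UNIV" for m
    unfolding k_def by (rule measurable_Least) measurable
  define F where "F i z = (if fst z \<in> N then c else f2 (fst z, e i))" for i and z :: "'a \<times> 'a"
  have Fm[measurable]: "F i \<in> borel_measurable (borel \<Otimes>\<^sub>M borel)" for i unfolding F_def by measurable
  have Fk: "(\<lambda>z. F (k m (snd z)) z) \<in> borel_measurable (borel \<Otimes>\<^sub>M borel)" for m
    by (rule measurable_compose_countable[OF Fm]) measurable
  have "(\<lambda>(x, y). if x \<in> N then c else f x y) \<in> borel_measurable (borel \<Otimes>\<^sub>M borel)"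
  proof (rule borel_measurable_LIMSEQ_real[OF _ Fk])
    fix z :: "'a \<times> 'a"
    obtain x y where z: "z = (x, y)" by (cases z)
    show "(\<lambda>m. F (k m (snd z)) z) \<longlonglongrightarrow> (case z of (x, y) \<Rightarrow> if x \<in> N then c else f x y)"
    proof (cases "x \<in> N")
      case True
      then show ?thesis by (simp add: F_def z)
    next
      case False
      have eq: "f x d = f2 (x, d)" if "d \<in> D" for d
        using subsetD[OF N(1), of x] False that by blast
      have "F (k m y) z = f x (e (k m y))" for m using False eq[OF eD] by (simp add: F_def z)
      moreover have "(\<lambda>m. e (k m y)) \<longlonglongrightarrow> y"
      proof (rule metric_LIMSEQ_I)
        fix r :: real assume "0 < r"
        then obtain M where M: "1 / real (Suc M) < r" using nat_approx_posE by metis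
        have "dist (e (k m y)) y < r" if "M \<le> m" for m
        proof -
          have "1 / real (Suc m) \<le> 1 / real (Suc M)" using that by (intro divide_left_mono) auto
          then show ?thesis using kprop[of m y] M by linarith
        qed
        then show "\<exists>no. \<forall>n\<ge>no. dist (e (k n y)) y < r" by blast
      qed
      then have "(\<lambda>m. f x (e (k m y))) \<longlonglongrightarrow> f x y"
        using continuous_on_tendsto_compose[OF cont[of x]] by fastforce
      ultimately show ?thesis using False by (simp add: z)
    qed
  qed
  then show ?thesis using that N(2) by blast
qed

lemma locally_integrable_measurable:
  fixes f :: "'a::euclidean_space \<Rightarrow> 'b::euclidean_space"
  assumes "locally_integrable f"
  shows "f \<in> borel_measurable lebesgue"
proof (rule borel_measurable_LIMSEQ_metric)
  show "(\<lambda>x. indicator (cball 0 (real m)) x *\<^sub>R f x) \<in> borel_measurable lebesgue" for m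
    using assms unfolding locally_integrable_def set_integrable_def by (intro borel_measurable_integrable) auto
  fix x :: 'a
  obtain M where M: "norm x \<le> real M" using real_arch_simple by blast
  have "\<forall>\<^sub>F m in sequentially. indicator (cball 0 (real m)) x *\<^sub>R f x = f x"
    using M by (intro eventually_sequentiallyI[of M]) (auto simp: indicator_def)
  then show "(\<lambda>m. indicator (cball 0 (real m)) x *\<^sub>R f x) \<longlonglongrightarrow> f x" by (rule tendsto_eventually)
qed

text \<open>
  Borel representatives make Fubini's theorem available on products of the Borel Lebesgue measure,
  without further null sets.
\<close>

lemma weak_gradient_borel:
  fixes u :: "real ^ 'n::finite \<Rightarrow> real" and g :: "real ^ 'n \<Rightarrow> real ^ 'n"
  assumes w: "is_weak_gradient u g"
  shows "\<exists>u' g'. loc_integrable u' \<and> (\<forall>i. loc_integrable (\<lambda>x. g' x $ i)) \<and> g' \<in> borel_measurable borel \<and>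
    (AE x in lborel. u x = u' x) \<and> (AE x in lborel. g x = g' x) \<and>
    (\<forall>\<phi> i. test_function \<phi> \<longrightarrow>
      (\<integral>x. u' x * partial_deriv i \<phi> x \<partial>lborel) = - (\<integral>x. g' x $ i * \<phi> x \<partial>lborel))"
proof -
  have lu: "locally_integrable u" and lg: "locally_integrable g" using w by (auto simp: is_weak_gradient_def)
  have um: "u \<in> borel_measurable lebesgue" and gm: "g \<in> borel_measurable lebesgue"
    using lu lg by (auto intro: locally_integrable_measurable)
  have gim: "(\<lambda>x. g x $ i) \<in> borel_measurable lebesgue" for i
    by (rule measurable_compose[OF gm]) simp
  obtain u' where u': "u' \<in> borel_measurable lborel" "AE x in lborel. u x = u' x"
    using completion_ex_borel_measurable_real[OF um] by blast
  have "\<forall>i. \<exists>f. f \<in> borel_measurable lborel \<and> (AE x in lborel. g x $ i = f x)"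
    using completion_ex_borel_measurable_real[OF gim] by blast
  then obtain G where G: "\<And>i. G i \<in> borel_measurable lborel" "\<And>i. AE x in lborel. g x $ i = G i x" by metis
  define g' where "g' x = (\<chi> i. G i x)" for x
  have g'i: "g' x $ i = G i x" for x i by (simp add: g'_def)
  have "AE x in lborel. \<forall>i\<in>(UNIV :: 'n set). g x $ i = G i x"
    by (subst AE_finite_all) (simp_all only: finite G(2) ball_UNIV simp_thms)
  then have gg': "AE x in lborel. g x = g' x"
    by eventually_elim (simp add: vec_eq_iff g'i)
  have g'm: "g' \<in> borel_measurable borel"
  proof (rule borel_measurable_euclidean_space[THEN iffD2], rule ballI)
    fix b :: "real ^ 'n" assume "b \<in> Basis"
    then obtain i where "b = axis i 1" by (auto simp: Basis_vec_def)
    then show "(\<lambda>x. g' x \<bullet> b) \<in> borel_measurable borel" using G(1)[of i] by (simp add: inner_axis g'i)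
  qed
  have li: "loc_integrable f'"
    if f': "f' \<in> borel_measurable lborel" "AE x in lborel. f x = f' x" and lf: "\<And>K. compact K \<Longrightarrow> set_integrable lebesgue K f" for f f' :: "real ^ 'n \<Rightarrow> real"
    unfolding loc_integrable_def
  proof (intro conjI allI)
    show fm[measurable]: "f' \<in> borel_measurable borel" using f'(1) by simp
    fix R
    have "integrable lebesgue (\<lambda>x. indicator (cball 0 R) x *\<^sub>R f x)"
      using lf[of "cball 0 R"] by (simp add: set_integrable_def)
    then have "integrable lebesgue (\<lambda>x. indicator (cball 0 R) x * f' x)"
    proof (rule integrable_cong_AE_imp)
      show "(\<lambda>x. indicator (cball 0 R) x * f' x) \<in> borel_measurable lebesgue"
        by (rule measurable_completion) (auto intro!: borel_measurable_times borel_measurable_indicator)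
      show "AE x in lebesgue. indicator (cball 0 R) x *\<^sub>R f x = indicator (cball 0 R) x * f' x"
        using AE_completion[OF f'(2)] by eventually_elim simp
    qed
    then show "integrable lborel (\<lambda>x. indicator (cball 0 R) x * f' x)"
      by (subst (asm) integrable_completion) (auto intro!: borel_measurable_times borel_measurable_indicator)
  qed
  have lu': "loc_integrable u'" using lu by (intro li[OF u']) (auto simp: locally_integrable_def)
  have lg': "loc_integrable (\<lambda>x. g' x $ i)" for i
    unfolding g'i
  proof (rule li[OF G])
    fix K :: "(real ^ 'n) set" assume "compact K"
    then have "integrable lebesgue (\<lambda>x. indicator K x *\<^sub>R g x)" using lg by (simp add: locally_integrable_def set_integrable_def)
    from integrable_bounded_linear[OF bounded_linear_vec_nth this, of i]
    show "set_integrable lebesgue K (\<lambda>x. g x $ i)" by (simp add: set_integrable_def)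
  qed
  have weak: "(\<integral>x. u' x * partial_deriv i \<phi> x \<partial>lborel) = - (\<integral>x. g' x $ i * \<phi> x \<partial>lborel)"
    if \<phi>: "test_function \<phi>" for \<phi> i
  proof -
    have \<phi>m: "\<phi> \<in> borel_measurable borel" and dm: "partial_deriv i \<phi> \<in> borel_measurable borel"
      using test_functionD[OF \<phi>] by (auto intro: borel_measurable_continuous_onI)
    have tr: "(\<integral>x. f' x * \<psi> x \<partial>lborel) = (\<integral>x. f x * \<psi> x \<partial>lebesgue)"
      if [measurable]: "f' \<in> borel_measurable borel" "\<psi> \<in> borel_measurable borel" and fl: "f \<in> borel_measurable lebesgue" and e: "AE x in lborel. f x = f' x" for f f' \<psi> :: "real ^ 'n \<Rightarrow> real"
    proof -
      have "(\<integral>x. f x * \<psi> x \<partial>lebesgue) = (\<integral>x. f' x * \<psi> x \<partial>lebesgue)"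
      proof (rule integral_cong_AE)
        show "(\<lambda>x. f x * \<psi> x) \<in> borel_measurable lebesgue"
          by (rule borel_measurable_times[OF fl measurable_completion]) simp
        show "(\<lambda>x. f' x * \<psi> x) \<in> borel_measurable lebesgue"
          by (rule measurable_completion) simp
        show "AE x in lebesgue. f x * \<psi> x = f' x * \<psi> x"
          using AE_completion[OF e] by eventually_elim simp
      qed
      also have "\<dots> = (\<integral>x. f' x * \<psi> x \<partial>lborel)" by (rule integral_completion) simp
      finally show ?thesis by simp
    qed
    have "(\<integral>x. u x * partial_deriv i \<phi> x \<partial>lebesgue) = - (\<integral>x. g x $ i * \<phi> x \<partial>lebesgue)"
      using w \<phi> by (simp add: is_weak_gradient_def)
    then show ?thesis
      using tr[of u' "partial_deriv i \<phi>" u] tr[of "\<lambda>x. g' x $ i" \<phi> "\<lambda>x. g x $ i"] u' G dm \<phi>m um gim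
      by (simp add: g'i)
  qed
  show ?thesis using lu' lg' g'm u'(2) gg' weak by blast
qed

lemma test_function_bounded:
  assumes \<phi>: "test_function \<phi>"
  shows "\<exists>R C. (\<forall>x. \<bar>\<phi> x\<bar> \<le> C) \<and> (\<forall>x. R < norm x \<longrightarrow> \<phi> x = 0)"
proof -
  obtain K where K: "compact K" "\<And>x. x \<notin> K \<Longrightarrow> \<phi> x = 0"
    using test_function_support[OF \<phi>] by metis
  obtain R where R: "\<And>x. x \<in> K \<Longrightarrow> norm x \<le> R" using compact_imp_bounded[OF K(1)] by (auto simp: bounded_iff)
  obtain C where "\<And>x. \<bar>\<phi> x\<bar> \<le> C"
    using compact_support_bounded[OF K(1) test_functionD(2)[OF \<phi>]] K(2) by blast
  moreover have "\<phi> x = 0" if "R < norm x" for x using that R[of x] by (intro K(2)) auto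
  ultimately show ?thesis by blast
qed

lemma weak_gradient_unique:
  fixes u :: "real ^ 'n::finite \<Rightarrow> real"
  assumes "is_weak_gradient u g" "is_weak_gradient u h"
  shows "AE x in lborel. g x = h x"
proof -
  obtain u1 g1 where 1: "loc_integrable u1" "\<And>i. loc_integrable (\<lambda>x. g1 x $ i)"
    "g1 \<in> borel_measurable borel"
    "AE x in lborel. u x = u1 x" "AE x in lborel. g x = g1 x"
    "\<And>\<phi> i. test_function \<phi> \<Longrightarrow> (\<integral>x. u1 x * partial_deriv i \<phi> x \<partial>lborel) = - (\<integral>x. g1 x $ i * \<phi> x \<partial>lborel)"
    using weak_gradient_borel[OF assms(1)] by blast
  obtain u2 h2 where 2: "loc_integrable u2" "\<And>i. loc_integrable (\<lambda>x. h2 x $ i)"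
    "h2 \<in> borel_measurable borel"
    "AE x in lborel. u x = u2 x" "AE x in lborel. h x = h2 x"
    "\<And>\<phi> i. test_function \<phi> \<Longrightarrow> (\<integral>x. u2 x * partial_deriv i \<phi> x \<partial>lborel) = - (\<integral>x. h2 x $ i * \<phi> x \<partial>lborel)"
    using weak_gradient_borel[OF assms(2)] by blast
  have m: "u1 \<in> borel_measurable borel" "u2 \<in> borel_measurable borel"
    using 1 2 by (auto intro: loc_integrable_measurable)
  have "AE x in lborel. g1 x $ i - h2 x $ i = 0" for i
  proof (rule fundamental_lemma_calculus_of_variations)
    show "loc_integrable (\<lambda>x. g1 x $ i - h2 x $ i)"
      using 1(2)[of i] 2(2)[of i] unfolding loc_integrable_def
      by (auto simp: right_diff_distrib intro!: Bochner_Integration.integrable_diff borel_measurable_diff)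
    fix \<phi> :: "real ^ 'n \<Rightarrow> real" assume \<phi>: "test_function \<phi>"
    have \<phi>m: "\<phi> \<in> borel_measurable borel" and dm: "partial_deriv i \<phi> \<in> borel_measurable borel"
      using test_functionD[OF \<phi>] by (auto intro: borel_measurable_continuous_onI)
    obtain R C where RC: "\<And>x. \<bar>\<phi> x\<bar> \<le> C" "\<And>x. R < norm x \<Longrightarrow> \<phi> x = 0"
      using test_function_bounded[OF \<phi>] by metis
    have "(\<integral>x. u1 x * partial_deriv i \<phi> x \<partial>lborel) = (\<integral>x. u2 x * partial_deriv i \<phi> x \<partial>lborel)"
    proof (rule integral_cong_AE)
      show "AE x in lborel. u1 x * partial_deriv i \<phi> x = u2 x * partial_deriv i \<phi> x"
        using 1(4) 2(4) by eventually_elim simp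
    qed (use m dm in auto)
    then have "(\<integral>x. g1 x $ i * \<phi> x \<partial>lborel) = (\<integral>x. h2 x $ i * \<phi> x \<partial>lborel)"
      using 1(6)[OF \<phi>, of i] 2(6)[OF \<phi>, of i] by simp
    then show "(\<integral>x. (g1 x $ i - h2 x $ i) * \<phi> x \<partial>lborel) = 0"
      using loc_integrable_mult_bounded[OF 1(2)[of i] \<phi>m RC] loc_integrable_mult_bounded[OF 2(2)[of i] \<phi>m RC]
      by (simp add: left_diff_distrib)
  qed
  then have "AE x in lborel. \<forall>i\<in>(UNIV :: 'n set). g1 x $ i - h2 x $ i = 0"
    by (subst AE_finite_all) (simp_all only: finite ball_UNIV simp_thms)
  then show ?thesis using 1(5) 2(5)
    by eventually_elim (simp add: vec_eq_iff)
qed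


section \<open>The modular of a difference quotient\<close>

text \<open>
  If \<open>y\<close> is at most \<open>\<eta> x\<close>, the sum is at most \<open>(1 + \<eta>) x\<close>, and otherwise it is at most
  \<open>(1 + 1 / \<eta>) y\<close>. The number \<open>\<eta>\<close> is chosen with \<open>(1 + \<eta>) powr P = 1 + \<epsilon>\<close>. That \<open>C\<close> does not
  depend on the exponent is what makes the estimate useful for variable exponents.
\<close>

lemma powr_add_le_eps:
  fixes P \<epsilon> :: real
  assumes P: "0 < P" and \<epsilon>: "0 < \<epsilon>"
  obtains C where "0 \<le> C"
    "\<And>x y p. 0 \<le> x \<Longrightarrow> 0 \<le> y \<Longrightarrow> 0 < p \<Longrightarrow> p \<le> P \<Longrightarrow> (x + y) powr p \<le> (1 + \<epsilon>) * x powr p + C * y powr p"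
proof
  define \<eta> where "\<eta> = (1 + \<epsilon>) powr (1 / P) - 1"
  have "1 < (1 + \<epsilon>) powr (1 / P)" using P \<epsilon> by (intro gr_one_powr) auto
  then have \<eta>: "0 < \<eta>" by (simp add: \<eta>_def)
  have \<eta>P: "(1 + \<eta>) powr P = 1 + \<epsilon>" using P \<epsilon> by (simp add: \<eta>_def powr_powr)
  show "0 \<le> (1 + 1 / \<eta>) powr P" by simp
  fix x y p :: real assume x: "0 \<le> x" and y: "0 \<le> y" and p: "0 < p" "p \<le> P"
  show "(x + y) powr p \<le> (1 + \<epsilon>) * x powr p + (1 + 1 / \<eta>) powr P * y powr p"
  proof (cases "y \<le> \<eta> * x")
    case True
    have "(x + y) powr p \<le> ((1 + \<eta>) * x) powr p" using True x y p by (intro powr_mono2) (auto simp: algebra_simps)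
    also have "\<dots> = (1 + \<eta>) powr p * x powr p" using x \<eta> by (simp add: powr_mult)
    also have "\<dots> \<le> (1 + \<eta>) powr P * x powr p" using p \<eta> by (intro mult_right_mono powr_mono) auto
    also have "\<dots> \<le> (1 + \<epsilon>) * x powr p + (1 + 1 / \<eta>) powr P * y powr p" by (simp add: \<eta>P)
    finally show ?thesis .
  next
    case False
    then have "x \<le> y / \<eta>" using \<eta> by (simp add: field_simps)
    then have "(x + y) powr p \<le> ((1 + 1 / \<eta>) * y) powr p" using x y p by (intro powr_mono2) (auto simp: algebra_simps)
    also have "\<dots> = (1 + 1 / \<eta>) powr p * y powr p" using y \<eta> by (simp add: powr_mult)
    also have "\<dots> \<le> (1 + 1 / \<eta>) powr P * y powr p" using p \<eta> by (intro mult_right_mono powr_mono) auto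
    also have "\<dots> \<le> (1 + \<epsilon>) * x powr p + (1 + 1 / \<eta>) powr P * y powr p" using \<epsilon> by simp
    finally show ?thesis .
  qed
qed

text \<open>
  This reduces every upper bound for the variable exponent to the two constant exponents at the
  ends of its range.
\<close>

lemma powr_between:
  fixes t :: real
  assumes "0 \<le> t" "a \<le> p" "p \<le> b"
  shows "t powr p \<le> t powr a + t powr b"
proof (cases "t \<le> 1")
  case True
  then have "t powr p \<le> t powr a" using assms by (intro powr_mono') auto
  then show ?thesis by (simp add: add_increasing2)
next
  case False
  then have "t powr p \<le> t powr b" using assms by (intro powr_mono) auto
  then show ?thesis by (simp add: add_increasing)
qed

text \<open>
  The two inequalities say that \<open>X j\<close> and \<open>Y j\<close> agree up to a factor close to \<open>1\<close> and an error
  that vanishes in the limit.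
\<close>

lemma ennreal_squeeze_eps:
  fixes X Y Z :: "nat \<Rightarrow> ennreal"
  assumes Y: "Y \<longlonglongrightarrow> L" and L: "L < \<infinity>" and Z: "Z \<longlonglongrightarrow> 0"
    and eps: "\<And>\<epsilon>. 0 < \<epsilon> \<Longrightarrow> \<exists>C. \<forall>j. X j \<le> ennreal (1 + \<epsilon>) * Y j + ennreal C * Z j \<and>
        Y j \<le> ennreal (1 + \<epsilon>) * X j + ennreal C * Z j"
  shows "X \<longlonglongrightarrow> L"
proof (rule order_tendstoI)
  obtain l where l: "L = ennreal l" "0 \<le> l" using L by (cases L) auto
  fix a assume a: "L < a"
  obtain \<epsilon> where \<epsilon>: "0 < \<epsilon>" "ennreal (1 + \<epsilon>) * L < a"
  proof (cases a)
    case (real r)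
    then have r: "l < r" using a l by (simp add: ennreal_less_iff)
    define \<epsilon> where "\<epsilon> = (r - l) / (2 * (l + 1))"
    have \<epsilon>: "0 < \<epsilon>" using r l by (simp add: \<epsilon>_def)
    have "(r - l) / (2 * d) * d = (r - l) / 2" if "0 < d" for d :: real using that by simp
    from this[of "l + 1"] have "\<epsilon> * (l + 1) = (r - l) / 2" using l by (simp only: \<epsilon>_def)
    then have "(1 + \<epsilon>) * l < r" using r \<epsilon> by (simp add: algebra_simps)
    then have "ennreal (1 + \<epsilon>) * L < a" using \<epsilon> l real by (simp add: ennreal_mult[symmetric] ennreal_less_iff del: ennreal_plus)
    then show ?thesis using \<epsilon> that by blast
  next
    case top
    then show ?thesis using that[of 1] L by (simp add: ennreal_mult_less_top)
  qed
  obtain C where C: "\<And>j. X j \<le> ennreal (1 + \<epsilon>) * Y j + ennreal C * Z j" using eps[OF \<epsilon>(1)] by blast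
  have "(\<lambda>j. ennreal (1 + \<epsilon>) * Y j + ennreal C * Z j) \<longlonglongrightarrow> ennreal (1 + \<epsilon>) * L + ennreal C * 0"
    by (intro tendsto_add ennreal_tendsto_cmult Y Z) auto
  then have "\<forall>\<^sub>F j in sequentially. ennreal (1 + \<epsilon>) * Y j + ennreal C * Z j < a"
    using \<epsilon>(2) by (intro order_tendstoD(2)) auto
  then show "\<forall>\<^sub>F j in sequentially. X j < a" by eventually_elim (rule le_less_trans[OF C])
next
  obtain l where l: "L = ennreal l" "0 \<le> l" using L by (cases L) auto
  fix a assume a: "a < L"
  then have "a < \<infinity>" using L by (simp add: order.strict_trans)
  then obtain r where r: "a = ennreal r" "0 \<le> r" by (cases a) auto
  have rl: "r < l" using a l r by (simp add: ennreal_less_iff)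
  define \<epsilon> where "\<epsilon> = (l - r) / (2 * (r + 1))"
  have \<epsilon>: "0 < \<epsilon>" using r rl by (simp add: \<epsilon>_def)
  have "(l - r) / (2 * d) * d = (l - r) / 2" if "0 < d" for d :: real using that by simp
  from this[of "r + 1"] have "\<epsilon> * (r + 1) = (l - r) / 2" using r by (simp only: \<epsilon>_def)
  then have m: "(1 + \<epsilon>) * r < l" using rl \<epsilon> by (simp add: algebra_simps)
  obtain C where C: "\<And>j. Y j \<le> ennreal (1 + \<epsilon>) * X j + ennreal C * Z j" using eps[OF \<epsilon>] by blast
  obtain b where b: "(1 + \<epsilon>) * r < b" "b < l" using m dense by blast
  have "(\<lambda>j. ennreal (1 + \<epsilon>) * a + ennreal C * Z j) \<longlonglongrightarrow> ennreal (1 + \<epsilon>) * a + ennreal C * 0"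
    by (intro tendsto_add ennreal_tendsto_cmult tendsto_const Z) auto
  moreover have "ennreal (1 + \<epsilon>) * a + ennreal C * 0 < ennreal b"
    using b \<epsilon> r by (simp add: ennreal_mult[symmetric] ennreal_less_iff del: ennreal_plus)
  ultimately have 1: "\<forall>\<^sub>F j in sequentially. ennreal (1 + \<epsilon>) * a + ennreal C * Z j < ennreal b"
    by (intro order_tendstoD(2))
  have b0: "0 \<le> b" using b(1) \<epsilon> r by (smt (verit) mult_nonneg_nonneg)
  have 2: "\<forall>\<^sub>F j in sequentially. ennreal b < Y j"
    using b(2) b0 l by (intro order_tendstoD(1)[OF Y]) (auto simp: ennreal_less_iff)
  show "\<forall>\<^sub>F j in sequentially. a < X j"
    using 1 2
  proof eventually_elim
    case (elim j)
    show ?case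
    proof (rule ccontr)
      assume "\<not> a < X j"
      then have "ennreal (1 + \<epsilon>) * X j + ennreal C * Z j \<le> ennreal (1 + \<epsilon>) * a + ennreal C * Z j"
        by (intro add_right_mono mult_left_mono) auto
      then have "Y j < ennreal b" using C[of j] elim by (meson le_less_trans order_trans)
      then show False using elim by simp
    qed
  qed
qed

lemma nn_integral_lborel_scale_real:
  fixes F :: "real \<Rightarrow> ennreal"
  assumes [measurable]: "F \<in> borel_measurable borel" and c: "0 < c"
  shows "ennreal c * (\<integral>\<^sup>+t. F t \<partial>lborel) = (\<integral>\<^sup>+t. F (t / c) \<partial>lborel)"
proof -
  have "(\<integral>\<^sup>+t. F (t / c) \<partial>lborel) = \<bar>c\<bar> * (\<integral>\<^sup>+t. F ((0 + c * t) / c) \<partial>lborel)"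
    using c by (intro nn_integral_real_affine) auto
  then show ?thesis using c by simp
qed

text \<open>
  The data after the passage to Borel representatives. The last assumption is the form in which
  \<open>g\<close> enters as the gradient of \<open>u\<close>.
\<close>

locale nonlocal_energy =
  fixes p a :: "real ^ 'n::finite \<Rightarrow> real ^ 'n \<Rightarrow> real" and p_minus p_plus a_plus :: real
    and u :: "real ^ 'n \<Rightarrow> real" and g :: "real ^ 'n \<Rightarrow> real ^ 'n"
  assumes p_borel: "(\<lambda>(x, y). p x y) \<in> borel_measurable (borel \<Otimes>\<^sub>M borel)"
    and a_borel: "(\<lambda>(x, y). a x y) \<in> borel_measurable (borel \<Otimes>\<^sub>M borel)"
    and pc: "\<And>x. continuous_on UNIV (p x)" and ac: "\<And>x. continuous_on UNIV (a x)"
    and p1: "1 < p_minus" and pb: "\<And>x y. p_minus \<le> p x y \<and> p x y \<le> p_plus"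
    and ab: "\<And>x y. 0 < a x y \<and> a x y \<le> a_plus"
    and um[measurable]: "u \<in> borel_measurable borel" and gm[measurable]: "g \<in> borel_measurable borel"
    and ufin: "powr_integral p_minus u < \<infinity>" "powr_integral p_plus u < \<infinity>"
    and gfin: "powr_integral p_minus (\<lambda>x. norm (g x)) < \<infinity>" "powr_integral p_plus (\<lambda>x. norm (g x)) < \<infinity>"
    and line: "\<And>h. AE x in lborel. integrable lborel (\<lambda>t. indicator {0..1} t * (g (x + t *\<^sub>R h) \<bullet> h)) \<and>
        u (x + h) - u x = (\<integral>t. indicator {0..1} t * (g (x + t *\<^sub>R h) \<bullet> h) \<partial>lborel)"
begin

lemma p_measurable_comp [measurable (raw)]:
  "f \<in> M \<rightarrow>\<^sub>M borel \<Longrightarrow> h \<in> M \<rightarrow>\<^sub>M borel \<Longrightarrow> (\<lambda>z. p (f z) (h z)) \<in> borel_measurable M"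
  using measurable_compose[OF measurable_Pair p_borel, of f M h] by simp

lemma a_measurable_comp [measurable (raw)]:
  "f \<in> M \<rightarrow>\<^sub>M borel \<Longrightarrow> h \<in> M \<rightarrow>\<^sub>M borel \<Longrightarrow> (\<lambda>z. a (f z) (h z)) \<in> borel_measurable M"
  using measurable_compose[OF measurable_Pair a_borel, of f M h] by simp

lemma p_pos: "0 < p x y" "1 < p x y" "p_minus \<le> p_plus" "1 < p_plus" "0 < p_plus" "0 < p_minus"
  using pb[of x y] p1 by linarith+

lemma a_nonneg: "0 \<le> a x y" "0 < a_plus" "0 \<le> a_plus"
  using ab[of x y] by linarith+

definition quot :: "real \<Rightarrow> real ^ 'n \<Rightarrow> real ^ 'n \<Rightarrow> real" where
  "quot r w x = (u (x + r *\<^sub>R w) - u x) / r"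

text \<open>
  The innermost integral of the energy in polar coordinates: the modular of \<open>f\<close> for the exponent
  \<open>x \<mapsto> p x (x + h)\<close>. At \<open>h = 0\<close> it has the diagonal values of the coefficients.
\<close>

definition shifted_modular :: "real ^ 'n \<Rightarrow> real \<Rightarrow> (real ^ 'n \<Rightarrow> real) \<Rightarrow> ennreal" where
  "shifted_modular h \<tau> f = (\<integral>\<^sup>+x. ennreal (a x (x + h) * \<bar>f x\<bar> powr p x (x + h) * exp (- (\<tau> * p x (x + h)))) \<partial>lborel)"

lemma quot_measurable [measurable]: "quot r w \<in> borel_measurable borel"
  unfolding quot_def[abs_def] by measurable

lemma shifted_modular_le:
  assumes [measurable]: "f \<in> borel_measurable borel"
  shows "shifted_modular h \<tau> f \<le> ennreal (a_plus * exp (- (\<tau> * p_minus))) * powr_integral p_minus f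
    + ennreal (a_plus * exp (- (\<tau> * p_plus))) * powr_integral p_plus f"
proof -
  have "shifted_modular h \<tau> f \<le> (\<integral>\<^sup>+x. ennreal (a_plus * exp (- (\<tau> * p_minus))) * ennreal (\<bar>f x\<bar> powr p_minus)
    + ennreal (a_plus * exp (- (\<tau> * p_plus))) * ennreal (\<bar>f x\<bar> powr p_plus) \<partial>lborel)"
    unfolding shifted_modular_def
  proof (rule nn_integral_mono)
    fix x
    (* the exponential is absorbed into the base, so that one exponent remains *)
    let ?P = "p x (x + h)" and ?t = "\<bar>f x\<bar> * exp (- \<tau>)"
    have e: "?t powr q = \<bar>f x\<bar> powr q * exp (- (\<tau> * q))" for q
      by (simp add: powr_mult exp_powr_real)
    have "a x (x + h) * \<bar>f x\<bar> powr ?P * exp (- (\<tau> * ?P)) = a x (x + h) * ?t powr ?P"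
      by (simp add: e mult.assoc)
    also have "\<dots> \<le> a_plus * (?t powr p_minus + ?t powr p_plus)"
      using pb[of x "x + h"] ab[of x "x + h"] by (intro mult_mono powr_between) auto
    also have "\<dots> = (a_plus * exp (- (\<tau> * p_minus))) * \<bar>f x\<bar> powr p_minus + (a_plus * exp (- (\<tau> * p_plus))) * \<bar>f x\<bar> powr p_plus"
      by (simp add: e algebra_simps)
    finally show "ennreal (a x (x + h) * \<bar>f x\<bar> powr ?P * exp (- (\<tau> * ?P))) \<le>
      ennreal (a_plus * exp (- (\<tau> * p_minus))) * ennreal (\<bar>f x\<bar> powr p_minus)
      + ennreal (a_plus * exp (- (\<tau> * p_plus))) * ennreal (\<bar>f x\<bar> powr p_plus)"
      using a_nonneg by (simp add: ennreal_mult[symmetric] ennreal_plus[symmetric] ennreal_leI del: ennreal_plus)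
  qed
  also have "\<dots> = ennreal (a_plus * exp (- (\<tau> * p_minus))) * powr_integral p_minus f
    + ennreal (a_plus * exp (- (\<tau> * p_plus))) * powr_integral p_plus f"
    unfolding powr_integral_def by (subst nn_integral_add) (auto simp: nn_integral_cmult)
  finally show ?thesis .
qed

lemma line_direction:
  "AE x in lborel. integrable lborel (\<lambda>t. indicator {0..1} t * (g (x + t *\<^sub>R (r *\<^sub>R w)) \<bullet> w)) \<and>
    u (x + r *\<^sub>R w) - u x = r * (\<integral>t. indicator {0..1} t * (g (x + t *\<^sub>R (r *\<^sub>R w)) \<bullet> w) \<partial>lborel)" if "r \<noteq> 0"
  using line[of "r *\<^sub>R w"]
proof eventually_elim
  case (elim x)
  have e: "indicator {0..1} t * (g (x + t *\<^sub>R (r *\<^sub>R w)) \<bullet> (r *\<^sub>R w)) = r * (indicator {0..1} t * (g (x + t *\<^sub>R (r *\<^sub>R w)) \<bullet> w))" for t :: real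
    by simp
  show ?case using elim that unfolding e by (simp only: integrable_mult_right_iff integral_mult_right_zero) auto
qed

lemma powr_integral_directional_le:
  assumes w: "norm w = 1" and q: "0 < q"
  shows "powr_integral q (\<lambda>x. g x \<bullet> w) \<le> powr_integral q (\<lambda>x. norm (g x))"
  unfolding powr_integral_def
proof (intro nn_integral_mono ennreal_leI powr_mono2)
  show "\<bar>g x \<bullet> w\<bar> \<le> \<bar>norm (g x)\<bar>" for x using Cauchy_Schwarz_ineq2[of "g x" w] w by simp
qed (use q in auto)

text \<open>
  Here \<open>f\<close> is fixed and only the coefficients vary, so dominated convergence applies with the two
  constant exponents.
\<close>

lemma shifted_modular_directional_tendsto:
  assumes w: "norm w = 1" and h: "h \<longlonglongrightarrow> 0"
  shows "(\<lambda>j. shifted_modular (h j) \<tau> (\<lambda>x. g x \<bullet> w)) \<longlonglongrightarrow> shifted_modular 0 \<tau> (\<lambda>x. g x \<bullet> w)"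
  unfolding shifted_modular_def
proof (rule nn_integral_dominated_convergence[where w="\<lambda>x. ennreal (a_plus * exp (\<bar>\<tau>\<bar> * p_plus)) * (ennreal (\<bar>g x \<bullet> w\<bar> powr p_minus) + ennreal (\<bar>g x \<bullet> w\<bar> powr p_plus))"])
  let ?f = "\<lambda>x. g x \<bullet> w"
  show "AE x in lborel. ennreal (a x (x + h j) * \<bar>?f x\<bar> powr p x (x + h j) * exp (- (\<tau> * p x (x + h j))))
      \<le> ennreal (a_plus * exp (\<bar>\<tau>\<bar> * p_plus)) * (ennreal (\<bar>?f x\<bar> powr p_minus) + ennreal (\<bar>?f x\<bar> powr p_plus))" for j
  proof (rule AE_I2)
    fix x
    let ?P = "p x (x + h j)"
    have "- (\<tau> * ?P) \<le> \<bar>\<tau>\<bar> * ?P" using p_pos(1)[of x "x + h j"] by (metis abs_ge_minus_self minus_mult_left mult_right_mono less_imp_le)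
    also have "\<dots> \<le> \<bar>\<tau>\<bar> * p_plus" using pb by (intro mult_left_mono) auto
    finally have E: "exp (- (\<tau> * ?P)) \<le> exp (\<bar>\<tau>\<bar> * p_plus)" by simp
    have "a x (x + h j) * \<bar>?f x\<bar> powr ?P * exp (- (\<tau> * ?P))
        \<le> a_plus * (\<bar>?f x\<bar> powr p_minus + \<bar>?f x\<bar> powr p_plus) * exp (\<bar>\<tau>\<bar> * p_plus)"
      using pb[of x "x + h j"] ab[of x "x + h j"] E by (intro mult_mono powr_between) auto
    then show "ennreal (a x (x + h j) * \<bar>?f x\<bar> powr ?P * exp (- (\<tau> * ?P)))
      \<le> ennreal (a_plus * exp (\<bar>\<tau>\<bar> * p_plus)) * (ennreal (\<bar>?f x\<bar> powr p_minus) + ennreal (\<bar>?f x\<bar> powr p_plus))"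
      using a_nonneg by (simp add: ennreal_mult[symmetric] ennreal_plus[symmetric] ennreal_leI mult_ac del: ennreal_plus)
  qed
  have "powr_integral p_minus ?f < \<infinity>" "powr_integral p_plus ?f < \<infinity>"
    using powr_integral_directional_le[OF w p_pos(6)] powr_integral_directional_le[OF w p_pos(5)] gfin by (auto intro: le_less_trans)
  then show "(\<integral>\<^sup>+x. ennreal (a_plus * exp (\<bar>\<tau>\<bar> * p_plus)) * (ennreal (\<bar>?f x\<bar> powr p_minus) + ennreal (\<bar>?f x\<bar> powr p_plus)) \<partial>lborel) < \<infinity>"
    by (subst nn_integral_cmult) (auto simp: nn_integral_add powr_integral_def ennreal_mult_less_top)
  show "AE x in lborel. (\<lambda>j. ennreal (a x (x + h j) * \<bar>?f x\<bar> powr p x (x + h j) * exp (- (\<tau> * p x (x + h j)))))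
      \<longlonglongrightarrow> ennreal (a x (x + 0) * \<bar>?f x\<bar> powr p x (x + 0) * exp (- (\<tau> * p x (x + 0))))"
  proof (rule AE_I2, rule tendsto_ennrealI)
    fix x
    have xh: "(\<lambda>j. x + h j) \<longlonglongrightarrow> x + 0" by (intro tendsto_intros h)
    have P: "(\<lambda>j. p x (x + h j)) \<longlonglongrightarrow> p x (x + 0)"
      using continuous_on_tendsto_compose[OF pc[of x] xh] by simp
    have A: "(\<lambda>j. a x (x + h j)) \<longlonglongrightarrow> a x (x + 0)"
      using continuous_on_tendsto_compose[OF ac[of x] xh] by simp
    have F: "(\<lambda>j. \<bar>?f x\<bar> powr p x (x + h j)) \<longlonglongrightarrow> \<bar>?f x\<bar> powr p x (x + 0)"
    proof (cases "?f x = 0")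
      case False
      then show ?thesis by (intro tendsto_powr tendsto_const P) auto
    qed simp
    show "(\<lambda>j. a x (x + h j) * \<bar>?f x\<bar> powr p x (x + h j) * exp (- (\<tau> * p x (x + h j))))
      \<longlonglongrightarrow> a x (x + 0) * \<bar>?f x\<bar> powr p x (x + 0) * exp (- (\<tau> * p x (x + 0)))"
      by (intro tendsto_intros A F P)
  qed
qed measurable

lemma shifted_modular_eps:
  assumes \<epsilon>: "0 < \<epsilon>"
  shows "\<exists>C. \<forall>h \<tau>. \<forall>f\<in>borel_measurable borel. \<forall>f'\<in>borel_measurable borel.
    shifted_modular h \<tau> f \<le> ennreal (1 + \<epsilon>) * shifted_modular h \<tau> f' + ennreal C * shifted_modular h \<tau> (\<lambda>x. f x - f' x)"
proof -
  obtain C where C: "0 \<le> C"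
    "\<And>x y q. 0 \<le> x \<Longrightarrow> 0 \<le> y \<Longrightarrow> 0 < q \<Longrightarrow> q \<le> p_plus \<Longrightarrow> (x + y) powr q \<le> (1 + \<epsilon>) * x powr q + C * y powr q"
    using powr_add_le_eps[OF p_pos(5) \<epsilon>] by metis
  show ?thesis
  proof (intro exI[of _ C] allI ballI)
    fix h \<tau> and f f' :: "real ^ 'n \<Rightarrow> real"
    assume [measurable]: "f \<in> borel_measurable borel" "f' \<in> borel_measurable borel"
    let ?k = "\<lambda>x. a x (x + h) * exp (- (\<tau> * p x (x + h)))"
    let ?P = "\<lambda>x. p x (x + h)"
    have "shifted_modular h \<tau> f \<le> (\<integral>\<^sup>+x. ennreal (1 + \<epsilon>) * ennreal (a x (x + h) * \<bar>f' x\<bar> powr ?P x * exp (- (\<tau> * ?P x)))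
        + ennreal C * ennreal (a x (x + h) * \<bar>f x - f' x\<bar> powr ?P x * exp (- (\<tau> * ?P x))) \<partial>lborel)"
      unfolding shifted_modular_def
    proof (rule nn_integral_mono)
      fix x
      have k: "0 \<le> ?k x" using a_nonneg by simp
      have "\<bar>f x\<bar> powr ?P x \<le> (\<bar>f' x\<bar> + \<bar>f x - f' x\<bar>) powr ?P x" using p_pos(1)[of x "x + h"] by (intro powr_mono2) auto
      also have "\<dots> \<le> (1 + \<epsilon>) * \<bar>f' x\<bar> powr ?P x + C * \<bar>f x - f' x\<bar> powr ?P x"
        using p_pos pb by (intro C) auto
      finally have "?k x * \<bar>f x\<bar> powr ?P x \<le> ?k x * ((1 + \<epsilon>) * \<bar>f' x\<bar> powr ?P x + C * \<bar>f x - f' x\<bar> powr ?P x)"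
        using k by (rule mult_left_mono)
      then have "a x (x + h) * \<bar>f x\<bar> powr ?P x * exp (- (\<tau> * ?P x)) \<le>
          (1 + \<epsilon>) * (a x (x + h) * \<bar>f' x\<bar> powr ?P x * exp (- (\<tau> * ?P x)))
          + C * (a x (x + h) * \<bar>f x - f' x\<bar> powr ?P x * exp (- (\<tau> * ?P x)))"
        by (simp add: algebra_simps)
      then show "ennreal (a x (x + h) * \<bar>f x\<bar> powr ?P x * exp (- (\<tau> * ?P x))) \<le>
          ennreal (1 + \<epsilon>) * ennreal (a x (x + h) * \<bar>f' x\<bar> powr ?P x * exp (- (\<tau> * ?P x)))
        + ennreal C * ennreal (a x (x + h) * \<bar>f x - f' x\<bar> powr ?P x * exp (- (\<tau> * ?P x)))"
        using a_nonneg C \<epsilon> by (simp add: ennreal_mult[symmetric] ennreal_plus[symmetric] ennreal_leI del: ennreal_plus)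
    qed
    also have "\<dots> = ennreal (1 + \<epsilon>) * shifted_modular h \<tau> f' + ennreal C * shifted_modular h \<tau> (\<lambda>x. f x - f' x)"
      unfolding shifted_modular_def by (subst nn_integral_add) (auto simp: nn_integral_cmult)
    finally show "shifted_modular h \<tau> f \<le> ennreal (1 + \<epsilon>) * shifted_modular h \<tau> f' + ennreal C * shifted_modular h \<tau> (\<lambda>x. f x - f' x)" .
  qed
qed

text \<open>
  Three limits are combined. The modulars of the directional derivative converge because the
  coefficients do, the modulars of \<open>quot - g \<bullet> w\<close> tend to zero by the \<open>L\<^sup>q\<close> convergence for the two
  constant exponents, and \<open>shifted_modular_eps\<close>, applied in both directions, compares the modulars
  of \<open>quot\<close> and \<open>g \<bullet> w\<close>.
\<close>

lemma shifted_modular_quot_tendsto: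
  assumes w: "norm w = 1" and r: "r \<longlonglongrightarrow> 0" "\<And>j. 0 < r j"
  shows "(\<lambda>j. shifted_modular (r j *\<^sub>R w) \<tau> (quot (r j) w)) \<longlonglongrightarrow> shifted_modular 0 \<tau> (\<lambda>x. g x \<bullet> w)"
proof (rule ennreal_squeeze_eps)
  let ?\<gamma> = "\<lambda>x. g x \<bullet> w"
  let ?h = "\<lambda>j. r j *\<^sub>R w"
  have gam[measurable]: "?\<gamma> \<in> borel_measurable borel" by measurable
  have fin: "powr_integral p_minus ?\<gamma> < \<infinity>" "powr_integral p_plus ?\<gamma> < \<infinity>"
    using powr_integral_directional_le[OF w p_pos(6)] powr_integral_directional_le[OF w p_pos(5)] gfin by (auto intro: le_less_trans)
  have "(\<lambda>j. r j *\<^sub>R w) \<longlonglongrightarrow> 0 *\<^sub>R w" by (intro tendsto_intros r)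
  then show "(\<lambda>j. shifted_modular (?h j) \<tau> ?\<gamma>) \<longlonglongrightarrow> shifted_modular 0 \<tau> ?\<gamma>"
    by (intro shifted_modular_directional_tendsto w) simp
  show "shifted_modular 0 \<tau> ?\<gamma> < \<infinity>"
    using fin by (intro le_less_trans[OF shifted_modular_le[OF gam]]) (auto simp: ennreal_mult_less_top)
  have D: "(\<lambda>j. powr_integral q (\<lambda>x. quot (r j) w x - ?\<gamma> x)) \<longlonglongrightarrow> 0" if "1 < q" "powr_integral q ?\<gamma> < \<infinity>" for q
    unfolding quot_def
    by (rule powr_integral_difference_quotient_tendsto[OF that(1) um gam line_direction that(2) r])
  let ?B = "\<lambda>j. ennreal (a_plus * exp (- (\<tau> * p_minus))) * powr_integral p_minus (\<lambda>x. quot (r j) w x - ?\<gamma> x)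
    + ennreal (a_plus * exp (- (\<tau> * p_plus))) * powr_integral p_plus (\<lambda>x. quot (r j) w x - ?\<gamma> x)"
  have lim: "?B \<longlonglongrightarrow> ennreal (a_plus * exp (- (\<tau> * p_minus))) * 0 + ennreal (a_plus * exp (- (\<tau> * p_plus))) * 0"
    by (intro tendsto_add ennreal_tendsto_cmult D fin p1 p_pos(4)) auto
  show "(\<lambda>j. shifted_modular (?h j) \<tau> (\<lambda>x. quot (r j) w x - ?\<gamma> x)) \<longlonglongrightarrow> 0"
  proof (rule tendsto_sandwich[OF _ _ tendsto_const])
    show "?B \<longlonglongrightarrow> 0" using lim by simp
    show "\<forall>\<^sub>F j in sequentially. shifted_modular (?h j) \<tau> (\<lambda>x. quot (r j) w x - ?\<gamma> x) \<le> ?B j"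
      by (intro always_eventually allI shifted_modular_le) measurable
  qed simp
  fix \<epsilon> :: real assume \<epsilon>: "0 < \<epsilon>"
  from shifted_modular_eps[OF \<epsilon>] obtain C where "\<forall>h \<tau>. \<forall>f\<in>borel_measurable borel. \<forall>f'\<in>borel_measurable borel.
    shifted_modular h \<tau> f \<le> ennreal (1 + \<epsilon>) * shifted_modular h \<tau> f' + ennreal C * shifted_modular h \<tau> (\<lambda>x. f x - f' x)" ..
  note C = this[rule_format]
  have sym: "shifted_modular h \<tau> (\<lambda>x. f x - f' x) = shifted_modular h \<tau> (\<lambda>x. f' x - f x)" for h f f'
    unfolding shifted_modular_def by (simp add: abs_minus_commute)
  show "\<exists>C. \<forall>j. shifted_modular (?h j) \<tau> (quot (r j) w) \<le> ennreal (1 + \<epsilon>) * shifted_modular (?h j) \<tau> ?\<gamma> + ennreal C * shifted_modular (?h j) \<tau> (\<lambda>x. quot (r j) w x - ?\<gamma> x) \<and>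
     shifted_modular (?h j) \<tau> ?\<gamma> \<le> ennreal (1 + \<epsilon>) * shifted_modular (?h j) \<tau> (quot (r j) w) + ennreal C * shifted_modular (?h j) \<tau> (\<lambda>x. quot (r j) w x - ?\<gamma> x)"
  proof (intro exI[of _ C] allI conjI)
    fix j
    show "shifted_modular (?h j) \<tau> (quot (r j) w) \<le> ennreal (1 + \<epsilon>) * shifted_modular (?h j) \<tau> ?\<gamma> + ennreal C * shifted_modular (?h j) \<tau> (\<lambda>x. quot (r j) w x - ?\<gamma> x)"
      by (rule C[OF quot_measurable gam])
    show "shifted_modular (?h j) \<tau> ?\<gamma> \<le> ennreal (1 + \<epsilon>) * shifted_modular (?h j) \<tau> (quot (r j) w) + ennreal C * shifted_modular (?h j) \<tau> (\<lambda>x. quot (r j) w x - ?\<gamma> x)"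
      using C[OF gam quot_measurable] by (subst sym)
  qed
qed

end


section \<open>The energy in polar coordinates and its limit\<close>

lemma nn_integral_exp_minus_abs:
  fixes q :: real
  assumes q: "0 < q"
  shows "(\<integral>\<^sup>+\<tau>. ennreal (exp (- (q * \<bar>\<tau>\<bar>))) \<partial>lborel) = ennreal (1 / q) + ennreal (1 / q)"
proof -
  let ?F = "\<lambda>\<tau>. ennreal (exp (- (q * \<tau>))) * indicator {0<..} \<tau>"
  have e: "(\<integral>\<^sup>+\<tau>. ?F \<tau> \<partial>lborel) = ennreal (1 / q)" using nn_integral_exp_greaterThan[OF q, of 0] by simp
  have "(\<integral>\<^sup>+\<tau>. ennreal (exp (- (q * \<bar>\<tau>\<bar>))) \<partial>lborel) = (\<integral>\<^sup>+\<tau>. ?F \<tau> + ?F (- \<tau>) \<partial>lborel)"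
    using AE_lborel_singleton[of "0::real"]
    by (intro nn_integral_cong_AE) (auto elim!: eventually_mono split: split_indicator)
  also have "\<dots> = (\<integral>\<^sup>+\<tau>. ?F \<tau> \<partial>lborel) + (\<integral>\<^sup>+\<tau>. ?F (- \<tau>) \<partial>lborel)"
    by (rule nn_integral_add) auto
  also have "(\<integral>\<^sup>+\<tau>. ?F (- \<tau>) \<partial>lborel) = (\<integral>\<^sup>+\<tau>. ?F \<tau> \<partial>lborel)"
    using nn_integral_real_affine[of ?F "-1" 0] by simp
  finally show ?thesis by (simp add: e)
qed

context nonlocal_energy
begin

definition polar_energy :: "real \<Rightarrow> real ^ 'n \<Rightarrow> ennreal" where
  "polar_energy s w = (\<integral>\<^sup>+\<tau>. shifted_modular (exp (- (\<tau> / (1 - s))) *\<^sub>R w) \<tau> (quot (exp (- (\<tau> / (1 - s)))) w) \<partial>lborel)"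

text \<open>
  With \<open>t = \<tau> / (1 - s)\<close> and \<open>r = exp (- t)\<close>, the Jacobian \<open>exp (- n t)\<close> cancels the power
  \<open>r powr n\<close> of the kernel. Of \<open>r powr (- s p)\<close>, the part \<open>r powr (- p)\<close> makes the difference a
  quotient, and \<open>r powr ((1 - s) p) = exp (- (\<tau> p))\<close> remains.
\<close>

lemma kernel_polar_eq:
  fixes \<tau> :: real
  assumes s: "0 < s" "s < 1" and w: "norm w = 1"
  defines "r \<equiv> exp (- (\<tau> / (1 - s)))"
  shows "exp (- (real CARD('n) * (\<tau> / (1 - s)))) *
      (a x (x + r *\<^sub>R w) * (\<bar>u x - u (x + r *\<^sub>R w)\<bar> powr p x (x + r *\<^sub>R w)
        / norm (x - (x + r *\<^sub>R w)) powr (real CARD('n) + s * p x (x + r *\<^sub>R w))))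
    = a x (x + r *\<^sub>R w) * \<bar>quot r w x\<bar> powr p x (x + r *\<^sub>R w) * exp (- (\<tau> * p x (x + r *\<^sub>R w)))"
proof -
  define t where "t = \<tau> / (1 - s)"
  define P where "P = p x (x + r *\<^sub>R w)"
  define A where "A = \<bar>u (x + r *\<^sub>R w) - u x\<bar> powr P"
  have \<tau>: "\<tau> = (1 - s) * t" using s by (simp add: t_def)
  have r: "r = exp (- t)" "0 < r" by (simp_all add: r_def t_def)
  have n: "norm (x - (x + r *\<^sub>R w)) = r" using w r by simp
  have rp: "r powr q = exp (- (t * q))" for q using r by (simp add: exp_powr_real)
  have q: "\<bar>quot r w x\<bar> powr P = A * exp (t * P)"
    using r(2) by (simp add: quot_def A_def powr_divide rp exp_minus field_simps)
  have A': "\<bar>u x - u (x + r *\<^sub>R w)\<bar> powr P = A" by (simp add: A_def abs_minus_commute)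
  have "exp (- (real CARD('n) * t)) * (A / exp (- (t * (real CARD('n) + s * P))))
      = A * (exp (- (real CARD('n) * t)) * exp (t * (real CARD('n) + s * P)))"
  proof -
    have "A / exp (- X) = A * exp X" for X by (simp add: exp_minus divide_inverse)
    then show ?thesis by (simp only: mult.left_commute)
  qed
  also have "\<dots> = A * (exp (t * P) * exp (- (\<tau> * P)))"
    unfolding exp_add[symmetric] \<tau> by (simp add: algebra_simps)
  finally have "exp (- (real CARD('n) * t)) * (A / exp (- (t * (real CARD('n) + s * P)))) = A * (exp (t * P) * exp (- (\<tau> * P)))" .
  note exps = this
  show ?thesis
    unfolding P_def[symmetric] n rp A' q t_def[symmetric] mult.left_commute[of "exp (- (real CARD('n) * t))"] exps
    by (simp add: mult_ac)
qed

lemma energy_polar: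
  assumes s: "0 < s" "s < 1"
  shows "ennreal (1 - s) * (\<integral>\<^sup>+x. \<integral>\<^sup>+y. ennreal (a x y * (\<bar>u x - u y\<bar> powr p x y
         / norm (x - y) powr (real CARD('n) + s * p x y))) \<partial>lborel \<partial>lborel) = (\<integral>\<^sup>+w. polar_energy s w \<partial>cone_measure)"
proof -
  let ?n = "real CARD('n)"
  let ?K = "\<lambda>x y. ennreal (a x y * (\<bar>u x - u y\<bar> powr p x y / norm (x - y) powr (?n + s * p x y)))"
  define R where "R h = (\<integral>\<^sup>+x. ?K x (x + h) \<partial>lborel)" for h
  have Rm[measurable]: "R \<in> borel_measurable borel"
  proof -
    have "(\<lambda>(h, x). ?K x (x + h)) \<in> borel_measurable (lborel \<Otimes>\<^sub>M lborel)" by measurable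
    from lborel.borel_measurable_nn_integral[OF this] show ?thesis by (simp add: R_def[abs_def])
  qed
  have "(\<integral>\<^sup>+x. \<integral>\<^sup>+y. ?K x y \<partial>lborel \<partial>lborel) = (\<integral>\<^sup>+x. \<integral>\<^sup>+h. ?K x (h + x) \<partial>lborel \<partial>lborel)"
    by (intro nn_integral_cong nn_integral_lborel_translate[symmetric]) measurable
  also have "\<dots> = (\<integral>\<^sup>+x. \<integral>\<^sup>+h. ?K x (x + h) \<partial>lborel \<partial>lborel)" by (simp only: add.commute)
  also have "\<dots> = (\<integral>\<^sup>+h. R h \<partial>lborel)"
    unfolding R_def by (rule lborel_pair.Fubini'[symmetric]) measurable
  also have "\<dots> = (\<integral>\<^sup>+w. (\<integral>\<^sup>+t. ennreal (exp (- (?n * t))) * R (exp (- t) *\<^sub>R w) \<partial>lborel) \<partial>cone_measure)"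
    using nn_integral_polar[OF Rm] by simp
  finally have "ennreal (1 - s) * (\<integral>\<^sup>+x. \<integral>\<^sup>+y. ?K x y \<partial>lborel \<partial>lborel)
      = (\<integral>\<^sup>+w. ennreal (1 - s) * (\<integral>\<^sup>+t. ennreal (exp (- (?n * t))) * R (exp (- t) *\<^sub>R w) \<partial>lborel) \<partial>cone_measure)"
    by (simp only:) (subst nn_integral_cmult, auto)
  also have "\<dots> = (\<integral>\<^sup>+w. polar_energy s w \<partial>cone_measure)"
  proof (rule nn_integral_cong_AE)
    show "AE w in cone_measure. ennreal (1 - s) * (\<integral>\<^sup>+t. ennreal (exp (- (?n * t))) * R (exp (- t) *\<^sub>R w) \<partial>lborel) = polar_energy s w"
      using AE_cone_measure_norm
    proof eventually_elim
      case (elim w)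
      have "ennreal (1 - s) * (\<integral>\<^sup>+t. ennreal (exp (- (?n * t))) * R (exp (- t) *\<^sub>R w) \<partial>lborel)
          = (\<integral>\<^sup>+\<tau>. ennreal (exp (- (?n * (\<tau> / (1 - s))))) * R (exp (- (\<tau> / (1 - s))) *\<^sub>R w) \<partial>lborel)"
        using s by (intro nn_integral_lborel_scale_real) auto
      also have "\<dots> = polar_energy s w"
        unfolding polar_energy_def
      proof (rule nn_integral_cong)
        fix \<tau> :: real
        show "ennreal (exp (- (?n * (\<tau> / (1 - s))))) * R (exp (- (\<tau> / (1 - s))) *\<^sub>R w)
          = shifted_modular (exp (- (\<tau> / (1 - s))) *\<^sub>R w) \<tau> (quot (exp (- (\<tau> / (1 - s)))) w)"
          unfolding R_def shifted_modular_def
          by (subst nn_integral_cmult[symmetric], measurable)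
            (intro nn_integral_cong, simp only: ennreal_mult'[symmetric] exp_ge_zero kernel_polar_eq[OF s elim])
      qed
      finally show ?case .
    qed
  qed
  finally show ?thesis .
qed

text \<open>
  One constant for both regimes: the first summand bounds the difference quotients for small
  distances, the second one for large distances.
\<close>

definition quot_bound :: "real \<Rightarrow> ennreal" where
  "quot_bound q = powr_integral q (\<lambda>x. norm (g x)) + ennreal (2 powr q) * (powr_integral q u + powr_integral q u)"

lemma quot_bound_finite: "quot_bound p_minus < \<infinity>" "quot_bound p_plus < \<infinity>"
  using ufin gfin by (auto simp: quot_bound_def ennreal_mult_less_top)

lemma powr_integral_quot_near:
  assumes "1 < q" "norm w = 1" "0 < r"
  shows "powr_integral q (quot r w) \<le> quot_bound q"
proof -
  have "powr_integral q (quot r w) \<le> powr_integral q (\<lambda>x. g x \<bullet> w)"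
    unfolding quot_def[abs_def]
    by (rule powr_integral_difference_quotient_le[OF assms(1) um _ line_direction assms(3)]) measurable
  also have "\<dots> \<le> powr_integral q (\<lambda>x. norm (g x))" using assms by (intro powr_integral_directional_le) auto
  finally show ?thesis by (simp add: quot_bound_def add_increasing2)
qed

lemma powr_integral_quot_far:
  assumes "1 < q" "0 < r"
  shows "powr_integral q (quot r w) \<le> ennreal (r powr (- q)) * quot_bound q"
proof -
  have e: "ennreal (\<bar>quot r w x\<bar> powr q) = ennreal (r powr (- q)) * ennreal (\<bar>u (x + r *\<^sub>R w) - u x\<bar> powr q)" for x
    using assms by (simp add: quot_def powr_divide powr_minus_divide ennreal_mult[symmetric])
  have "powr_integral q (quot r w) = ennreal (r powr (- q)) * powr_integral q (\<lambda>x. u (x + r *\<^sub>R w) - u x)"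
    unfolding powr_integral_def e by (rule nn_integral_cmult) measurable
  also have "powr_integral q (\<lambda>x. u (x + r *\<^sub>R w) - u x) = powr_integral q (\<lambda>x. u (x + r *\<^sub>R w) + - u x)" by simp
  also have "ennreal (r powr (- q)) * \<dots> \<le> ennreal (r powr (- q)) *
      (ennreal (2 powr q) * (powr_integral q (\<lambda>x. u (x + r *\<^sub>R w)) + powr_integral q (\<lambda>x. - u x)))"
    using assms by (intro mult_left_mono powr_integral_add_le) auto
  also have "powr_integral q (\<lambda>x. u (x + r *\<^sub>R w)) = powr_integral q u" by (rule powr_integral_translate) measurable
  also have "powr_integral q (\<lambda>x. - u x) = powr_integral q u" by (simp add: powr_integral_def)
  also have "ennreal (r powr (- q)) * (ennreal (2 powr q) * (powr_integral q u + powr_integral q u)) \<le> ennreal (r powr (- q)) * quot_bound q"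
    by (intro mult_left_mono) (auto simp: quot_bound_def add_increasing)
  finally show ?thesis .
qed

text \<open>
  For negative \<open>\<tau>\<close> the factor \<open>exp (- (\<tau> * q))\<close> is large, but \<open>r powr (- q)\<close> outweighs it: their
  product is \<open>exp (\<tau> * s / (1 - s) * q)\<close>.
\<close>

lemma shifted_modular_quot_far:
  fixes \<tau> :: real
  assumes s: "0 < s" "s < 1"
  defines "r \<equiv> exp (- (\<tau> / (1 - s)))"
  shows "shifted_modular (r *\<^sub>R w) \<tau> (quot r w) \<le>
    ennreal (a_plus * exp (\<tau> * s / (1 - s) * p_minus)) * quot_bound p_minus + ennreal (a_plus * exp (\<tau> * s / (1 - s) * p_plus)) * quot_bound p_plus"
proof -
  have r: "0 < r" by (simp add: r_def)
  have e: "ennreal (a_plus * exp (- (\<tau> * q))) * (ennreal (r powr (- q)) * B) = ennreal (a_plus * exp (\<tau> * s / (1 - s) * q)) * B" for q B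
  proof -
    have rq: "r powr (- q) = exp (\<tau> / (1 - s) * q)" by (simp add: r_def exp_powr_real)
    have t: "- (\<tau> * q) + \<tau> / (1 - s) * q = \<tau> * s / (1 - s) * q" using s by (simp add: field_simps)
    have "a_plus * exp (- (\<tau> * q)) * r powr (- q) = a_plus * exp (\<tau> * s / (1 - s) * q)"
      unfolding rq mult.assoc exp_add[symmetric] t ..
    moreover have "ennreal (a_plus * exp (- (\<tau> * q))) * (ennreal (r powr (- q)) * B) = ennreal (a_plus * exp (- (\<tau> * q)) * r powr (- q)) * B"
      using a_nonneg(3) by (simp add: mult.assoc[symmetric] ennreal_mult[symmetric])
    ultimately show ?thesis by (simp only:)
  qed
  have "shifted_modular (r *\<^sub>R w) \<tau> (quot r w) \<le> ennreal (a_plus * exp (- (\<tau> * p_minus))) * powr_integral p_minus (quot r w)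
    + ennreal (a_plus * exp (- (\<tau> * p_plus))) * powr_integral p_plus (quot r w)"
    by (rule shifted_modular_le) measurable
  also have "\<dots> \<le> ennreal (a_plus * exp (- (\<tau> * p_minus))) * (ennreal (r powr (- p_minus)) * quot_bound p_minus)
    + ennreal (a_plus * exp (- (\<tau> * p_plus))) * (ennreal (r powr (- p_plus)) * quot_bound p_plus)"
    by (intro add_mono mult_left_mono powr_integral_quot_far p1 p_pos(4) r) auto
  finally show ?thesis unfolding e .
qed

definition envelope :: "real \<Rightarrow> ennreal" where
  "envelope \<tau> = ennreal (a_plus * exp (- (p_minus * \<bar>\<tau>\<bar>))) * quot_bound p_minus + ennreal (a_plus * exp (- (p_plus * \<bar>\<tau>\<bar>))) * quot_bound p_plus"

lemma envelope_measurable [measurable]: "envelope \<in> borel_measurable borel"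
  unfolding envelope_def[abs_def] by measurable

lemma envelope_integral: "(\<integral>\<^sup>+\<tau>. envelope \<tau> \<partial>lborel) < \<infinity>"
proof -
  have "(\<integral>\<^sup>+\<tau>. envelope \<tau> \<partial>lborel) =
      (\<integral>\<^sup>+\<tau>. ennreal a_plus * quot_bound p_minus * ennreal (exp (- (p_minus * \<bar>\<tau>\<bar>))) + ennreal a_plus * quot_bound p_plus * ennreal (exp (- (p_plus * \<bar>\<tau>\<bar>))) \<partial>lborel)"
    unfolding envelope_def using a_nonneg by (simp add: ennreal_mult mult_ac)
  also have "\<dots> = ennreal a_plus * quot_bound p_minus * (ennreal (1 / p_minus) + ennreal (1 / p_minus))
      + ennreal a_plus * quot_bound p_plus * (ennreal (1 / p_plus) + ennreal (1 / p_plus))"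
    using p_pos by (subst nn_integral_add) (auto simp: nn_integral_cmult nn_integral_exp_minus_abs)
  also have "\<dots> < \<infinity>" using quot_bound_finite by (auto simp: ennreal_mult_less_top)
  finally show ?thesis .
qed

text \<open>
  The condition \<open>1 / 2 < s\<close> ensures \<open>s / (1 - s) \<ge> 1\<close>, which makes the bound for negative \<open>\<tau>\<close>
  independent of \<open>s\<close>.
\<close>

lemma shifted_modular_quot_envelope:
  assumes s: "1 / 2 < s" "s < 1" and w: "norm w = 1"
  shows "shifted_modular (exp (- (\<tau> / (1 - s))) *\<^sub>R w) \<tau> (quot (exp (- (\<tau> / (1 - s)))) w) \<le> envelope \<tau>"
proof (cases "0 < \<tau>")
  case True
  have "shifted_modular (exp (- (\<tau> / (1 - s))) *\<^sub>R w) \<tau> (quot (exp (- (\<tau> / (1 - s)))) w)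
     \<le> ennreal (a_plus * exp (- (\<tau> * p_minus))) * powr_integral p_minus (quot (exp (- (\<tau> / (1 - s)))) w)
      + ennreal (a_plus * exp (- (\<tau> * p_plus))) * powr_integral p_plus (quot (exp (- (\<tau> / (1 - s)))) w)"
    by (rule shifted_modular_le) measurable
  also have "\<dots> \<le> ennreal (a_plus * exp (- (\<tau> * p_minus))) * quot_bound p_minus + ennreal (a_plus * exp (- (\<tau> * p_plus))) * quot_bound p_plus"
    by (intro add_mono mult_left_mono powr_integral_quot_near p1 p_pos(4) w) auto
  also have "\<dots> = envelope \<tau>" using True by (simp add: envelope_def mult.commute)
  finally show ?thesis .
next
  case False
  have "1 \<le> s / (1 - s)" using s by (simp add: field_simps)
  then have "\<tau> * (s / (1 - s)) \<le> \<tau> * 1" using False by (intro mult_left_mono_neg) auto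
  then have "\<tau> * s / (1 - s) \<le> - \<bar>\<tau>\<bar>" using False by simp
  then have "\<tau> * s / (1 - s) * q \<le> - \<bar>\<tau>\<bar> * q" if "0 < q" for q
    using that by (intro mult_right_mono) auto
  then have "\<tau> * s / (1 - s) * q \<le> - (q * \<bar>\<tau>\<bar>)" if "0 < q" for q
    using that by (simp add: mult.commute)
  then have "ennreal (a_plus * exp (\<tau> * s / (1 - s) * q)) \<le> ennreal (a_plus * exp (- (q * \<bar>\<tau>\<bar>)))" if "0 < q" for q
    using that a_nonneg by (intro ennreal_leI mult_left_mono) auto
  then show ?thesis
    unfolding envelope_def using s p_pos
    by (intro order_trans[OF shifted_modular_quot_far] add_mono mult_right_mono) auto
qed

text \<open>
  The contribution of the direction \<open>w\<close> to the limit. Negative \<open>\<tau>\<close>, which correspond to distances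
  larger than \<open>1\<close>, contribute nothing.
\<close>

definition limit_energy :: "real ^ 'n \<Rightarrow> ennreal" where
  "limit_energy w = (\<integral>\<^sup>+\<tau>. indicator {0<..} \<tau> * shifted_modular 0 \<tau> (\<lambda>x. g x \<bullet> w) \<partial>lborel)"

lemma shifted_modular_quot_measurable:
  "(\<lambda>(w, \<tau>). shifted_modular (exp (- (\<tau> / (1 - s))) *\<^sub>R w) \<tau> (quot (exp (- (\<tau> / (1 - s)))) w)) \<in> borel_measurable (borel \<Otimes>\<^sub>M borel)"
proof -
  have "(\<lambda>(z, x). let w = fst z; \<tau> = snd z; r = exp (- (\<tau> / (1 - s))); h = r *\<^sub>R w in
      ennreal (a x (x + h) * \<bar>(u (x + r *\<^sub>R w) - u x) / r\<bar> powr p x (x + h) * exp (- (\<tau> * p x (x + h)))))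
    \<in> borel_measurable ((borel \<Otimes>\<^sub>M borel) \<Otimes>\<^sub>M lborel)"
    unfolding Let_def by measurable
  from lborel.borel_measurable_nn_integral[OF this] show ?thesis
    by (simp add: shifted_modular_def quot_def Let_def case_prod_beta)
qed

lemma shifted_modular_directional_measurable:
  "(\<lambda>(w, \<tau>). shifted_modular 0 \<tau> (\<lambda>x. g x \<bullet> w)) \<in> borel_measurable (borel \<Otimes>\<^sub>M borel)"
proof -
  have "(\<lambda>(z, x). ennreal (a x (x + 0) * \<bar>g x \<bullet> fst z\<bar> powr p x (x + 0) * exp (- (snd z * p x (x + 0)))))
    \<in> borel_measurable ((borel \<Otimes>\<^sub>M borel) \<Otimes>\<^sub>M lborel)"
    by measurable
  from lborel.borel_measurable_nn_integral[OF this] show ?thesis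
    by (simp add: shifted_modular_def case_prod_beta)
qed

lemma polar_energy_measurable [measurable]: "polar_energy s \<in> borel_measurable borel"
proof -
  have "(\<lambda>(w, \<tau>). shifted_modular (exp (- (\<tau> / (1 - s))) *\<^sub>R w) \<tau> (quot (exp (- (\<tau> / (1 - s)))) w)) \<in> borel_measurable (borel \<Otimes>\<^sub>M lborel)"
    using shifted_modular_quot_measurable by (simp cong: measurable_cong_sets sets_pair_measure_cong)
  from lborel.borel_measurable_nn_integral[OF this] show ?thesis by (simp add: polar_energy_def[abs_def])
qed

lemma limit_energy_measurable [measurable]: "limit_energy \<in> borel_measurable borel"
proof -
  have "(\<lambda>(w, \<tau>). indicator {0<..} \<tau> * (case (w, \<tau>) of (w, \<tau>) \<Rightarrow> shifted_modular 0 \<tau> (\<lambda>x. g x \<bullet> w))) \<in> borel_measurable (borel \<Otimes>\<^sub>M borel)"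
    using shifted_modular_directional_measurable by measurable
  then have "(\<lambda>(w, \<tau>). indicator {0<..} \<tau> * shifted_modular 0 \<tau> (\<lambda>x. g x \<bullet> w)) \<in> borel_measurable (borel \<Otimes>\<^sub>M lborel)"
    by (simp cong: measurable_cong_sets sets_pair_measure_cong)
  from lborel.borel_measurable_nn_integral[OF this] show ?thesis by (simp add: limit_energy_def[abs_def])
qed

lemma polar_energy_tendsto:
  assumes w: "norm w = 1" and S: "\<And>j. 1 / 2 < S j" "\<And>j. S j < 1" "S \<longlonglongrightarrow> 1"
  shows "(\<lambda>j. polar_energy (S j) w) \<longlonglongrightarrow> limit_energy w"
  unfolding polar_energy_def limit_energy_def
proof (rule nn_integral_dominated_convergence[where w=envelope])
  let ?f = "\<lambda>s \<tau>. shifted_modular (exp (- (\<tau> / (1 - s))) *\<^sub>R w) \<tau> (quot (exp (- (\<tau> / (1 - s)))) w)"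
  show "?f (S j) \<in> borel_measurable lborel" for j
    using measurable_Pair2[OF shifted_modular_quot_measurable, of w] by simp
  show "(\<lambda>\<tau>. indicator {0<..} \<tau> * shifted_modular 0 \<tau> (\<lambda>x. g x \<bullet> w)) \<in> borel_measurable lborel"
    using measurable_Pair2[OF shifted_modular_directional_measurable, of w] by simp
  show "AE \<tau> in lborel. ?f (S j) \<tau> \<le> envelope \<tau>" for j
    by (intro AE_I2 shifted_modular_quot_envelope S w)
  have D: "(\<lambda>j. 1 - S j) \<longlonglongrightarrow> 0" using tendsto_diff[OF tendsto_const[of 1] S(3)] by simp
  have inv: "filterlim (\<lambda>j. inverse (1 - S j)) at_top sequentially"
    using S(2) by (intro filterlim_inverse_at_top[OF D]) auto
  show "AE \<tau> in lborel. (\<lambda>j. ?f (S j) \<tau>) \<longlonglongrightarrow> indicator {0<..} \<tau> * shifted_modular 0 \<tau> (\<lambda>x. g x \<bullet> w)"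
    using AE_lborel_singleton[of "0::real"]
  proof eventually_elim
    case (elim \<tau>)
    show ?case
    proof (cases "0 < \<tau>")
      case True
      have "filterlim (\<lambda>j. \<tau> * inverse (1 - S j)) at_top sequentially"
        by (rule filterlim_tendsto_pos_mult_at_top[OF tendsto_const True inv])
      then have "(\<lambda>j. exp (- (\<tau> * inverse (1 - S j)))) \<longlonglongrightarrow> 0"
        by (intro filterlim_compose[OF exp_at_bot] filterlim_compose[OF filterlim_uminus_at_bot_at_top])
      then have "(\<lambda>j. exp (- (\<tau> / (1 - S j)))) \<longlonglongrightarrow> 0" by (simp add: divide_inverse)
      from shifted_modular_quot_tendsto[OF w this] show ?thesis using True by simp
    next
      case False
      then have \<tau>: "\<tau> < 0" using elim by simp
      have SI: "filterlim (\<lambda>j. S j * inverse (1 - S j)) at_top sequentially"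
        by (rule filterlim_tendsto_pos_mult_at_top[OF S(3) _ inv]) simp
      have lim0: "(\<lambda>j. ennreal (a_plus * exp (\<tau> * S j / (1 - S j) * q))) \<longlonglongrightarrow> 0" if q: "0 < q" for q
      proof -
        have "0 < - (\<tau> * q)" using \<tau> q by (simp add: mult_neg_pos)
        then have "filterlim (\<lambda>j. - (\<tau> * q) * (S j * inverse (1 - S j))) at_top sequentially"
          by (rule filterlim_tendsto_pos_mult_at_top[OF tendsto_const _ SI])
        then have "(\<lambda>j. exp (- (- (\<tau> * q) * (S j * inverse (1 - S j))))) \<longlonglongrightarrow> 0"
          by (intro filterlim_compose[OF exp_at_bot] filterlim_compose[OF filterlim_uminus_at_bot_at_top])
        then have "(\<lambda>j. a_plus * exp (\<tau> * S j / (1 - S j) * q)) \<longlonglongrightarrow> a_plus * 0"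
          by (intro tendsto_mult tendsto_const) (simp add: divide_inverse mult_ac)
        then show ?thesis by (auto dest: tendsto_ennrealI)
      qed
      let ?B = "\<lambda>j. quot_bound p_minus * ennreal (a_plus * exp (\<tau> * S j / (1 - S j) * p_minus)) + quot_bound p_plus * ennreal (a_plus * exp (\<tau> * S j / (1 - S j) * p_plus))"
      have "?B \<longlonglongrightarrow> quot_bound p_minus * 0 + quot_bound p_plus * 0"
        using quot_bound_finite p_pos by (intro tendsto_add ennreal_tendsto_cmult lim0) auto
      then have B: "?B \<longlonglongrightarrow> 0" by simp
      have "0 < S j" for j using S(1)[of j] by linarith
      then have "?f (S j) \<tau> \<le> ?B j" for j
        using shifted_modular_quot_far[OF _ S(2)] by (simp add: mult.commute)
      then have "(\<lambda>j. ?f (S j) \<tau>) \<longlonglongrightarrow> 0"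
        by (intro tendsto_sandwich[OF _ _ tendsto_const B]) auto
      then show ?thesis using \<tau> by simp
    qed
  qed
qed (use envelope_integral in auto)

lemma energy_tendsto:
  "((\<lambda>s. ennreal (1 - s) * (\<integral>\<^sup>+x. \<integral>\<^sup>+y. ennreal (a x y * (\<bar>u x - u y\<bar> powr p x y
         / norm (x - y) powr (real CARD('n) + s * p x y))) \<partial>lborel \<partial>lborel))
     \<longlongrightarrow> (\<integral>\<^sup>+w. limit_energy w \<partial>cone_measure)) (at_left 1)"
proof (rule tendsto_at_left_sequentially[of "1 / 2"])
  fix S :: "nat \<Rightarrow> real" assume S: "\<And>j. S j < 1" "\<And>j. 1 / 2 < S j" "S \<longlonglongrightarrow> 1"
  have "0 < S j" for j using S(2)[of j] by linarith
  note e = energy_polar[OF this S(1)]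
  interpret cone: finite_measure "cone_measure :: (real ^ 'n) measure" by (rule finite_measure_cone_measure)
  show "(\<lambda>j. ennreal (1 - S j) * (\<integral>\<^sup>+x. \<integral>\<^sup>+y. ennreal (a x y * (\<bar>u x - u y\<bar> powr p x y
         / norm (x - y) powr (real CARD('n) + S j * p x y))) \<partial>lborel \<partial>lborel)) \<longlonglongrightarrow> (\<integral>\<^sup>+w. limit_energy w \<partial>cone_measure)"
    unfolding e
  proof (rule nn_integral_dominated_convergence[where w="\<lambda>_. \<integral>\<^sup>+\<tau>. envelope \<tau> \<partial>lborel"])
    show "AE w in cone_measure. polar_energy (S j) w \<le> (\<integral>\<^sup>+\<tau>. envelope \<tau> \<partial>lborel)" for j
      using AE_cone_measure_norm
      by eventually_elim (auto simp: polar_energy_def intro!: nn_integral_mono shifted_modular_quot_envelope S)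
    show "(\<integral>\<^sup>+w. (\<integral>\<^sup>+\<tau>. envelope \<tau> \<partial>lborel) \<partial>(cone_measure :: (real ^ 'n) measure)) < \<infinity>"
      using envelope_integral cone.emeasure_finite[of UNIV]
      by (simp add: ennreal_mult_less_top ennreal_mult_eq_top_iff less_top[symmetric])
    show "AE w in cone_measure. (\<lambda>j. polar_energy (S j) w) \<longlonglongrightarrow> limit_energy w"
      using AE_cone_measure_norm by eventually_elim (intro polar_energy_tendsto S)
  qed auto
qed simp

lemma limit_energy_integral:
  fixes k :: 'n
  shows "(\<integral>\<^sup>+w. limit_energy w \<partial>cone_measure) = (\<integral>\<^sup>+x. ennreal (a x x / p x x) *
     (ennreal (norm (g x) powr p x x) * (\<integral>\<^sup>+w. ennreal (\<bar>w $ k\<bar> powr p x x) \<partial>cone_measure)) \<partial>lborel)"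
proof -
  interpret cone: finite_measure "cone_measure :: (real ^ 'n) measure" by (rule finite_measure_cone_measure)
  interpret P: pair_sigma_finite "cone_measure :: (real ^ 'n) measure" "lborel :: (real ^ 'n) measure" ..
  have L: "limit_energy w = (\<integral>\<^sup>+x. ennreal (a x x / p x x) * ennreal (\<bar>g x \<bullet> w\<bar> powr p x x) \<partial>lborel)" for w
  proof -
    have "limit_energy w = (\<integral>\<^sup>+\<tau>. \<integral>\<^sup>+x. indicator {0<..} \<tau> * ennreal (a x x * \<bar>g x \<bullet> w\<bar> powr p x x * exp (- (\<tau> * p x x))) \<partial>lborel \<partial>lborel)"
      unfolding limit_energy_def shifted_modular_def by (intro nn_integral_cong, subst nn_integral_cmult) auto
    also have "\<dots> = (\<integral>\<^sup>+x. \<integral>\<^sup>+\<tau>. indicator {0<..} \<tau> * ennreal (a x x * \<bar>g x \<bullet> w\<bar> powr p x x * exp (- (\<tau> * p x x))) \<partial>lborel \<partial>lborel)"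
      by (rule lborel_pair.Fubini') measurable
    also have "\<dots> = (\<integral>\<^sup>+x. ennreal (a x x / p x x) * ennreal (\<bar>g x \<bullet> w\<bar> powr p x x) \<partial>lborel)"
    proof (rule nn_integral_cong)
      fix x
      have "(\<integral>\<^sup>+\<tau>. indicator {0<..} \<tau> * ennreal (a x x * \<bar>g x \<bullet> w\<bar> powr p x x * exp (- (\<tau> * p x x))) \<partial>lborel)
          = (\<integral>\<^sup>+\<tau>. ennreal (a x x * \<bar>g x \<bullet> w\<bar> powr p x x) * (ennreal (exp (- (p x x * \<tau>))) * indicator {0<..} \<tau>) \<partial>lborel)"
        using a_nonneg by (intro nn_integral_cong) (simp add: ennreal_mult mult_ac)
      also have "\<dots> = ennreal (a x x * \<bar>g x \<bullet> w\<bar> powr p x x) * ennreal (exp (- (p x x * 0)) / p x x)"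
        by (subst nn_integral_cmult, measurable) (simp only: nn_integral_exp_greaterThan[OF p_pos(1)])
      also have "\<dots> = ennreal (a x x / p x x) * ennreal (\<bar>g x \<bullet> w\<bar> powr p x x)"
        using a_nonneg(1)[of x x] p_pos(1)[of x x] by (simp add: ennreal_mult[symmetric])
      finally show "(\<integral>\<^sup>+\<tau>. indicator {0<..} \<tau> * ennreal (a x x * \<bar>g x \<bullet> w\<bar> powr p x x * exp (- (\<tau> * p x x))) \<partial>lborel)
         = ennreal (a x x / p x x) * ennreal (\<bar>g x \<bullet> w\<bar> powr p x x)" .
    qed
    finally show ?thesis .
  qed
  have "(\<integral>\<^sup>+w. limit_energy w \<partial>cone_measure) = (\<integral>\<^sup>+x. \<integral>\<^sup>+w. ennreal (a x x / p x x) * ennreal (\<bar>g x \<bullet> w\<bar> powr p x x) \<partial>cone_measure \<partial>lborel)"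
    unfolding L by (rule P.Fubini'[symmetric]) measurable
  also have "\<dots> = (\<integral>\<^sup>+x. ennreal (a x x / p x x) * (\<integral>\<^sup>+w. ennreal (\<bar>g x \<bullet> w\<bar> powr p x x) \<partial>cone_measure) \<partial>lborel)"
    by (intro nn_integral_cong nn_integral_cmult) measurable
  also have "\<dots> = (\<integral>\<^sup>+x. ennreal (a x x / p x x) * (ennreal (norm (g x) powr p x x) * (\<integral>\<^sup>+w. ennreal (\<bar>w $ k\<bar> powr p x x) \<partial>cone_measure)) \<partial>lborel)"
    by (simp only: nn_integral_cone_measure_inner_powr[OF p_pos(1), of _ _ _ k])
  finally show ?thesis .
qed

lemma limit_energy_eq_H_0:
  fixes k :: 'n
  shows "(\<integral>\<^sup>+w. limit_energy w \<partial>cone_measure) = (\<integral>\<^sup>+x. ennreal (H_0 k a p x (norm (g x))) \<partial>lborel)"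
  unfolding limit_energy_integral[of k]
proof (rule nn_integral_cong)
  fix x
  interpret cone: finite_measure "cone_measure :: (real ^ 'n) measure" by (rule finite_measure_cone_measure)
  let ?H = "hausdorff_measure (CARD('n) - 1) :: (real ^ 'n) measure"
  let ?P = "p x x"
  let ?c = "\<integral>\<^sup>+w. ennreal (\<bar>w $ k\<bar> powr ?P) \<partial>(cone_measure :: (real ^ 'n) measure)"
  have S[measurable]: "sphere (0::real ^ 'n) 1 \<in> sets borel" by simp
  have "?c \<le> (\<integral>\<^sup>+w. 1 \<partial>(cone_measure :: (real ^ 'n) measure))"
  proof (rule nn_integral_mono_AE)
    show "AE w in cone_measure. ennreal (\<bar>w $ k\<bar> powr ?P) \<le> 1"
      using AE_cone_measure_norm
    proof eventually_elim
      case (elim w)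
      have "\<bar>w $ k\<bar> powr ?P \<le> 1 powr ?P" using component_le_norm_cart[of w k] elim p_pos(1)[of x x] by (intro powr_mono2) auto
      then show ?case by simp
    qed
  qed
  also have "\<dots> < \<infinity>" using cone.emeasure_finite[of UNIV] by (simp add: less_top[symmetric])
  finally have cfin: "?c < \<infinity>" .
  have "(LINT w : sphere 0 1 | ?H. \<bar>w $ k\<bar> powr ?P) = enn2real (\<integral>\<^sup>+w. ennreal (indicator (sphere 0 1) w *\<^sub>R (\<bar>w $ k\<bar> powr ?P)) \<partial>?H)"
    unfolding set_lebesgue_integral_def by (rule integral_eq_nn_integral) auto
  also have "(\<integral>\<^sup>+w. ennreal (indicator (sphere 0 1) w *\<^sub>R (\<bar>w $ k\<bar> powr ?P)) \<partial>?H) = (\<integral>\<^sup>+w. ennreal (\<bar>w $ k\<bar> powr ?P) * indicator (sphere 0 1) w \<partial>?H)"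
    by (intro nn_integral_cong) (simp split: split_indicator)
  also have "\<dots> = ?c" by (rule nn_integral_hausdorff_sphere) measurable
  finally have K: "K_const k a p x = a x x / ?P * enn2real ?c" by (simp add: K_const_def)
  have "0 \<le> a x x / ?P" using a_nonneg(1)[of x x] p_pos(1)[of x x] by simp
  then have "ennreal (H_0 k a p x (norm (g x))) = ennreal (a x x / ?P) * (ennreal (norm (g x) powr ?P) * ennreal (enn2real ?c))"
    by (simp add: H_0_def K ennreal_mult[symmetric] mult_ac)
  also have "ennreal (enn2real ?c) = ?c" using cfin by (simp add: less_top)
  finally show "ennreal (a x x / ?P) * (ennreal (norm (g x) powr ?P) * ?c) = ennreal (H_0 k a p x (norm (g x)))" ..
qed

end


section \<open>The limit of the energies\<close>

lemma AE_lborel_pairI: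
  fixes P :: "'a::euclidean_space \<Rightarrow> bool"
  assumes "AE x in lborel. P x"
  shows "AE z in lborel \<Otimes>\<^sub>M lborel. P (fst z) \<and> P (snd z)"
proof -
  obtain N where N: "{x. \<not> P x} \<subseteq> N" "N \<in> null_sets lborel"
    using assms by (auto simp: eventually_ae_filter)
  have [measurable]: "N \<in> sets borel" using N(2) by auto
  have ae: "AE x in lborel. x \<notin> N" using N(2) by (rule AE_not_in)
  have "AE z in lborel \<Otimes>\<^sub>M lborel. fst z \<notin> N \<and> snd z \<notin> N"
  proof (rule lborel_pair.AE_pair_measure)
    show "{z \<in> space (lborel \<Otimes>\<^sub>M lborel). fst z \<notin> N \<and> snd z \<notin> N} \<in> sets (lborel \<Otimes>\<^sub>M lborel)" by measurable
    show "AE x in lborel. AE y in lborel. fst (x, y) \<notin> N \<and> snd (x, y) \<notin> N"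
      using ae by eventually_elim (use ae in simp)
  qed
  then show ?thesis by eventually_elim (use N(1) in blast)
qed

lemma weak_gradient_line_inner:
  fixes u :: "real ^ 'n::finite \<Rightarrow> real" and g :: "real ^ 'n \<Rightarrow> real ^ 'n"
  assumes u: "loc_integrable u" and g: "\<And>i. loc_integrable (\<lambda>x. g x $ i)"
    and weak: "\<And>\<phi> i. test_function \<phi> \<Longrightarrow>
      (\<integral>x. u x * partial_deriv i \<phi> x \<partial>lborel) = - (\<integral>x. g x $ i * \<phi> x \<partial>lborel)"
  shows "AE x in lborel. integrable lborel (\<lambda>t. indicator {0..1} t * (g (x + t *\<^sub>R h) \<bullet> h)) \<and>
        u (x + h) - u x = (\<integral>t. indicator {0..1} t * (g (x + t *\<^sub>R h) \<bullet> h) \<partial>lborel)"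
proof -
  have "AE x in lborel. (\<forall>i. integrable lborel (\<lambda>t. indicator {0..1::real} t * (g (x + t *\<^sub>R h) $ i))) \<and>
    u (x + h) - u x = (\<Sum>i\<in>UNIV. h $ i * (\<integral>t. indicator {0..1} t * (g (x + t *\<^sub>R h) $ i) \<partial>lborel))"
    by (rule weak_gradient_line[OF u g weak])
  then show ?thesis
  proof eventually_elim
    case (elim x)
    have e: "indicator {0..1} t * (g (x + t *\<^sub>R h) \<bullet> h) = (\<Sum>i\<in>UNIV. h $ i * (indicator {0..1} t * (g (x + t *\<^sub>R h) $ i)))" for t :: real
      by (simp add: inner_vec_def sum_distrib_left mult_ac)
    show ?case unfolding e using elim by simp
  qed
qed

lemma powr_integral_Lebesgue_space:
  fixes f :: "'a::euclidean_space \<Rightarrow> 'b::euclidean_space" and f' :: "'a \<Rightarrow> real"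
  assumes f: "f \<in> Lebesgue_space q" and e: "AE x in lborel. norm (f x) = \<bar>f' x\<bar>"
  shows "powr_integral q f' < \<infinity>"
proof -
  have "integrable lebesgue (\<lambda>x. norm (f x) powr q)" using f by (simp add: Lebesgue_space_def)
  then have "(\<integral>\<^sup>+x. ennreal (norm (norm (f x) powr q)) \<partial>lebesgue) < \<infinity>" by (simp only: integrable_iff_bounded)
  then have "(\<integral>\<^sup>+x. ennreal (norm (f x) powr q) \<partial>lborel) < \<infinity>" by (simp add: nn_integral_completion)
  also have "(\<integral>\<^sup>+x. ennreal (norm (f x) powr q) \<partial>lborel) = powr_integral q f'"
    unfolding powr_integral_def using e by (intro nn_integral_cong_AE) (auto elim!: eventually_mono)
  finally show ?thesis .
qed

theorem proposition4p3:
  fixes p a :: "real ^ 'n::finite \<Rightarrow> real ^ 'n \<Rightarrow> real"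
    and p_minus p_plus a_minus a_plus :: real
    and u :: "real ^ 'n \<Rightarrow> real"
    and k :: 'n
  assumes p_measurable: "(\<lambda>(x, y). p x y) \<in> borel_measurable lebesgue"
    and p_continuous: "\<And>x. continuous_on UNIV (\<lambda>y. p x y)"
    and p_minus: "1 < p_minus"
    and p_bounds: "\<And>x y. p_minus \<le> p x y \<and> p x y \<le> p_plus"
    and a_measurable: "(\<lambda>(x, y). a x y) \<in> borel_measurable lebesgue"
    and a_continuous: "\<And>x. continuous_on UNIV (\<lambda>y. a x y)"
    and a_minus: "0 < a_minus"
    and a_bounds: "\<And>x y. a_minus \<le> a x y \<and> a x y \<le> a_plus"
    and u: "u \<in> Sobolev_space p_plus \<inter> Sobolev_space p_minus"
  shows "((\<lambda>s. ennreal (1 - s) * frac_energy a p s u) \<longlongrightarrow>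
           (\<integral>\<^sup>+ x. ennreal (H_0 k a p x (norm (weak_gradient u x))) \<partial>lebesgue)) (at_left 1)"
proof -
  define G where "G = weak_gradient u"
  obtain gp where gp: "is_weak_gradient u gp" "gp \<in> Lebesgue_space p_plus" using u by (auto simp: Sobolev_space_def)
  obtain gq where gq: "is_weak_gradient u gq" "gq \<in> Lebesgue_space p_minus" using u by (auto simp: Sobolev_space_def)
  have uL: "u \<in> Lebesgue_space p_plus" "u \<in> Lebesgue_space p_minus" using u by (auto simp: Sobolev_space_def)
  have G: "is_weak_gradient u G" unfolding G_def weak_gradient_def by (rule someI[of _ gp]) (rule gp)
  obtain u' g' where lu: "loc_integrable u'" and lg: "\<And>i. loc_integrable (\<lambda>x. g' x $ i)"
    and gm: "g' \<in> borel_measurable borel"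
    and ueq: "AE x in lborel. u x = u' x" and geq: "AE x in lborel. G x = g' x"
    and weak: "\<And>\<phi> i. test_function \<phi> \<Longrightarrow> (\<integral>x. u' x * partial_deriv i \<phi> x \<partial>lborel) = - (\<integral>x. g' x $ i * \<phi> x \<partial>lborel)"
    using weak_gradient_borel[OF G] by blast
  obtain Np where Np: "Np \<in> null_sets lborel"
    and p'm: "(\<lambda>(x, y). if x \<in> Np then p_minus else p x y) \<in> borel_measurable (borel \<Otimes>\<^sub>M borel)"
    by (rule caratheodory_function_borel[OF p_measurable p_continuous])
  obtain Na where Na: "Na \<in> null_sets lborel"
    and a'm: "(\<lambda>(x, y). if x \<in> Na then a_minus else a x y) \<in> borel_measurable (borel \<Otimes>\<^sub>M borel)"
    by (rule caratheodory_function_borel[OF a_measurable a_continuous])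
  define p' where "p' = (\<lambda>x y. if x \<in> Np then p_minus else p x y)"
  define a' where "a' = (\<lambda>x y. if x \<in> Na then a_minus else a x y)"
  (* the gradients in the two Lebesgue spaces and the chosen one agree almost everywhere *)
  have gG: "AE x in lborel. norm (gp x) = \<bar>norm (g' x)\<bar>" "AE x in lborel. norm (gq x) = \<bar>norm (g' x)\<bar>"
    using weak_gradient_unique[OF gp(1) G] weak_gradient_unique[OF gq(1) G] geq by (eventually_elim, simp)+
  interpret nonlocal_energy p' a' p_minus p_plus a_plus u' g'
  proof
    show "(\<lambda>(x, y). p' x y) \<in> borel_measurable (borel \<Otimes>\<^sub>M borel)" using p'm by (simp add: p'_def)
    show "(\<lambda>(x, y). a' x y) \<in> borel_measurable (borel \<Otimes>\<^sub>M borel)" using a'm by (simp add: a'_def)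
    show "continuous_on UNIV (p' x)" for x using p_continuous[of x] by (cases "x \<in> Np") (simp_all add: p'_def)
    show "continuous_on UNIV (a' x)" for x using a_continuous[of x] by (cases "x \<in> Na") (simp_all add: a'_def)
    show "p_minus \<le> p' x y \<and> p' x y \<le> p_plus" for x y using p_bounds[of x y] by (auto simp: p'_def)
    show "0 < a' x y \<and> a' x y \<le> a_plus" for x y using a_bounds[of x y] a_minus by (auto simp: a'_def)
    show "u' \<in> borel_measurable borel" using lu by (rule loc_integrable_measurable)
    have "AE x in lborel. norm (u x) = \<bar>u' x\<bar>" using ueq by eventually_elim simp
    then show "powr_integral p_minus u' < \<infinity>" "powr_integral p_plus u' < \<infinity>"
      using powr_integral_Lebesgue_space uL by blast+
    show "powr_integral p_minus (\<lambda>x. norm (g' x)) < \<infinity>" "powr_integral p_plus (\<lambda>x. norm (g' x)) < \<infinity>"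
      using powr_integral_Lebesgue_space[OF gp(2) gG(1)] powr_integral_Lebesgue_space[OF gq(2) gG(2)] by auto
    show "AE x in lborel. integrable lborel (\<lambda>t. indicator {0..1} t * (g' (x + t *\<^sub>R h) \<bullet> h)) \<and>
        u' (x + h) - u' x = (\<integral>t. indicator {0..1} t * (g' (x + t *\<^sub>R h) \<bullet> h) \<partial>lborel)" for h
      by (rule weak_gradient_line_inner[OF lu lg weak])
  qed (use p_minus gm in auto)
  let ?K = "\<lambda>a p u s x y. ennreal (a x y * (\<bar>u x - u y\<bar> powr p x y / norm (x - y) powr (real CARD('n) + s * p x y)))"
  have good: "AE x in lborel. x \<notin> Np \<and> x \<notin> Na \<and> u x = u' x \<and> G x = g' x"
    using AE_not_in[OF Np] AE_not_in[OF Na] ueq geq by eventually_elim simp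
  have energy: "frac_energy a p s u = (\<integral>\<^sup>+x. \<integral>\<^sup>+y. ?K a' p' u' s x y \<partial>lborel \<partial>lborel)" for s
  proof -
    have "frac_energy a p s u = (\<integral>\<^sup>+(x, y). ?K a p u s x y \<partial>(lborel \<Otimes>\<^sub>M lborel))"
      unfolding frac_energy_def nn_integral_completion lborel_prod ..
    also have "\<dots> = (\<integral>\<^sup>+(x, y). ?K a' p' u' s x y \<partial>(lborel \<Otimes>\<^sub>M lborel))"
    proof (rule nn_integral_cong_AE)
      show "AE z in lborel \<Otimes>\<^sub>M lborel. (case z of (x, y) \<Rightarrow> ?K a p u s x y) = (case z of (x, y) \<Rightarrow> ?K a' p' u' s x y)"
        using AE_lborel_pairI[OF good] by eventually_elim (auto simp: p'_def a'_def)
    qed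
    also have "\<dots> = (\<integral>\<^sup>+x. \<integral>\<^sup>+y. ?K a' p' u' s x y \<partial>lborel \<partial>lborel)"
    proof -
      have "(\<lambda>(x, y). ?K a' p' u' s x y) \<in> borel_measurable (lborel \<Otimes>\<^sub>M lborel)" by measurable
      from lborel.nn_integral_fst[OF this] show ?thesis by simp
    qed
    finally show ?thesis .
  qed
  have limit: "(\<integral>\<^sup>+x. ennreal (H_0 k a p x (norm (weak_gradient u x))) \<partial>lebesgue) = (\<integral>\<^sup>+w. limit_energy w \<partial>cone_measure)"
    unfolding limit_energy_eq_H_0[of k] nn_integral_completion G_def[symmetric]
  proof (rule nn_integral_cong_AE)
    show "AE x in lborel. ennreal (H_0 k a p x (norm (G x))) = ennreal (H_0 k a' p' x (norm (g' x)))"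
      using good by eventually_elim (simp add: H_0_def K_const_def p'_def a'_def)
  qed
  show ?thesis
    unfolding energy limit by (rule energy_tendsto)
qed

end
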